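(* Let $\Gamma$ be a finitely generated virtually free group acting measure preservingly on a standard probability space $(X,\mu)$. Let $G,H\leq\Gamma$ be finite index free subgroups, and let them act on $(X,\mu)$ by restricting the $\Gamma$ action. Assume that there is a finite Shannon entropy generating partition for $\Gamma\curvearrowright(X,\mu)$. Then $f_G(X,\mu)$ and $f_H(X,\mu)$ are defined and $$\frac{1}{|\Gamma:G|}\cdot f_G(X,\mu)=\frac{1}{|\Gamma:H|}\cdot f_H(X,\mu).$$ Furthermore, if $\Gamma$ is itself free then the common value $\frac{1}{|\Gamma:G|}\cdot f_G(X,\mu)=\frac{1}{|\Gamma:H|}\cdot f_H(X,\mu)$ is $f_\Gamma(X,\mu)$.
   Context: A group is virtually free if it contains a free subgroup of finite index. For a countable measurable partition $\alpha$ of $X$, a group element $g$ and a finite set $F$ of group elements, put $g\cdot\alpha=\{g\cdot A : A\in\alpha\}$ and $F\cdot\alpha=\bigvee_{f\in F} f\cdot\alpha$ (join of partitions). The Shannon entropy is $\mathrm{H}(\alpha)=\sum_{A\in\alpha}-\mu(A)\log\mu(A)$. A countable measurable partition $\alpha$ is generating for an action of a group if the smallest invariant $\sigma$-algebra containing $\alpha$ contains all measurable sets up to null sets. f-invariant entropy: let $G$ be a finitely generated free group with free generating set $S$, $r=|S|$, acting measure preservingly on a standard probability space $(X,\mu)$. For $\alpha$ with $\mathrm{H}(\alpha)<\infty$ set $F_G(X,\mu,S,\alpha)=(1-2r)\mathrm{H}(\alpha)+\sum_{s\in S}\mathrm{H}(s\cdot\alpha\vee\alpha)$. Let $B_S(n)$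 be the ball of radius $n$ about $1_G$ for the $S$-word length. If there is a generating partition $\alpha$ with $\mathrm{H}(\alpha)<\infty$, define $f_G(X,\mu)=\lim_{n\to\infty}F_G(X,\mu,S,B_S(n)\cdot\alpha)$; otherwise $f_G(X,\mu)$ is undefined. By theorems of Bowen the sequence is non-increasing, so the limit exists in $[-\infty,\infty)$, and it does not depend on the choice of $S$ or of the finite Shannon entropy generating partition $\alpha$. *)

theory Defs
  imports "HOL-Probability.Probability" "HOL-Algebra.Algebra"
begin

section \<open>Free and virtually free groups\<close>

text \<open>A word over \<open>S\<close> is a list of letters \<open>(b, s)\<close> with \<open>s \<in> S\<close>; the letter \<open>(True, s)\<close> stands
  for \<open>s\<close> and \<open>(False, s)\<close> for the formal inverse of \<open>s\<close>.\<close>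

definition words_on :: "'g set \<Rightarrow> (bool \<times> 'g) list set" where
  "words_on S = lists (UNIV \<times> S)"

definition reduced_words_on :: "'g set \<Rightarrow> (bool \<times> 'g) list set" where
  "reduced_words_on S =
     {w \<in> words_on S. successively (\<lambda>x y. \<not> (snd x = snd y \<and> fst x \<noteq> fst y)) w}"

definition word_value :: "('g, 'm) monoid_scheme \<Rightarrow> (bool \<times> 'g) list \<Rightarrow> 'g" where
  "word_value G w =
     foldr (\<lambda>(b, s) g. (if b then s else inv\<^bsub>G\<^esub> s) \<otimes>\<^bsub>G\<^esub> g) w \<one>\<^bsub>G\<^esub>"

text \<open>\<open>S\<close> freely generates \<open>G\<close>: the canonical map from the free group on \<open>S\<close>, realised by the reduced
  words over \<open>S\<close>, to \<open>G\<close> is bijective. The trivial group is free on the empty set.\<close>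

definition free_generating_set :: "('g, 'm) monoid_scheme \<Rightarrow> 'g set \<Rightarrow> bool" where
  "free_generating_set G S \<longleftrightarrow>
     S \<subseteq> carrier G \<and> bij_betw (word_value G) (reduced_words_on S) (carrier G)"

definition free_group :: "('g, 'm) monoid_scheme \<Rightarrow> bool" where
  "free_group G \<longleftrightarrow> group G \<and> (\<exists>S. free_generating_set G S)"

definition finitely_generated_group :: "('g, 'm) monoid_scheme \<Rightarrow> bool" where
  "finitely_generated_group G \<longleftrightarrow>
     group G \<and> (\<exists>S. finite S \<and> S \<subseteq> carrier G \<and> generate G S = carrier G)"

definition finite_index_subgroup :: "('g, 'm) monoid_scheme \<Rightarrow> 'g set \<Rightarrow> bool" where
  "finite_index_subgroup G K \<longleftrightarrow> subgroup K G \<and> finite (rcosets\<^bsub>G\<^esub> K)"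

definition subgroup_index :: "('g, 'm) monoid_scheme \<Rightarrow> 'g set \<Rightarrow> nat" where
  "subgroup_index G K = card (rcosets\<^bsub>G\<^esub> K)"

definition virtually_free_group :: "('g, 'm) monoid_scheme \<Rightarrow> bool" where
  "virtually_free_group G \<longleftrightarrow>
     group G \<and> (\<exists>K. finite_index_subgroup G K \<and> free_group (G\<lparr>carrier := K\<rparr>))"

definition word_ball :: "('g, 'm) monoid_scheme \<Rightarrow> 'g set \<Rightarrow> nat \<Rightarrow> 'g set" where
  "word_ball G S n = word_value G ` {w \<in> words_on S. length w \<le> n}"


section \<open>Measure preserving actions on standard probability spaces\<close>

text \<open>A standard probability space is a standard Borel space (the Borel sets of a Polish topology)
  with a probability measure on it; the measure is not completed.\<close>

definition standard_prob_space :: "'x measure \<Rightarrow> bool" where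
  "standard_prob_space M \<longleftrightarrow> prob_space M \<and>
     (\<exists>T. completely_metrizable_space T \<and> separable_space T \<and> topspace T = space M \<and>
          sets M = sigma_sets (space M) {U. openin T U})"

definition pmp_action ::
  "('g, 'm) monoid_scheme \<Rightarrow> 'x measure \<Rightarrow> ('g \<Rightarrow> 'x \<Rightarrow> 'x) \<Rightarrow> bool" where
  "pmp_action G M \<phi> \<longleftrightarrow> group_action G (space M) \<phi> \<and>
     (\<forall>g \<in> carrier G. \<phi> g \<in> measurable M M \<and> distr M M (\<phi> g) = M)"


section \<open>Partitions and Shannon entropy\<close>

definition countable_measurable_partition :: "'x measure \<Rightarrow> 'x set set \<Rightarrow> bool" where
  "countable_measurable_partition M \<alpha> \<longleftrightarrow>
     countable \<alpha> \<and> \<alpha> \<subseteq> sets M \<and> partition_on (space M) \<alpha>"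

definition shannon_entropy :: "'x measure \<Rightarrow> 'x set set \<Rightarrow> ereal" where
  "shannon_entropy M \<alpha> = (\<Sum>\<^sub>\<infinity>A\<in>\<alpha>. ereal (- measure M A * ln (measure M A)))"

definition translate_partition :: "('g \<Rightarrow> 'x \<Rightarrow> 'x) \<Rightarrow> 'g \<Rightarrow> 'x set set \<Rightarrow> 'x set set" where
  "translate_partition \<phi> g \<alpha> = (\<lambda>A. \<phi> g ` A) ` \<alpha>"

definition join_translates :: "('g \<Rightarrow> 'x \<Rightarrow> 'x) \<Rightarrow> 'g set \<Rightarrow> 'x set set \<Rightarrow> 'x set set" where
  "join_translates \<phi> F \<alpha> = common_refinement ((\<lambda>g. translate_partition \<phi> g \<alpha>) ` F)"

definition invariant_sigma_algebra ::
  "('g, 'm) monoid_scheme \<Rightarrow> 'x measure \<Rightarrow> ('g \<Rightarrow> 'x \<Rightarrow> 'x) \<Rightarrow> 'x set set \<Rightarrow> bool" where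
  "invariant_sigma_algebra G M \<phi> \<A> \<longleftrightarrow>
     sigma_algebra (space M) \<A> \<and> (\<forall>g \<in> carrier G. \<forall>A \<in> \<A>. \<phi> g ` A \<in> \<A>)"

definition generating_partition ::
  "('g, 'm) monoid_scheme \<Rightarrow> 'x measure \<Rightarrow> ('g \<Rightarrow> 'x \<Rightarrow> 'x) \<Rightarrow> 'x set set \<Rightarrow> bool" where
  "generating_partition G M \<phi> \<alpha> \<longleftrightarrow> countable_measurable_partition M \<alpha> \<and>
     (\<forall>B \<in> sets M. \<exists>C \<in> invariant_sigma_algebra G M \<phi> hull \<alpha>. sym_diff B C \<in> null_sets M)"

definition finite_entropy_generating_partition ::
  "('g, 'm) monoid_scheme \<Rightarrow> 'x measure \<Rightarrow> ('g \<Rightarrow> 'x \<Rightarrow> 'x) \<Rightarrow> 'x set set \<Rightarrow> bool" where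
  "finite_entropy_generating_partition G M \<phi> \<alpha> \<longleftrightarrow>
     generating_partition G M \<phi> \<alpha> \<and> shannon_entropy M \<alpha> < \<infinity>"


section \<open>The f-invariant\<close>

text \<open>Only meaningful for finite \<open>S\<close> and for \<open>\<alpha>\<close> of finite entropy.\<close>

definition F_entropy ::
  "'x measure \<Rightarrow> ('g \<Rightarrow> 'x \<Rightarrow> 'x) \<Rightarrow> 'g set \<Rightarrow> 'x set set \<Rightarrow> ereal" where
  "F_entropy M \<phi> S \<alpha> = ereal (1 - 2 * real (card S)) * shannon_entropy M \<alpha> +
     (\<Sum>s\<in>S. shannon_entropy M (common_refinement {translate_partition \<phi> s \<alpha>, \<alpha>}))"

definition f_invariant_defined ::
  "('g, 'm) monoid_scheme \<Rightarrow> 'x measure \<Rightarrow> ('g \<Rightarrow> 'x \<Rightarrow> 'x) \<Rightarrow> bool" where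
  "f_invariant_defined G M \<phi> \<longleftrightarrow>
     (\<exists>S. finite S \<and> free_generating_set G S) \<and>
     (\<exists>\<alpha>. finite_entropy_generating_partition G M \<phi> \<alpha>)"

definition has_f_invariant ::
  "('g, 'm) monoid_scheme \<Rightarrow> 'x measure \<Rightarrow> ('g \<Rightarrow> 'x \<Rightarrow> 'x) \<Rightarrow> ereal \<Rightarrow> bool" where
  "has_f_invariant G M \<phi> v \<longleftrightarrow>
     (\<exists>S \<alpha>. finite S \<and> free_generating_set G S \<and>
        finite_entropy_generating_partition G M \<phi> \<alpha> \<and>
        (\<lambda>n. F_entropy M \<phi> S (join_translates \<phi> (word_ball G S n) \<alpha>)) \<longlonglongrightarrow> v)"

text \<open>By theorems of Bowen the limit in \<^const>\<open>has_f_invariant\<close> exists in \<open>[-\<infinity>, \<infinity>)\<close> and depends on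
  neither \<open>S\<close> nor \<open>\<alpha>\<close>, so the definite description denotes whenever
  \<^const>\<open>f_invariant_defined\<close> holds; otherwise the value is arbitrary.\<close>

definition f_invariant ::
  "('g, 'm) monoid_scheme \<Rightarrow> 'x measure \<Rightarrow> ('g \<Rightarrow> 'x \<Rightarrow> 'x) \<Rightarrow> ereal" where
  "f_invariant G M \<phi> = (THE v. has_f_invariant G M \<phi> v)"

end

theory Submission
  imports Defs
begin

text \<open>The functional \<open>F\<close> makes sense for every finite graph with group labels and one family of
  observables per vertex: add the entropies of the vertices and subtract the mutual information along
  each edge. The one-vertex graph with loops labelled by a free basis gives the functional defining
  the f-invariant, and passing to the covering graph of a subgroup \<open>K\<close> multiplies it by the index of
  \<open>K\<close>. Take \<open>K = G \<inter> H\<close>: the \<open>K\<close>-cover of the graph of \<open>G\<close> folds, in the sense of Stallings, onto the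
  Schreier graph of \<open>K\<close> in the free group \<open>H\<close>, and no subdivision, slide or contraction of an edge
  increases \<open>F\<close> when the observables are enlarged suitably. Hence the value for \<open>G\<close> bounds the value of
  \<open>F\<close> on the Schreier graph for some generating observables. Since a generating partition determines
  every other partition up to small conditional entropy, that value bounds the limit for \<open>H\<close> and any
  generating partition. By symmetry the two normalised invariants agree; the case \<open>G = H\<close> is the
  independence of the basis and of the partition.\<close>

text \<open>Writing I for mutual information and using invariance,
  \<open>(1 - 2 * r) * H(x) + \<Sum> H(s x, x)\<close> equals
  \<open>H(x) - \<Sum> I(x; s x)\<close>: Bowen's functional is an Euler characteristic weighted by
  entropy, so it should be multiplicative under covers. Two obstacles shape the proof. The cover of
  the graph of \<open>G\<close> and the Schreier graph of \<open>K\<close> in \<open>H\<close> share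
  only the group \<open>K\<close>: the labels of the former are elements of \<open>K\<close>, not
  letters of the basis of \<open>H\<close>, and have to be respelled. Moreover, identifying two
  edges with the same two ends would lose a mutual-information term and could raise the functional.
  The graphs therefore carry a certificate that their covers have no cycles and are as connected as
  the positions allow. Every move preserves it, which makes folding a homotopy equivalence. Limits
  may be minus infinity, so finite stages are compared, with an error that tends to zero. The graph
  argument uses only that joint entropy is monotone, submodular and invariant and vanishes on the
  empty set; measure theory enters later, to supply such a function.\<close>

section \<open>Words\<close>

lemma word_value_Nil [simp]: "word_value G [] = \<one>\<^bsub>G\<^esub>"
  by (simp add: word_value_def)

lemma word_value_Cons [simp]:
  "word_value G ((b, s) # w) = (if b then s else inv\<^bsub>G\<^esub> s) \<otimes>\<^bsub>G\<^esub> word_value G w"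
  by (simp add: word_value_def)

definition inverse_word :: "(bool \<times> 'a) list \<Rightarrow> (bool \<times> 'a) list" where
  "inverse_word w = rev (map (\<lambda>(b, s). (\<not> b, s)) w)"

lemma inverse_word_Nil [simp]: "inverse_word [] = []"
  by (simp add: inverse_word_def)

lemma inverse_word_Cons [simp]: "inverse_word ((b, s) # w) = inverse_word w @ [(\<not> b, s)]"
  by (simp add: inverse_word_def)

lemma words_on_Nil [simp]: "[] \<in> words_on S"
  by (simp add: words_on_def)

lemma words_on_Cons [simp]: "(b, s) # w \<in> words_on S \<longleftrightarrow> s \<in> S \<and> w \<in> words_on S"
  by (auto simp: words_on_def)

lemma words_on_append [simp]: "v @ w \<in> words_on S \<longleftrightarrow> v \<in> words_on S \<and> w \<in> words_on S"
  by (auto simp: words_on_def)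

lemma words_on_mono: "S \<subseteq> T \<Longrightarrow> w \<in> words_on S \<Longrightarrow> w \<in> words_on T"
  by (auto simp: words_on_def)

context group
begin

lemma word_value_closed: "w \<in> words_on (carrier G) \<Longrightarrow> word_value G w \<in> carrier G"
proof (induction w)
  case (Cons p w) then show ?case by (cases p) auto
qed simp

lemma word_value_append:
  "v \<in> words_on (carrier G) \<Longrightarrow> w \<in> words_on (carrier G) \<Longrightarrow>
    word_value G (v @ w) = word_value G v \<otimes> word_value G w"
proof (induction v)
  case Nil then show ?case by (simp add: word_value_closed)
next
  case (Cons p v) then show ?case
    by (cases p) (auto simp: m_assoc word_value_closed)
qed

lemma inverse_word_in_words_on: "w \<in> words_on S \<Longrightarrow> inverse_word w \<in> words_on S"
proof (induction w)
  case (Cons p w) then show ?case by (cases p) auto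
qed simp

lemma word_value_inverse_word:
  "w \<in> words_on (carrier G) \<Longrightarrow> word_value G (inverse_word w) = inv (word_value G w)"
proof (induction w)
  case (Cons p w) then show ?case
    by (cases p)
      (auto simp: word_value_append word_value_closed inverse_word_in_words_on inv_mult_group)
qed simp

end


section \<open>Submodular set functions as abstract entropy: conditional increments and mutual
  information\<close>

section \<open>Invariant polymatroids\<close>

locale polymatroid =
  fixes W :: "'w set" and h :: "'w set \<Rightarrow> real"
  assumes h_mono: "finite B \<Longrightarrow> B \<subseteq> W \<Longrightarrow> A \<subseteq> B \<Longrightarrow> h A \<le> h B"
    and h_submodular: "finite A \<Longrightarrow> A \<subseteq> W \<Longrightarrow> finite B \<Longrightarrow> B \<subseteq> W \<Longrightarrow>
          h (A \<union> B) + h (A \<inter> B) \<le> h A + h B"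
begin

abbreviation fin :: "'w set \<Rightarrow> bool" where "fin A \<equiv> finite A \<and> A \<subseteq> W"

text \<open>Submodularity for \<open>Z \<union> B\<close> and \<open>B'\<close>, whose intersection
  still contains \<open>B\<close>. In terms of entropy: more conditioning never raises conditional
  entropy.\<close>

lemma increment_antimono:
  assumes "fin B'" "B \<subseteq> B'" "fin Z"
  shows "h (Z \<union> B') - h B' \<le> h (Z \<union> B) - h B"
proof -
  have "h ((Z \<union> B) \<union> B') + h ((Z \<union> B) \<inter> B') \<le> h (Z \<union> B) + h B'"
    using assms by (intro h_submodular) (auto intro: finite_subset)
  moreover have "h B \<le> h ((Z \<union> B) \<inter> B')" using assms by (intro h_mono) auto
  moreover have "(Z \<union> B) \<union> B' = Z \<union> B'" using assms by auto
  ultimately show ?thesis by simp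
qed

text \<open>In terms of entropy, the conditional entropy of \<open>w\<close> given everything
  generated by \<open>U\<close> is zero. Finite subsets are used because \<open>h\<close> is
  controlled on finite sets only.\<close>

definition determined_by :: "'w set \<Rightarrow> 'w \<Rightarrow> bool" where
  "determined_by U w \<longleftrightarrow> (\<forall>\<epsilon>>0. \<exists>B. finite B \<and> B \<subseteq> U \<and> h (insert w B) - h B < \<epsilon>)"

text \<open>The chain rule adds up the errors of the elements of \<open>Z\<close>. By
  \<open>increment_antimono\<close> the bound persists for every larger finite \<open>B'\<close>, so
  that one radius will serve all later balls.\<close>

lemma determined_by_finite:
  assumes "finite Z" "Z \<subseteq> W" "U \<subseteq> W" "\<And>w. w \<in> Z \<Longrightarrow> determined_by U w" "0 < \<epsilon>"
  shows "\<exists>B. finite B \<and> B \<subseteq> U \<and> (\<forall>B'. fin B' \<longrightarrow> B \<subseteq> B' \<longrightarrow> h (Z \<union> B') - h B' < \<epsilon>)"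
  using assms
proof (induction Z arbitrary: \<epsilon> rule: finite_induct)
  case empty
  then show ?case by (intro exI[of _ "{}"]) auto
next
  case (insert w Z)
  obtain B1 where B1: "finite B1" "B1 \<subseteq> U"
    "\<And>B'. fin B' \<Longrightarrow> B1 \<subseteq> B' \<Longrightarrow> h (Z \<union> B') - h B' < \<epsilon> / 2"
    using insert.IH[of "\<epsilon> / 2"] insert.prems by auto
  obtain B2 where B2: "finite B2" "B2 \<subseteq> U" "h (insert w B2) - h B2 < \<epsilon> / 2"
    using insert.prems unfolding determined_by_def by (metis half_gt_zero insertI1)
  have "h (insert w Z \<union> B') - h B' < \<epsilon>" if B': "fin B'" "B1 \<union> B2 \<subseteq> B'" for B'
  proof -
    have "h ({w} \<union> (Z \<union> B')) - h (Z \<union> B') \<le> h ({w} \<union> B2) - h B2"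
      using B' insert by (intro increment_antimono) auto
    moreover have "h (Z \<union> B') - h B' < \<epsilon> / 2" using B' by (intro B1) auto
    ultimately show ?thesis using B2(3) by simp
  qed
  then show ?case using B1 B2 by (intro exI[of _ "B1 \<union> B2"]) auto
qed

end

locale invariant_polymatroid = group G + polymatroid W h
  for G :: "('a, 'm) monoid_scheme" (structure) and W :: "'w set"
    and a :: "'a \<Rightarrow> 'w \<Rightarrow> 'w" and h :: "'w set \<Rightarrow> real" +
  assumes a_closed [simp]: "g \<in> carrier G \<Longrightarrow> w \<in> W \<Longrightarrow> a g w \<in> W"
    and a_one [simp]: "w \<in> W \<Longrightarrow> a \<one> w = w"
    and a_mult: "g \<in> carrier G \<Longrightarrow> k \<in> carrier G \<Longrightarrow> w \<in> W \<Longrightarrow> a (g \<otimes> k) w = a g (a k w)"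
    and h_invariant: "g \<in> carrier G \<Longrightarrow> finite A \<Longrightarrow> A \<subseteq> W \<Longrightarrow> h (a g ` A) = h A"
begin

text \<open>Mutual information of two sets of observables.\<close>

definition mi :: "'w set \<Rightarrow> 'w set \<Rightarrow> real" where
  "mi A B = h A + h B - h (A \<union> B)"

lemma fin_image [simp]: "g \<in> carrier G \<Longrightarrow> fin A \<Longrightarrow> fin (a g ` A)"
  by auto

lemma image_mult: "g \<in> carrier G \<Longrightarrow> k \<in> carrier G \<Longrightarrow> A \<subseteq> W \<Longrightarrow> a g ` a k ` A = a (g \<otimes> k) ` A"
  by (force simp: a_mult image_image)

lemma image_one: "A \<subseteq> W \<Longrightarrow> a \<one> ` A = A"
  by (force simp: image_iff)

lemma image_inv_image: "g \<in> carrier G \<Longrightarrow> A \<subseteq> W \<Longrightarrow> a (inv g) ` a g ` A = A"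
  by (simp add: image_mult image_one)

lemma image_image_inv: "g \<in> carrier G \<Longrightarrow> A \<subseteq> W \<Longrightarrow> a g ` a (inv g) ` A = A"
  by (simp add: image_mult image_one)

lemma mi_commute: "mi A B = mi B A"
  by (simp add: mi_def Un_commute)

text \<open>Submodularity for \<open>A'\<close> and \<open>A \<union> B\<close>: their union is
  \<open>A' \<union> B\<close> and their intersection contains \<open>A\<close>.\<close>

lemma mi_mono_left:
  assumes "fin A'" "fin B" "A \<subseteq> A'" shows "mi A B \<le> mi A' B"
proof -
  have "h (A' \<union> (A \<union> B)) + h (A' \<inter> (A \<union> B)) \<le> h A' + h (A \<union> B)"
    using assms by (intro h_submodular) (auto intro: finite_subset)
  moreover have "h A \<le> h (A' \<inter> (A \<union> B))"
    using assms by (intro h_mono) auto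
  moreover have "A' \<union> (A \<union> B) = A' \<union> B" using assms by auto
  ultimately show ?thesis by (simp add: mi_def)
qed

lemma mi_mono:
  assumes "fin A'" "fin B'" "A \<subseteq> A'" "B \<subseteq> B'" shows "mi A B \<le> mi A' B'"
proof -
  have "mi A B \<le> mi A' B" using assms by (intro mi_mono_left) (auto intro: finite_subset)
  also have "\<dots> \<le> mi A' B'" using assms mi_mono_left[of B' A' B] by (simp add: mi_commute)
  finally show ?thesis .
qed

lemma mi_absorb: "A \<subseteq> B \<Longrightarrow> mi A B = h A"
  by (simp add: mi_def Un_absorb1)

lemma mi_absorb': "B \<subseteq> A \<Longrightarrow> mi A B = h B"
  by (simp add: mi_def Un_absorb2)

lemma mi_nonneg: "fin A \<Longrightarrow> fin B \<Longrightarrow> h {} = 0 \<Longrightarrow> 0 \<le> mi A B"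
  using mi_mono[of A B "{}" "{}"] by (simp add: mi_def)

lemma mi_invariant: "g \<in> carrier G \<Longrightarrow> fin A \<Longrightarrow> fin B \<Longrightarrow> mi (a g ` A) (a g ` B) = mi A B"
  unfolding mi_def by (simp add: h_invariant flip: image_Un)

lemma mi_image_inv: "g \<in> carrier G \<Longrightarrow> fin A \<Longrightarrow> fin B \<Longrightarrow> mi (a (inv g) ` A) B = mi A (a g ` B)"
  using mi_invariant[of g "a (inv g) ` A" B] by (simp add: image_image_inv)

end


section \<open>Graphs of observables, the entropy functional on them, and the splitting
  inequality\<close>

section \<open>Labelled graphs\<close>

text \<open>\<open>lab\<close> is the group element that moves observables at the target so that
  they can be compared with those at the source. \<open>pos\<close> tells over which vertex of the
  eventual Schreier graph a vertex lies.\<close>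

record ('v, 'e, 'a, 'c) lgraph =
  verts :: "'v set"
  edges :: "'e set"
  src :: "'e \<Rightarrow> 'v"
  tgt :: "'e \<Rightarrow> 'v"
  lab :: "'e \<Rightarrow> 'a"
  pos :: "'v \<Rightarrow> 'c"

text \<open>\<open>(True, d)\<close> runs along \<open>d\<close> and \<open>(False, d)\<close>
  against it, as in words, so that \<open>letters\<close> turns a walk into a word over the
  labels.\<close>

fun walk :: "('v, 'e, 'a, 'c) lgraph \<Rightarrow> 'v \<Rightarrow> (bool \<times> 'e) list \<Rightarrow> 'v \<Rightarrow> bool" where
  "walk \<Delta> i [] j = (i = j)"
| "walk \<Delta> i ((b, d) # q) j = (d \<in> edges \<Delta> \<and> i = (if b then src \<Delta> d else tgt \<Delta> d) \<and>
     walk \<Delta> (if b then tgt \<Delta> d else src \<Delta> d) q j)"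

definition letters :: "('v, 'e, 'a, 'c) lgraph \<Rightarrow> (bool \<times> 'e) list \<Rightarrow> (bool \<times> 'a) list" where
  "letters \<Delta> q = map (\<lambda>(b, d). (b, lab \<Delta> d)) q"

lemma letters_simps [simp]:
  "letters \<Delta> [] = []"
  "letters \<Delta> ((b, d) # q) = (b, lab \<Delta> d) # letters \<Delta> q"
  "letters \<Delta> (q @ q') = letters \<Delta> q @ letters \<Delta> q'"
  by (auto simp: letters_def)

lemma letters_inverse_word [simp]: "letters \<Delta> (inverse_word q) = inverse_word (letters \<Delta> q)"
  by (auto simp: letters_def inverse_word_def rev_map)

lemma walk_append [simp]: "walk \<Delta> i (q @ q') j \<longleftrightarrow> (\<exists>k. walk \<Delta> i q k \<and> walk \<Delta> k q' j)"
proof (induction q arbitrary: i)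
  case (Cons p q) then show ?case by (cases p) auto
qed auto

lemma walk_inverse_word: "walk \<Delta> i q j \<Longrightarrow> walk \<Delta> j (inverse_word q) i"
proof (induction q arbitrary: i)
  case (Cons p q) then show ?case by (cases p) auto
qed auto

text \<open>In the application \<open>C\<close> is the set of cosets of the intersection of two
  subgroups in the one that is free on \<open>S\<close>, and \<open>r\<close> is right
  multiplication; the target of folding is the Schreier graph on \<open>C\<close>.\<close>

locale graph_folding = invariant_polymatroid G W a h
  for G :: "('a, 'm) monoid_scheme" (structure) and W :: "'w set" and a h +
  fixes S :: "'a set" and C :: "'c set" and r :: "'c \<Rightarrow> 'a \<Rightarrow> 'c"
  assumes S_carrier: "S \<subseteq> carrier G" and finite_S: "finite S" and finite_C: "finite C"
    and free: "free_generating_set G S"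
    and r_closed [simp]: "c \<in> C \<Longrightarrow> g \<in> carrier G \<Longrightarrow> r c g \<in> C"
    and r_one [simp]: "c \<in> C \<Longrightarrow> r c \<one> = c"
    and r_mult: "c \<in> C \<Longrightarrow> g \<in> carrier G \<Longrightarrow> k \<in> carrier G \<Longrightarrow> r c (g \<otimes> k) = r (r c g) k"
    and h_empty: "h {} = 0"

text \<open>An Euler characteristic weighted by entropy: each edge subtracts what its two ends share
  after transport by the label.\<close>

definition (in invariant_polymatroid) graph_F ::
  "('v, 'e, 'a, 'c) lgraph \<Rightarrow> ('v \<Rightarrow> 'w set) \<Rightarrow> real" where
  "graph_F \<Delta> P = (\<Sum>i\<in>verts \<Delta>. h (P i)) -
     (\<Sum>d\<in>edges \<Delta>. mi (P (src \<Delta> d)) (a (lab \<Delta> d) ` P (tgt \<Delta> d)))"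

definition (in group) wf_graph :: "('v, 'e, 'a, 'c) lgraph \<Rightarrow> bool" where
  "wf_graph \<Delta> \<longleftrightarrow> finite (verts \<Delta>) \<and> finite (edges \<Delta>) \<and>
     (\<forall>d\<in>edges \<Delta>. src \<Delta> d \<in> verts \<Delta> \<and> tgt \<Delta> d \<in> verts \<Delta> \<and> lab \<Delta> d \<in> carrier G)"

lemma (in group) wf_graphD:
  assumes "wf_graph \<Delta>"
  shows "finite (verts \<Delta>)" "finite (edges \<Delta>)" "d \<in> edges \<Delta> \<Longrightarrow> src \<Delta> d \<in> verts \<Delta>"
    "d \<in> edges \<Delta> \<Longrightarrow> tgt \<Delta> d \<in> verts \<Delta>" "d \<in> edges \<Delta> \<Longrightarrow> lab \<Delta> d \<in> carrier G"
  using assms by (auto simp: wf_graph_def)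

context invariant_polymatroid
begin

definition labelling :: "('v, 'e, 'a, 'c) lgraph \<Rightarrow> ('v \<Rightarrow> 'w set) \<Rightarrow> bool" where
  "labelling \<Delta> P \<longleftrightarrow> (\<forall>i\<in>verts \<Delta>. fin (P i))"

lemma labellingD:
  assumes "labelling \<Delta> P" "i \<in> verts \<Delta>" shows "finite (P i)" "P i \<subseteq> W" "fin (P i)"
  using assms by (auto simp: labelling_def)

lemma mi_edge_mono:
  assumes "fin A'" "fin B'" "l \<in> carrier G" "A \<subseteq> A'" "B \<subseteq> B'"
  shows "mi A (a l ` B) \<le> mi A' (a l ` B')"
  using assms by (intro mi_mono) auto

lemma graph_F_eqI:
  assumes "\<And>i. i \<in> verts \<Delta> \<Longrightarrow> P i = Q i" "wf_graph \<Delta>"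
  shows "graph_F \<Delta> P = graph_F \<Delta> Q"
  using assms by (auto simp: graph_F_def wf_graph_def)

text \<open>The observables \<open>Z\<close> are already seen through \<open>d\<close>, so the joint
  entropy across \<open>d\<close> stays the same. The mutual information along \<open>d\<close>
  therefore rises by as much as the entropy of the source, and no other edge term falls.\<close>

lemma graph_F_split_src:
  assumes "wf_graph \<Delta>" "labelling \<Delta> P" "d \<in> edges \<Delta>" "Z \<subseteq> a (lab \<Delta> d) ` P (tgt \<Delta> d)"
  defines "Q \<equiv> P(src \<Delta> d := P (src \<Delta> d) \<union> Z)"
  shows "labelling \<Delta> Q" "graph_F \<Delta> Q \<le> graph_F \<Delta> P"
proof -
  note wf = wf_graphD[OF assms(1)]
  let ?i = "src \<Delta> d" and ?j = "tgt \<Delta> d" and ?l = "lab \<Delta> d"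
  have d: "?i \<in> verts \<Delta>" "?j \<in> verts \<Delta>" "?l \<in> carrier G" using wf assms by auto
  have "fin (a ?l ` P ?j)" using d labellingD[OF assms(2)] by (intro fin_image) auto
  then have Z: "fin Z" using assms(4) by (auto intro: finite_subset)
  show Q: "labelling \<Delta> Q"
    using assms(2) Z by (auto simp: labelling_def Q_def)
  have PQ: "P k \<subseteq> Q k" for k by (auto simp: Q_def)
  \<comment> \<open>The entropy gained at the source is booked on the edge \<open>d\<close> alone.
    Comparing whole edge terms of \<open>P\<close> and \<open>Q\<close> also covers loops, whose two
    ends change together.\<close>
  let ?\<delta> = "h (P ?i \<union> Z) - h (P ?i)"
  have "(\<Sum>e\<in>edges \<Delta>. mi (P (src \<Delta> e)) (a (lab \<Delta> e) ` P (tgt \<Delta> e)) + (if e = d then ?\<delta> else 0))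
     \<le> (\<Sum>e\<in>edges \<Delta>. mi (Q (src \<Delta> e)) (a (lab \<Delta> e) ` Q (tgt \<Delta> e)))"
  proof (intro sum_mono)
    fix e assume e: "e \<in> edges \<Delta>"
    have mono: "mi (P (src \<Delta> e)) (a (lab \<Delta> e) ` P (tgt \<Delta> e))
        \<le> mi (Q (src \<Delta> e)) (a (lab \<Delta> e) ` Q (tgt \<Delta> e))"
      using labellingD(3)[OF Q] wf e PQ by (intro mi_edge_mono) auto
    have "mi (P ?i) (a ?l ` P ?j) + ?\<delta> = mi (P ?i \<union> Z) (a ?l ` P ?j)"
      using assms(4) by (simp add: mi_def Un_assoc Un_absorb1)
    also have "\<dots> \<le> mi (Q ?i) (a ?l ` Q ?j)"
      by (intro mi_edge_mono labellingD(3)[OF Q] d PQ) (simp add: Q_def)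
    finally show "mi (P (src \<Delta> e)) (a (lab \<Delta> e) ` P (tgt \<Delta> e)) + (if e = d then ?\<delta> else 0)
        \<le> mi (Q (src \<Delta> e)) (a (lab \<Delta> e) ` Q (tgt \<Delta> e))"
      using mono by auto
  qed
  then have edges: "(\<Sum>e\<in>edges \<Delta>. mi (P (src \<Delta> e)) (a (lab \<Delta> e) ` P (tgt \<Delta> e))) + ?\<delta>
     \<le> (\<Sum>e\<in>edges \<Delta>. mi (Q (src \<Delta> e)) (a (lab \<Delta> e) ` Q (tgt \<Delta> e)))"
    using wf assms(3) by (simp add: sum.distrib sum.delta)
  have "(\<Sum>k\<in>verts \<Delta>. h (Q k)) = (\<Sum>k\<in>verts \<Delta>. h (P k) + (if k = ?i then ?\<delta> else 0))"
    by (intro sum.cong) (auto simp: Q_def)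
  also have "\<dots> = (\<Sum>k\<in>verts \<Delta>. h (P k)) + ?\<delta>"
    using wf d by (simp add: sum.distrib sum.delta)
  finally show "graph_F \<Delta> Q \<le> graph_F \<Delta> P" using edges by (simp add: graph_F_def)
qed

end

subsection \<open>Reversing an edge\<close>

definition (in group) flip_edge :: "'e \<Rightarrow> ('v, 'e, 'a, 'c) lgraph \<Rightarrow> ('v, 'e, 'a, 'c) lgraph" where
  "flip_edge d \<Delta> = \<Delta>\<lparr>src := (src \<Delta>)(d := tgt \<Delta> d), tgt := (tgt \<Delta>)(d := src \<Delta> d),
     lab := (lab \<Delta>)(d := inv (lab \<Delta> d))\<rparr>"

lemma (in group) flip_edge_simps [simp]:
  "verts (flip_edge d \<Delta>) = verts \<Delta>" "edges (flip_edge d \<Delta>) = edges \<Delta>"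
  "src (flip_edge d \<Delta>) = (src \<Delta>)(d := tgt \<Delta> d)" "tgt (flip_edge d \<Delta>) = (tgt \<Delta>)(d := src \<Delta> d)"
  "lab (flip_edge d \<Delta>) = (lab \<Delta>)(d := inv (lab \<Delta> d))" "pos (flip_edge d \<Delta>) = pos \<Delta>"
  by (auto simp: flip_edge_def)

lemma (in group) wf_flip_edge: "wf_graph \<Delta> \<Longrightarrow> wf_graph (flip_edge d \<Delta>)"
  by (auto simp: wf_graph_def)

context invariant_polymatroid
begin

lemma labelling_flip_edge [simp]: "labelling (flip_edge d \<Delta>) P = labelling \<Delta> P"
  by (auto simp: labelling_def)

text \<open>Translating both ends by the inverse label exchanges the two orientations, and mutual
  information is invariant under translation.\<close>

lemma graph_F_flip_edge:
  assumes "wf_graph \<Delta>" "labelling \<Delta> P" shows "graph_F (flip_edge d \<Delta>) P = graph_F \<Delta> P"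
proof -
  note wf = wf_graphD[OF assms(1)]
  have "mi (P (tgt \<Delta> d)) (a (inv (lab \<Delta> d)) ` P (src \<Delta> d)) =
        mi (P (src \<Delta> d)) (a (lab \<Delta> d) ` P (tgt \<Delta> d))" if "d \<in> edges \<Delta>"
    using mi_image_inv[of "inv (lab \<Delta> d)" "P (tgt \<Delta> d)" "P (src \<Delta> d)"]
      labellingD(3)[OF assms(2)] wf that by (simp add: mi_commute)
  then show ?thesis unfolding graph_F_def
    by (intro arg_cong2[where f = "(-)"] sum.cong) auto
qed

lemma graph_F_split_tgt:
  assumes "wf_graph \<Delta>" "labelling \<Delta> P" "d \<in> edges \<Delta>" "Z \<subseteq> a (inv (lab \<Delta> d)) ` P (src \<Delta> d)"
  defines "Q \<equiv> P(tgt \<Delta> d := P (tgt \<Delta> d) \<union> Z)"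
  shows "labelling \<Delta> Q" "graph_F \<Delta> Q \<le> graph_F \<Delta> P"
  using graph_F_split_src[of "flip_edge d \<Delta>" P d Z] assms
  by (auto simp: wf_flip_edge graph_F_flip_edge)

text \<open>Observables are added one at a time, with induction on the number still missing. The
  witnesses refer to the initial \<open>P\<close> and stay valid while \<open>P\<close>
  grows.\<close>

lemma graph_F_splitting:
  assumes "wf_graph \<Delta>" "labelling \<Delta> P" "labelling \<Delta> Q"
    and "\<And>i. i \<in> verts \<Delta> \<Longrightarrow> P i \<subseteq> Q i"
    and "\<And>i w. i \<in> verts \<Delta> \<Longrightarrow> w \<in> Q i - P i \<Longrightarrow>
      (\<exists>d\<in>edges \<Delta>. src \<Delta> d = i \<and> w \<in> a (lab \<Delta> d) ` P (tgt \<Delta> d)) \<or>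
      (\<exists>d\<in>edges \<Delta>. tgt \<Delta> d = i \<and> w \<in> a (inv (lab \<Delta> d)) ` P (src \<Delta> d))"
  shows "graph_F \<Delta> Q \<le> graph_F \<Delta> P"
  using assms(2,4,5)
proof (induction "\<Sum>i\<in>verts \<Delta>. card (Q i - P i)" arbitrary: P rule: less_induct)
  case less
  note wf = wf_graphD[OF assms(1)]
  show ?case
  proof (cases "\<exists>i\<in>verts \<Delta>. Q i - P i \<noteq> {}")
    case False
    then show ?thesis using less.prems(2) assms(1)
      by (intro eq_refl graph_F_eqI) auto
  next
    case True
    then obtain i w where iw: "i \<in> verts \<Delta>" "w \<in> Q i - P i" by blast
    define P' where "P' = P(i := P i \<union> {w})"
    from less.prems(3)[OF iw]
    have P': "labelling \<Delta> P' \<and> graph_F \<Delta> P' \<le> graph_F \<Delta> P"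
    proof
      assume "\<exists>d\<in>edges \<Delta>. src \<Delta> d = i \<and> w \<in> a (lab \<Delta> d) ` P (tgt \<Delta> d)"
      then obtain d where "d \<in> edges \<Delta>" "src \<Delta> d = i" "w \<in> a (lab \<Delta> d) ` P (tgt \<Delta> d)" by blast
      then show ?thesis
        using graph_F_split_src[OF assms(1) less.prems(1), of d "{w}"] by (simp add: P'_def)
    next
      assume "\<exists>d\<in>edges \<Delta>. tgt \<Delta> d = i \<and> w \<in> a (inv (lab \<Delta> d)) ` P (src \<Delta> d)"
      then obtain d where "d \<in> edges \<Delta>" "tgt \<Delta> d = i" "w \<in> a (inv (lab \<Delta> d)) ` P (src \<Delta> d)"
        by blast
      then show ?thesis
        using graph_F_split_tgt[OF assms(1) less.prems(1), of d "{w}"] by (simp add: P'_def)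
    qed
    have "graph_F \<Delta> Q \<le> graph_F \<Delta> P'"
    proof (rule less.hyps)
      show "(\<Sum>i\<in>verts \<Delta>. card (Q i - P' i)) < (\<Sum>i\<in>verts \<Delta>. card (Q i - P i))"
      proof (rule sum_strict_mono_ex1)
        show "\<forall>k\<in>verts \<Delta>. card (Q k - P' k) \<le> card (Q k - P k)"
          using labellingD[OF assms(3)] by (auto simp: P'_def intro!: card_mono)
        show "\<exists>k\<in>verts \<Delta>. card (Q k - P' k) < card (Q k - P k)"
          using labellingD[OF assms(3)] iw
          by (intro bexI[of _ i] psubset_card_mono) (auto simp: P'_def)
      qed (use wf in auto)
    next
      fix k u assume "k \<in> verts \<Delta>" "u \<in> Q k - P' k"
      then have "u \<in> Q k - P k" by (auto simp: P'_def split: if_splits)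
      moreover have "P j \<subseteq> P' j" for j by (auto simp: P'_def)
      ultimately show "(\<exists>d\<in>edges \<Delta>. src \<Delta> d = k \<and> u \<in> a (lab \<Delta> d) ` P' (tgt \<Delta> d)) \<or>
          (\<exists>d\<in>edges \<Delta>. tgt \<Delta> d = k \<and> u \<in> a (inv (lab \<Delta> d)) ` P' (src \<Delta> d))"
        using less.prems(3)[OF \<open>k \<in> verts \<Delta>\<close>, of u] by blast
    qed (use P' iw less.prems in \<open>auto simp: P'_def\<close>)
    with P' show ?thesis by simp
  qed
qed

end

text \<open>The cover has vertices \<open>(x, i)\<close> and an edge from
  \<open>(x, src \<Delta> d)\<close> to \<open>(x \<otimes> lab \<Delta> d, tgt \<Delta> d)\<close>
  for each \<open>x\<close> and \<open>d\<close>. That every two-valued cochain \<open>c\<close> is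
  a coboundary says that first cohomology mod 2 vanishes, so there are no cycles. In this form the
  condition passes through each move by an explicit change of \<open>c\<close> and
  \<open>p\<close>.\<close>

definition (in group) forest_cover :: "('v, 'e, 'a, 'c) lgraph \<Rightarrow> bool" where
  "forest_cover \<Delta> \<longleftrightarrow> (\<forall>c. \<exists>p :: 'a \<Rightarrow> 'v \<Rightarrow> bool. \<forall>x\<in>carrier G. \<forall>d\<in>edges \<Delta>.
     (p x (src \<Delta> d) \<noteq> p (x \<otimes> lab \<Delta> d) (tgt \<Delta> d)) \<longleftrightarrow> c x d)"

lemma (in group) forest_coverE:
  fixes \<Delta> :: "('v, 'e, 'a, 'c) lgraph"
  assumes "forest_cover \<Delta>"
  obtains p :: "'a \<Rightarrow> 'v \<Rightarrow> bool" where "\<And>x d. x \<in> carrier G \<Longrightarrow> d \<in> edges \<Delta> \<Longrightarrow>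
     (p x (src \<Delta> d) \<noteq> p (x \<otimes> lab \<Delta> d) (tgt \<Delta> d)) = c x d"
proof -
  from assms[unfolded forest_cover_def, rule_format, of c]
  obtain p :: "'a \<Rightarrow> 'v \<Rightarrow> bool" where "\<forall>x\<in>carrier G. \<forall>d\<in>edges \<Delta>.
     (p x (src \<Delta> d) \<noteq> p (x \<otimes> lab \<Delta> d) (tgt \<Delta> d)) = c x d" ..
  then show thesis by (intro that[of p]) simp
qed

text \<open>Walks are pushed forward edge by edge, backward letters using the inverse of the
  substituted walk. Connectedness after a move can thus be checked on single edges.\<close>

lemma (in group) walk_transfer:
  assumes "wf_graph \<Delta>" "wf_graph \<Delta>'"
    and sim: "\<And>d. d \<in> edges \<Delta> \<Longrightarrow> \<exists>q. walk \<Delta>' (\<sigma> (src \<Delta> d)) q (\<sigma> (tgt \<Delta> d)) \<and>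
       word_value G (letters \<Delta>' q) = lab \<Delta> d"
    and "walk \<Delta> i q j"
  shows "\<exists>q'. walk \<Delta>' (\<sigma> i) q' (\<sigma> j) \<and>
     word_value G (letters \<Delta>' q') = word_value G (letters \<Delta> q)"
  using assms(4)
proof (induction q arbitrary: i)
  case Nil
  then show ?case by (intro exI[of _ "[]"]) auto
next
  case (Cons p q)
  obtain b d where p: "p = (b, d)" by (cases p)
  have carr: "letters \<Delta>' q \<in> words_on (carrier G)" if "walk \<Delta>' x q y" for x y q
    using that wf_graphD(5)[OF assms(2)]
  proof (induction q arbitrary: x)
    case (Cons p q) then show ?case by (cases p) auto
  qed simp
  from Cons.prems p have d: "d \<in> edges \<Delta>" and i: "i = (if b then src \<Delta> d else tgt \<Delta> d)"
    and q: "walk \<Delta> (if b then tgt \<Delta> d else src \<Delta> d) q j" by auto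
  from sim[OF d] obtain q1 where q1: "walk \<Delta>' (\<sigma> (src \<Delta> d)) q1 (\<sigma> (tgt \<Delta> d))"
    "word_value G (letters \<Delta>' q1) = lab \<Delta> d" by blast
  from Cons.IH[OF q] obtain q2 where
    q2: "walk \<Delta>' (\<sigma> (if b then tgt \<Delta> d else src \<Delta> d)) q2 (\<sigma> j)"
    "word_value G (letters \<Delta>' q2) = word_value G (letters \<Delta> q)" by blast
  show ?case
  proof (cases b)
    case True
    then show ?thesis using q1 q2 i p carr[OF q1(1)] carr[OF q2(1)]
      by (intro exI[of _ "q1 @ q2"]) (auto simp: word_value_append)
  next
    case False
    then show ?thesis using q1 q2 i p carr[OF q1(1)] carr[OF q2(1)]
      by (intro exI[of _ "inverse_word q1 @ q2"])
        (auto simp: word_value_append word_value_inverse_word inverse_word_in_words_on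
          intro: walk_inverse_word)
  qed
qed

section \<open>Graphs over the Schreier graph and the invariants kept by folding\<close>

context graph_folding
begin

text \<open>\<open>pos\<close> is a morphism to the graph of the action \<open>r\<close>.\<close>

definition positioned :: "('v, 'e, 'a, 'c) lgraph \<Rightarrow> bool" where
  "positioned \<Delta> \<longleftrightarrow> (\<forall>i\<in>verts \<Delta>. pos \<Delta> i \<in> C) \<and>
     (\<forall>d\<in>edges \<Delta>. pos \<Delta> (tgt \<Delta> d) = r (pos \<Delta> (src \<Delta> d)) (lab \<Delta> d))"

text \<open>For a well-formed positioned graph, the values of walks from \<open>i\<close> to
  \<open>j\<close> are then exactly the elements carrying \<open>pos \<Delta> i\<close> to
  \<open>pos \<Delta> j\<close>. In particular the closed walks at a vertex read off the full
  stabiliser of its position.\<close>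

definition conn_graph :: "('v, 'e, 'a, 'c) lgraph \<Rightarrow> bool" where
  "conn_graph \<Delta> \<longleftrightarrow> (\<forall>i\<in>verts \<Delta>. \<forall>j\<in>verts \<Delta>. \<forall>y\<in>carrier G. r (pos \<Delta> i) y = pos \<Delta> j \<longrightarrow>
     (\<exists>q. walk \<Delta> i q j \<and> word_value G (letters \<Delta> q) = y))"

definition good :: "('v, 'e, 'a, 'c) lgraph \<Rightarrow> bool" where
  "good \<Delta> \<longleftrightarrow> wf_graph \<Delta> \<and> positioned \<Delta> \<and> forest_cover \<Delta> \<and> conn_graph \<Delta>"

definition schreier :: "('c, 'c \<times> 'a, 'a, 'c) lgraph" where
  "schreier = \<lparr>verts = C, edges = C \<times> S, src = fst, tgt = (\<lambda>(c, s). r c s), lab = snd, pos = id\<rparr>"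

text \<open>The containment travels with the inequality because the final estimate needs the
  original observables to be visible in \<open>Q\<close>.\<close>

definition solvable :: "('v, 'e, 'a, 'c) lgraph \<Rightarrow> ('v \<Rightarrow> 'w set) \<Rightarrow> bool" where
  "solvable \<Delta> P \<longleftrightarrow> (\<exists>Q. labelling schreier Q \<and> graph_F schreier Q \<le> graph_F \<Delta> P \<and>
     (\<forall>i\<in>verts \<Delta>. P i \<subseteq> Q (pos \<Delta> i)))"

lemma solvable_move:
  assumes "solvable \<Delta>' P'" "graph_F \<Delta>' P' \<le> graph_F \<Delta> P"
    "\<And>i. i \<in> verts \<Delta> \<Longrightarrow> \<exists>k\<in>verts \<Delta>'. pos \<Delta>' k = pos \<Delta> i \<and> P i \<subseteq> P' k"
  shows "solvable \<Delta> P"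
proof -
  obtain Q where Q: "labelling schreier Q" "graph_F schreier Q \<le> graph_F \<Delta>' P'"
    "\<And>k. k \<in> verts \<Delta>' \<Longrightarrow> P' k \<subseteq> Q (pos \<Delta>' k)"
    using assms(1) by (auto simp: solvable_def)
  have "P i \<subseteq> Q (pos \<Delta> i)" if "i \<in> verts \<Delta>" for i
    using assms(3)[OF that] Q(3) by (metis subset_trans)
  then show ?thesis using Q assms(2) unfolding solvable_def by force
qed

lemma letters_in_words_on:
  "wf_graph \<Delta> \<Longrightarrow> walk \<Delta> i q j \<Longrightarrow> letters \<Delta> q \<in> words_on (carrier G)"
proof (induction q arbitrary: i)
  case (Cons p q) then show ?case by (cases p) (auto dest: wf_graphD)
qed simp

lemma walk_pos:
  assumes "wf_graph \<Delta>" "positioned \<Delta>" "walk \<Delta> i q j" "i \<in> verts \<Delta>"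
  shows "j \<in> verts \<Delta> \<and> pos \<Delta> j = r (pos \<Delta> i) (word_value G (letters \<Delta> q))"
  using assms(3,4)
proof (induction q arbitrary: i)
  case Nil
  then show ?case using assms(2) by (auto simp: positioned_def)
next
  case (Cons p q)
  obtain b d where p: "p = (b, d)" by (cases p)
  note wf = wf_graphD[OF assms(1)]
  define k where "k = (if b then tgt \<Delta> d else src \<Delta> d)"
  define x where "x = (if b then lab \<Delta> d else inv (lab \<Delta> d))"
  from Cons.prems p have d: "d \<in> edges \<Delta>" and i: "i = (if b then src \<Delta> d else tgt \<Delta> d)"
    and q: "walk \<Delta> k q j" by (auto simp: k_def)
  have k: "k \<in> verts \<Delta>" "x \<in> carrier G" using d wf by (auto simp: k_def x_def)
  have ck: "pos \<Delta> k \<in> C" "pos \<Delta> i \<in> C" using k Cons.prems assms(2) by (auto simp: positioned_def)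
  have "pos \<Delta> k = r (pos \<Delta> i) x"
  proof (cases b)
    case True then show ?thesis using d assms(2) i by (auto simp: positioned_def k_def x_def)
  next
    case False
    then have "pos \<Delta> i = r (pos \<Delta> k) (lab \<Delta> d)"
      using d assms(2) i by (auto simp: positioned_def k_def)
    then show ?thesis
      using False ck wf(5)[OF d] by (simp add: x_def flip: r_mult)
  qed
  moreover have "word_value G (letters \<Delta> q) \<in> carrier G"
    using letters_in_words_on[OF assms(1) q] by (rule word_value_closed)
  ultimately have "pos \<Delta> j = r (pos \<Delta> i) (x \<otimes> word_value G (letters \<Delta> q))" "j \<in> verts \<Delta>"
    using Cons.IH[OF q k(1)] k ck by (auto simp: r_mult)
  then show ?case by (simp add: p x_def)
qed

text \<open>Both new vertices are joined to images of old ones by walks of values \<open>x1\<close>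
  and \<open>x2\<close>. The old graph realises \<open>x1 \<otimes> y \<otimes> inv x2\<close>, and
  undoing the connecting walks leaves \<open>y\<close>.\<close>

lemma conn_graph_transfer:
  assumes "wf_graph \<Delta>" "wf_graph \<Delta>'" "positioned \<Delta>'" "conn_graph \<Delta>"
    and sim: "\<And>d. d \<in> edges \<Delta> \<Longrightarrow> \<exists>q. walk \<Delta>' (\<sigma> (src \<Delta> d)) q (\<sigma> (tgt \<Delta> d)) \<and>
       word_value G (letters \<Delta>' q) = lab \<Delta> d"
    and reach: "\<And>i'. i' \<in> verts \<Delta>' \<Longrightarrow>
       \<exists>i\<in>verts \<Delta>. \<sigma> i \<in> verts \<Delta>' \<and> pos \<Delta>' (\<sigma> i) = pos \<Delta> i \<and> (\<exists>q. walk \<Delta>' (\<sigma> i) q i')"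
  shows "conn_graph \<Delta>'"
  unfolding conn_graph_def
proof (intro ballI impI)
  fix i' j' y assume ij: "i' \<in> verts \<Delta>'" "j' \<in> verts \<Delta>'" and y: "y \<in> carrier G"
    and eq: "r (pos \<Delta>' i') y = pos \<Delta>' j'"
  obtain i q1 where i: "i \<in> verts \<Delta>" "\<sigma> i \<in> verts \<Delta>'" "pos \<Delta>' (\<sigma> i) = pos \<Delta> i"
    "walk \<Delta>' (\<sigma> i) q1 i'" using reach[OF ij(1)] by blast
  obtain j q2 where j: "j \<in> verts \<Delta>" "\<sigma> j \<in> verts \<Delta>'" "pos \<Delta>' (\<sigma> j) = pos \<Delta> j"
    "walk \<Delta>' (\<sigma> j) q2 j'" using reach[OF ij(2)] by blast
  define x1 where "x1 = word_value G (letters \<Delta>' q1)"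
  define x2 where "x2 = word_value G (letters \<Delta>' q2)"
  have w1: "letters \<Delta>' q1 \<in> words_on (carrier G)" and w2: "letters \<Delta>' q2 \<in> words_on (carrier G)"
    using letters_in_words_on[OF assms(2)] i j by auto
  have x: "x1 \<in> carrier G" "x2 \<in> carrier G"
    using w1 w2 by (auto simp: x1_def x2_def word_value_closed)
  have c: "pos \<Delta> i \<in> C" "pos \<Delta> j \<in> C" using i j assms(3) by (auto simp: positioned_def)
  have "pos \<Delta>' i' = r (pos \<Delta> i) x1" "pos \<Delta>' j' = r (pos \<Delta> j) x2"
    using walk_pos[OF assms(2,3)] i j by (auto simp: x1_def x2_def)
  with eq have "r (r (r (pos \<Delta> i) x1) y) (inv x2) = r (r (pos \<Delta> j) x2) (inv x2)" by simp
  then have "r (pos \<Delta> i) (x1 \<otimes> y \<otimes> inv x2) = pos \<Delta> j"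
    using x y c by (simp flip: r_mult)
  then obtain q where q: "walk \<Delta> i q j" "word_value G (letters \<Delta> q) = x1 \<otimes> y \<otimes> inv x2"
    using assms(4) i j x y unfolding conn_graph_def by blast
  obtain q' where q': "walk \<Delta>' (\<sigma> i) q' (\<sigma> j)"
    "word_value G (letters \<Delta>' q') = x1 \<otimes> y \<otimes> inv x2"
    using walk_transfer[OF assms(1,2) sim q(1)] q(2) by auto
  have "inv x1 \<otimes> ((x1 \<otimes> y \<otimes> inv x2) \<otimes> x2) = y"
    using x y by (simp add: m_assoc) (simp add: m_assoc[symmetric])
  then have "word_value G (letters \<Delta>' (inverse_word q1 @ q' @ q2)) = y"
    using w1 w2 letters_in_words_on[OF assms(2) q'(1)] q'(2)
    by (simp add: word_value_append word_value_inverse_word inverse_word_in_words_on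
        flip: x1_def x2_def)
  moreover have "walk \<Delta>' i' (inverse_word q1 @ q' @ q2) j'"
    using i j q' walk_inverse_word by fastforce
  ultimately show "\<exists>q. walk \<Delta>' i' q j' \<and> word_value G (letters \<Delta>' q) = y" by blast
qed

lemma goodD:
  assumes "good \<Delta>"
  shows "wf_graph \<Delta>" "positioned \<Delta>" "forest_cover \<Delta>" "conn_graph \<Delta>"
  using assms by (auto simp: good_def)

lemma positionedD:
  assumes "positioned \<Delta>"
  shows "i \<in> verts \<Delta> \<Longrightarrow> pos \<Delta> i \<in> C"
    "d \<in> edges \<Delta> \<Longrightarrow> pos \<Delta> (tgt \<Delta> d) = r (pos \<Delta> (src \<Delta> d)) (lab \<Delta> d)"
  using assms by (auto simp: positioned_def)

lemma good_flip_edge: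
  fixes \<Delta> :: "('v, 'e, 'a, 'c) lgraph"
  assumes "good \<Delta>" and True: "d \<in> edges \<Delta>" shows "good (flip_edge d \<Delta>)"
proof -
  note wf = wf_graphD[OF goodD(1)[OF assms(1)]] and po = positionedD[OF goodD(2)[OF assms(1)]]
  have wf': "wf_graph (flip_edge d \<Delta>)" using assms by (simp add: good_def wf_flip_edge)
  have po': "positioned (flip_edge d \<Delta>)"
    using po wf True unfolding positioned_def by (auto simp flip: r_mult)
  have "forest_cover (flip_edge d \<Delta>)"
    unfolding forest_cover_def
  proof
    fix c :: "'a \<Rightarrow> 'e \<Rightarrow> bool"
    \<comment> \<open>The flipped edge over \<open>x\<close> is the old edge over
      \<open>x \<otimes> inv (lab \<Delta> d)\<close> run backwards. Hence the cochain is shifted by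
      the label before a potential is taken.\<close>
    obtain p :: "'a \<Rightarrow> 'v \<Rightarrow> bool" where p: "\<And>x e. x \<in> carrier G \<Longrightarrow> e \<in> edges \<Delta> \<Longrightarrow>
        (p x (src \<Delta> e) \<noteq> p (x \<otimes> lab \<Delta> e) (tgt \<Delta> e)) =
        (if e = d then c (x \<otimes> lab \<Delta> d) d else c x e)"
      using forest_coverE[OF goodD(3)[OF assms(1)],
          of "\<lambda>x e. if e = d then c (x \<otimes> lab \<Delta> d) d else c x e"] by blast
    have "(p x (tgt \<Delta> d) \<noteq> p (x \<otimes> inv (lab \<Delta> d)) (src \<Delta> d)) = c x d" if "x \<in> carrier G" for x
      using p[of "x \<otimes> inv (lab \<Delta> d)" d] that wf(5)[OF True] True by (auto simp: m_assoc)
    then show "\<exists>p :: 'a \<Rightarrow> 'v \<Rightarrow> bool. \<forall>x\<in>carrier G. \<forall>e\<in>edges (flip_edge d \<Delta>).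
       (p x (src (flip_edge d \<Delta>) e) \<noteq>
        p (x \<otimes> lab (flip_edge d \<Delta>) e) (tgt (flip_edge d \<Delta>) e)) = c x e"
      using p by (intro exI[of _ p]) auto
  qed
  moreover have "conn_graph (flip_edge d \<Delta>)"
  proof (rule conn_graph_transfer[OF goodD(1)[OF assms(1)] wf' po' goodD(4)[OF assms(1)], of id])
    fix e assume e: "e \<in> edges \<Delta>"
    show "\<exists>q. walk (flip_edge d \<Delta>) (id (src \<Delta> e)) q (id (tgt \<Delta> e)) \<and>
         word_value G (letters (flip_edge d \<Delta>) q) = lab \<Delta> e"
      using e wf by (intro exI[of _ "[(e \<noteq> d, e)]"]) auto
  next
    fix i assume "i \<in> verts (flip_edge d \<Delta>)"
    then show "\<exists>k\<in>verts \<Delta>. id k \<in> verts (flip_edge d \<Delta>) \<and>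
       pos (flip_edge d \<Delta>) (id k) = pos \<Delta> k \<and> (\<exists>q. walk (flip_edge d \<Delta>) (id k) q i)"
      by (intro bexI[of _ i]) (auto intro: exI[of _ "[]"])
  qed
  ultimately show ?thesis using wf' po' by (simp add: good_def)
qed

lemma solvable_flip_edge:
  assumes "good \<Delta>" "labelling \<Delta> P" "solvable (flip_edge d \<Delta>) P"
  shows "solvable \<Delta> P"
  using assms by (intro solvable_move[OF assms(3)]) (auto simp: good_def graph_F_flip_edge)

subsection \<open>Sliding an edge\<close>

text \<open>The first half of a Stallings fold: if \<open>d\<close> and \<open>d'\<close> have equal
  label and target, the path along \<open>d'\<close> and back along \<open>d\<close> has trivial
  label, and it replaces \<open>d'\<close>. Contracting the new \<open>d'\<close> completes the
  fold.\<close>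

definition slide_edge :: "'e \<Rightarrow> 'e \<Rightarrow> ('v, 'e, 'a, 'c) lgraph \<Rightarrow> ('v, 'e, 'a, 'c) lgraph" where
  "slide_edge d d' \<Delta> = \<Delta>\<lparr>tgt := (tgt \<Delta>)(d' := src \<Delta> d), lab := (lab \<Delta>)(d' := \<one>)\<rparr>"

lemma slide_edge_simps [simp]:
  "verts (slide_edge d d' \<Delta>) = verts \<Delta>" "edges (slide_edge d d' \<Delta>) = edges \<Delta>"
  "src (slide_edge d d' \<Delta>) = src \<Delta>" "tgt (slide_edge d d' \<Delta>) = (tgt \<Delta>)(d' := src \<Delta> d)"
  "lab (slide_edge d d' \<Delta>) = (lab \<Delta>)(d' := \<one>)" "pos (slide_edge d d' \<Delta>) = pos \<Delta>"
  by (auto simp: slide_edge_def)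

lemma good_slide_edge:
  fixes \<Delta> :: "('v, 'e, 'a, 'c) lgraph"
  assumes "good \<Delta>" "d \<in> edges \<Delta>" "d' \<in> edges \<Delta>" "d \<noteq> d'" "tgt \<Delta> d = tgt \<Delta> d'" "lab \<Delta> d = lab \<Delta> d'"
  shows "good (slide_edge d d' \<Delta>)"
proof -
  note wf = wf_graphD[OF goodD(1)[OF assms(1)]] and po = positionedD[OF goodD(2)[OF assms(1)]]
  let ?D = "slide_edge d d' \<Delta>"
  have wf': "wf_graph ?D" using wf assms by (auto simp: wf_graph_def)
  have "pos \<Delta> (src \<Delta> d) = pos \<Delta> (src \<Delta> d')"
  proof -
    have "r (pos \<Delta> (src \<Delta> d)) (lab \<Delta> d) = r (pos \<Delta> (src \<Delta> d')) (lab \<Delta> d)"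
      using po(2)[of d] po(2)[of d'] assms by simp
    then have "r (r (pos \<Delta> (src \<Delta> d)) (lab \<Delta> d)) (inv (lab \<Delta> d)) =
               r (r (pos \<Delta> (src \<Delta> d')) (lab \<Delta> d)) (inv (lab \<Delta> d))" by simp
    then show ?thesis using po(1) wf assms by (simp flip: r_mult)
  qed
  then have po': "positioned ?D"
    using po wf assms unfolding positioned_def by auto
  have "forest_cover ?D"
    unfolding forest_cover_def
  proof
    fix c :: "'a \<Rightarrow> 'e \<Rightarrow> bool"
    \<comment> \<open>The new \<open>d'\<close> is the old \<open>d'\<close> followed by
      \<open>d\<close> reversed. The old \<open>d'\<close> must therefore carry the sum mod 2 of the
      values prescribed on \<open>d'\<close> and \<open>d\<close>.\<close>
    obtain p :: "'a \<Rightarrow> 'v \<Rightarrow> bool" where p: "\<And>x e. x \<in> carrier G \<Longrightarrow> e \<in> edges \<Delta> \<Longrightarrow>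
        (p x (src \<Delta> e) \<noteq> p (x \<otimes> lab \<Delta> e) (tgt \<Delta> e)) =
        (if e = d' then c x d' \<noteq> c x d else c x e)"
      using forest_coverE[OF goodD(3)[OF assms(1)],
          of "\<lambda>x e. if e = d' then c x d' \<noteq> c x d else c x e"] by blast
    have "(p x (src \<Delta> d') \<noteq> p x (src \<Delta> d)) = c x d'" if "x \<in> carrier G" for x
      using p[of x d] p[of x d'] that assms by simp argo
    then show "\<exists>p :: 'a \<Rightarrow> 'v \<Rightarrow> bool. \<forall>x\<in>carrier G. \<forall>e\<in>edges ?D.
       (p x (src ?D e) \<noteq> p (x \<otimes> lab ?D e) (tgt ?D e)) = c x e"
      using p by (intro exI[of _ p]) auto
  qed
  moreover have "conn_graph ?D"
  proof (rule conn_graph_transfer[OF goodD(1)[OF assms(1)] wf' po' goodD(4)[OF assms(1)], of id])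
    fix e assume e: "e \<in> edges \<Delta>"
    show "\<exists>q. walk ?D (id (src \<Delta> e)) q (id (tgt \<Delta> e)) \<and> word_value G (letters ?D q) = lab \<Delta> e"
    proof (cases "e = d'")
      case True
      then show ?thesis using assms wf by (intro exI[of _ "[(True, d'), (True, d)]"]) auto
    next
      case False
      then show ?thesis using e wf by (intro exI[of _ "[(True, e)]"]) auto
    qed
  next
    fix i assume "i \<in> verts ?D"
    then show "\<exists>k\<in>verts \<Delta>. id k \<in> verts ?D \<and> pos ?D (id k) = pos \<Delta> k \<and> (\<exists>q. walk ?D (id k) q i)"
      by (intro bexI[of _ i]) (auto intro: exI[of _ "[]"])
  qed
  ultimately show ?thesis using wf' po' by (simp add: good_def)
qed

text \<open>Along with the slide, the source of \<open>d\<close> receives everything the common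
  target shows through \<open>d\<close>, a splitting that the edge \<open>d\<close> pays for. The
  moved edge then sees at its new end at least what it saw at the old one.\<close>

lemma solvable_slide_edge:
  assumes "good \<Delta>" "labelling \<Delta> P" "d \<in> edges \<Delta>" "d' \<in> edges \<Delta>" "d \<noteq> d'"
    "tgt \<Delta> d = tgt \<Delta> d'" "lab \<Delta> d = lab \<Delta> d'"
    and solve: "\<And>Q. labelling (slide_edge d d' \<Delta>) Q \<Longrightarrow> solvable (slide_edge d d' \<Delta>) Q"
  shows "solvable \<Delta> P"
proof -
  note wf = wf_graphD[OF goodD(1)[OF assms(1)]]
  let ?D = "slide_edge d d' \<Delta>" and ?l = "lab \<Delta> d" and ?i = "src \<Delta> d" and ?u = "tgt \<Delta> d"
  define Q where "Q = P(?i := P ?i \<union> a ?l ` P ?u)"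
  have l: "?l \<in> carrier G" "?i \<in> verts \<Delta>" "?u \<in> verts \<Delta>" using wf assms by auto
  have finl: "fin (a ?l ` P ?u)" using labellingD(3)[OF assms(2)] l by (intro fin_image) auto
  then have lQ: "labelling \<Delta> Q"
    using assms(2) by (auto simp: labelling_def Q_def)
  then have lQ': "labelling ?D Q" by (simp add: labelling_def)
  have PQ: "P k \<subseteq> Q k" for k by (auto simp: Q_def)
  let ?\<delta> = "h (P ?i \<union> a ?l ` P ?u) - h (P ?i)"
  have "(\<Sum>e\<in>edges \<Delta>. mi (P (src \<Delta> e)) (a (lab \<Delta> e) ` P (tgt \<Delta> e)) + (if e = d then ?\<delta> else 0))
     \<le> (\<Sum>e\<in>edges \<Delta>. mi (Q (src ?D e)) (a (lab ?D e) ` Q (tgt ?D e)))"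
  proof (intro sum_mono)
    fix e assume e: "e \<in> edges \<Delta>"
    have ve: "src \<Delta> e \<in> verts \<Delta>" "tgt \<Delta> e \<in> verts \<Delta>" "lab \<Delta> e \<in> carrier G" using wf e by auto
    have mono: "mi (P (src \<Delta> e)) (a (lab \<Delta> e) ` P (tgt \<Delta> e))
        \<le> mi (Q (src \<Delta> e)) (a (lab \<Delta> e) ` Q (tgt \<Delta> e))"
      by (intro mi_edge_mono labellingD(3)[OF lQ] ve PQ)
    have "mi (P ?i) (a ?l ` P ?u) + ?\<delta> = mi (P ?i \<union> a ?l ` P ?u) (a ?l ` P ?u)"
      by (simp add: mi_def Un_assoc)
    also have "\<dots> \<le> mi (Q ?i) (a ?l ` Q ?u)"
      by (intro mi_edge_mono labellingD(3)[OF lQ] l PQ) (simp add: Q_def)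
    finally have d: "mi (P ?i) (a ?l ` P ?u) + ?\<delta> \<le> mi (Q ?i) (a ?l ` Q ?u)" .
    have "mi (P (src \<Delta> d')) (a ?l ` P ?u) \<le> mi (Q (src \<Delta> d')) (Q ?i)"
      using wf assms l by (intro mi_mono labellingD(3)[OF lQ] PQ) (auto simp: Q_def)
    moreover have "a \<one> ` Q ?i = Q ?i" using labellingD[OF lQ] l by (intro image_one) auto
    ultimately show "mi (P (src \<Delta> e)) (a (lab \<Delta> e) ` P (tgt \<Delta> e)) + (if e = d then ?\<delta> else 0)
        \<le> mi (Q (src ?D e)) (a (lab ?D e) ` Q (tgt ?D e))"
      using mono d assms(5-7) by auto
  qed
  then have edges: "(\<Sum>e\<in>edges \<Delta>. mi (P (src \<Delta> e)) (a (lab \<Delta> e) ` P (tgt \<Delta> e))) + ?\<delta>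
     \<le> (\<Sum>e\<in>edges \<Delta>. mi (Q (src ?D e)) (a (lab ?D e) ` Q (tgt ?D e)))"
    using wf assms(3) by (simp add: sum.distrib sum.delta)
  have "(\<Sum>k\<in>verts \<Delta>. h (Q k)) = (\<Sum>k\<in>verts \<Delta>. h (P k) + (if k = ?i then ?\<delta> else 0))"
    by (intro sum.cong) (auto simp: Q_def)
  also have "\<dots> = (\<Sum>k\<in>verts \<Delta>. h (P k)) + ?\<delta>"
    using wf l by (simp add: sum.distrib sum.delta)
  finally have "graph_F ?D Q \<le> graph_F \<Delta> P" using edges by (simp add: graph_F_def)
  then show ?thesis
    by (rule solvable_move[OF solve[OF lQ']]) (use PQ in auto)
qed

subsection \<open>Contracting an edge\<close>

definition contract_edge :: "'e \<Rightarrow> ('v, 'e, 'a, 'c) lgraph \<Rightarrow> ('v, 'e, 'a, 'c) lgraph" where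
  "contract_edge d \<Delta> = \<Delta>\<lparr>verts := verts \<Delta> - {tgt \<Delta> d}, edges := edges \<Delta> - {d},
     src := id(tgt \<Delta> d := src \<Delta> d) \<circ> src \<Delta>, tgt := id(tgt \<Delta> d := src \<Delta> d) \<circ> tgt \<Delta>\<rparr>"

lemma contract_edge_simps [simp]:
  "verts (contract_edge d \<Delta>) = verts \<Delta> - {tgt \<Delta> d}"
  "edges (contract_edge d \<Delta>) = edges \<Delta> - {d}"
  "src (contract_edge d \<Delta>) = id(tgt \<Delta> d := src \<Delta> d) \<circ> src \<Delta>"
  "tgt (contract_edge d \<Delta>) = id(tgt \<Delta> d := src \<Delta> d) \<circ> tgt \<Delta>"
  "lab (contract_edge d \<Delta>) = lab \<Delta>" "pos (contract_edge d \<Delta>) = pos \<Delta>"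
  by (auto simp: contract_edge_def)

text \<open>A loop labelled \<open>\<one>\<close> lifts to loops of the cover, on which the constant
  cochain \<open>True\<close> is no coboundary. Contracting a unit edge therefore always merges two
  distinct vertices.\<close>

lemma unit_edge_not_loop:
  assumes "good \<Delta>" "d \<in> edges \<Delta>" "lab \<Delta> d = \<one>" shows "src \<Delta> d \<noteq> tgt \<Delta> d"
  using forest_coverE[OF goodD(3)[OF assms(1)], of "\<lambda>_ _. True"] assms
  by (metis one_closed r_one l_one)

lemma good_contract_edge:
  fixes \<Delta> :: "('v, 'e, 'a, 'c) lgraph"
  assumes "good \<Delta>" "d \<in> edges \<Delta>" "lab \<Delta> d = \<one>"
  shows "good (contract_edge d \<Delta>)"
proof -
  note wf = wf_graphD[OF goodD(1)[OF assms(1)]] and po = positionedD[OF goodD(2)[OF assms(1)]]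
  let ?D = "contract_edge d \<Delta>" and ?i = "src \<Delta> d" and ?j = "tgt \<Delta> d"
  let ?\<sigma> = "id(?j := ?i)"
  have ij: "?i \<noteq> ?j" by (rule unit_edge_not_loop[OF assms])
  have v: "?i \<in> verts \<Delta>" "?j \<in> verts \<Delta>" using wf assms by auto
  have wf': "wf_graph ?D" using wf assms ij by (auto simp: wf_graph_def)
  have pos: "pos \<Delta> (?\<sigma> k) = pos \<Delta> k" for k
    using po(2)[OF assms(2)] po(1) v assms(3) by auto
  have po': "positioned ?D"
    using po unfolding positioned_def
    by (simp add: pos del: fun_upd_apply)
  have "forest_cover ?D"
    unfolding forest_cover_def
  proof
    fix c :: "'a \<Rightarrow> 'e \<Rightarrow> bool"
    \<comment> \<open>With the value \<open>False\<close> on \<open>d\<close> the potential agrees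
      at both ends of \<open>d\<close>, so it descends to the contracted graph.\<close>
    obtain p :: "'a \<Rightarrow> 'v \<Rightarrow> bool" where p: "\<And>x e. x \<in> carrier G \<Longrightarrow> e \<in> edges \<Delta> \<Longrightarrow>
        (p x (src \<Delta> e) \<noteq> p (x \<otimes> lab \<Delta> e) (tgt \<Delta> e)) = (e \<noteq> d \<and> c x e)"
      using forest_coverE[OF goodD(3)[OF assms(1)], of "\<lambda>x e. e \<noteq> d \<and> c x e"] by blast
    have "p x (?\<sigma> k) = p x k" if "x \<in> carrier G" for x k
      using p[of x d] that assms by auto
    then show "\<exists>p :: 'a \<Rightarrow> 'v \<Rightarrow> bool. \<forall>x\<in>carrier G. \<forall>e\<in>edges ?D.
       (p x (src ?D e) \<noteq> p (x \<otimes> lab ?D e) (tgt ?D e)) = c x e"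
      using p wf(5) by (intro exI[of _ p]) (simp del: fun_upd_apply)
  qed
  moreover have "conn_graph ?D"
  proof (rule conn_graph_transfer[OF goodD(1)[OF assms(1)] wf' po' goodD(4)[OF assms(1)], of ?\<sigma>])
    fix e assume e: "e \<in> edges \<Delta>"
    show "\<exists>q. walk ?D (?\<sigma> (src \<Delta> e)) q (?\<sigma> (tgt \<Delta> e)) \<and> word_value G (letters ?D q) = lab \<Delta> e"
    proof (cases "e = d")
      case True
      then show ?thesis using assms by (intro exI[of _ "[]"]) auto
    next
      case False
      then show ?thesis using e wf by (intro exI[of _ "[(True, e)]"]) auto
    qed
  next
    fix i assume "i \<in> verts ?D"
    then show "\<exists>k\<in>verts \<Delta>. ?\<sigma> k \<in> verts ?D \<and> pos ?D (?\<sigma> k) = pos \<Delta> k \<and>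
        (\<exists>q. walk ?D (?\<sigma> k) q i)"
      by (intro bexI[of _ i]) (auto intro: exI[of _ "[]"])
  qed
  ultimately show ?thesis using wf' po' by (simp add: good_def)
qed

text \<open>The merged vertex carries the union of both labels, and
  \<open>h (A \<union> B) = h A + h B - mi A B\<close> is exactly what two vertices and a unit edge
  between them contribute. The remaining edges can only gain mutual information.\<close>

lemma solvable_contract_edge:
  assumes "good \<Delta>" "labelling \<Delta> P" "d \<in> edges \<Delta>" "lab \<Delta> d = \<one>"
    and solve: "\<And>Q. labelling (contract_edge d \<Delta>) Q \<Longrightarrow> solvable (contract_edge d \<Delta>) Q"
  shows "solvable \<Delta> P"
proof -
  note wf = wf_graphD[OF goodD(1)[OF assms(1)]] and po = positionedD[OF goodD(2)[OF assms(1)]]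
  let ?D = "contract_edge d \<Delta>" and ?i = "src \<Delta> d" and ?j = "tgt \<Delta> d"
  let ?\<sigma> = "id(?j := ?i)"
  have ij: "?i \<noteq> ?j" by (rule unit_edge_not_loop[OF assms(1,3,4)])
  have v: "?i \<in> verts \<Delta>" "?j \<in> verts \<Delta>" using wf assms by auto
  define Q where "Q = P(?i := P ?i \<union> P ?j)"
  have lQ: "labelling \<Delta> Q"
    using labellingD[OF assms(2)] v by (auto simp: labelling_def Q_def)
  then have lQ': "labelling ?D Q" by (simp add: labelling_def)
  have PQ: "P k \<subseteq> Q (?\<sigma> k)" for k by (auto simp: Q_def)
  have \<sigma>v: "?\<sigma> k \<in> verts \<Delta>" if "k \<in> verts \<Delta>" for k using that v by auto
  have Pj: "a \<one> ` P ?j = P ?j" using labellingD[OF assms(2)] v by (intro image_one) auto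
  have "(\<Sum>e\<in>edges \<Delta> - {d}. mi (P (src \<Delta> e)) (a (lab \<Delta> e) ` P (tgt \<Delta> e)))
     \<le> (\<Sum>e\<in>edges ?D. mi (Q (src ?D e)) (a (lab ?D e) ` Q (tgt ?D e)))"
    unfolding contract_edge_simps o_def using wf
    by (intro sum_mono mi_edge_mono labellingD(3)[OF lQ] PQ \<sigma>v) auto
  then have edges: "(\<Sum>e\<in>edges \<Delta>. mi (P (src \<Delta> e)) (a (lab \<Delta> e) ` P (tgt \<Delta> e))) - mi (P ?i) (P ?j)
     \<le> (\<Sum>e\<in>edges ?D. mi (Q (src ?D e)) (a (lab ?D e) ` Q (tgt ?D e)))"
    using wf assms(3,4) Pj by (simp add: sum_diff1)
  have "(\<Sum>k\<in>verts ?D. h (Q k)) = (\<Sum>k\<in>verts \<Delta>. h (Q k)) - h (P ?j)"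
    using wf v ij by (simp add: sum_diff1 Q_def)
  also have "(\<Sum>k\<in>verts \<Delta>. h (Q k)) =
      (\<Sum>k\<in>verts \<Delta>. h (P k) + (if k = ?i then h (P ?i \<union> P ?j) - h (P ?i) else 0))"
    by (intro sum.cong) (auto simp: Q_def)
  also have "\<dots> = (\<Sum>k\<in>verts \<Delta>. h (P k)) + (h (P ?i \<union> P ?j) - h (P ?i))"
    using wf v by (simp add: sum.distrib sum.delta)
  finally have "graph_F ?D Q \<le> graph_F \<Delta> P"
    using edges by (simp add: graph_F_def mi_def)
  then show ?thesis
  proof (rule solvable_move[OF solve[OF lQ']])
    fix k assume "k \<in> verts \<Delta>"
    then show "\<exists>k'\<in>verts ?D. pos ?D k' = pos \<Delta> k \<and> P k \<subseteq> Q k'"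
      using PQ[of k] ij v po(2)[OF assms(3)] po(1) assms(4)
      by (intro bexI[of _ "?\<sigma> k"]) auto
  qed
qed

end

context graph_folding
begin

subsection \<open>Subdividing an edge and attaching a leaf\<close>

definition subdivide_edge ::
  "'e \<Rightarrow> 'v \<Rightarrow> 'e \<Rightarrow> 'a \<Rightarrow> 'a \<Rightarrow> ('v, 'e, 'a, 'c) lgraph \<Rightarrow> ('v, 'e, 'a, 'c) lgraph" where
  "subdivide_edge d n e x y \<Delta> = \<Delta>\<lparr>verts := insert n (verts \<Delta>), edges := insert e (edges \<Delta>),
     src := (src \<Delta>)(e := n), tgt := (tgt \<Delta>)(d := n, e := tgt \<Delta> d),
     lab := (lab \<Delta>)(d := x, e := y), pos := (pos \<Delta>)(n := r (pos \<Delta> (src \<Delta> d)) x)\<rparr>"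

lemma subdivide_edge_simps [simp]:
  "verts (subdivide_edge d n e x y \<Delta>) = insert n (verts \<Delta>)"
  "edges (subdivide_edge d n e x y \<Delta>) = insert e (edges \<Delta>)"
  "src (subdivide_edge d n e x y \<Delta>) = (src \<Delta>)(e := n)"
  "tgt (subdivide_edge d n e x y \<Delta>) = (tgt \<Delta>)(d := n, e := tgt \<Delta> d)"
  "lab (subdivide_edge d n e x y \<Delta>) = (lab \<Delta>)(d := x, e := y)"
  "pos (subdivide_edge d n e x y \<Delta>) = (pos \<Delta>)(n := r (pos \<Delta> (src \<Delta> d)) x)"
  by (auto simp: subdivide_edge_def)

lemma good_subdivide_edge:
  fixes \<Delta> :: "('v, 'e, 'a, 'c) lgraph"
  assumes "good \<Delta>" and d: "d \<in> edges \<Delta>" and n: "n \<notin> verts \<Delta>" and e: "e \<notin> edges \<Delta>"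
    and xy: "x \<in> carrier G" "y \<in> carrier G" "lab \<Delta> d = x \<otimes> y"
  shows "good (subdivide_edge d n e x y \<Delta>)"
proof -
  note wf = wf_graphD[OF goodD(1)[OF assms(1)]] and po = positionedD[OF goodD(2)[OF assms(1)]]
  let ?D = "subdivide_edge d n e x y \<Delta>"
  have wf': "wf_graph ?D" using wf d xy by (auto simp: wf_graph_def)
  have ed: "e \<noteq> d" and ne: "\<And>f. f \<in> edges \<Delta> \<Longrightarrow> src \<Delta> f \<noteq> n \<and> tgt \<Delta> f \<noteq> n \<and> f \<noteq> e"
    using e d n wf by auto
  have po': "positioned ?D"
    using po wf d xy ne unfolding positioned_def by (auto simp: r_mult)
  have "forest_cover ?D"
    unfolding forest_cover_def
  proof
    fix c :: "'a \<Rightarrow> 'e \<Rightarrow> bool"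
    obtain p :: "'a \<Rightarrow> 'v \<Rightarrow> bool" where p: "\<And>z f. z \<in> carrier G \<Longrightarrow> f \<in> edges \<Delta> \<Longrightarrow>
        (p z (src \<Delta> f) \<noteq> p (z \<otimes> lab \<Delta> f) (tgt \<Delta> f)) =
        (if f = d then c z d \<noteq> c (z \<otimes> x) e else c z f)"
      using forest_coverE[OF goodD(3)[OF assms(1)],
          of "\<lambda>z f. if f = d then c z d \<noteq> c (z \<otimes> x) e else c z f"] by blast
    \<comment> \<open>The first half of the edge, ending over \<open>z\<close>, forces the value at
      the new vertex. The second half then comes out right because the old \<open>d\<close> carries
      the sum of the values on both halves.\<close>
    define p' where "p' z k =
      (if k = n then p (z \<otimes> inv x) (src \<Delta> d) \<noteq> c (z \<otimes> inv x) d else p z k)" for z k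
    have "(p' z (src ?D f) \<noteq> p' (z \<otimes> lab ?D f) (tgt ?D f)) = c z f"
      if z: "z \<in> carrier G" and f: "f \<in> edges ?D" for z f
    proof -
      consider "f = e" | "f = d" | "f \<in> edges \<Delta>" "f \<noteq> d" using f by auto
      then show ?thesis
      proof cases
        case 1
        have "z \<otimes> inv x \<otimes> (x \<otimes> y) = z \<otimes> y" "z \<otimes> inv x \<otimes> x = z"
          using z xy by (simp_all add: m_assoc) (simp_all add: m_assoc[symmetric])
        then show ?thesis
          using p[of "z \<otimes> inv x" d] z xy d ne[OF d] ed 1 by (simp add: p'_def) argo
      next
        case 2
        have "z \<otimes> x \<otimes> inv x = z" using z xy by (simp add: m_assoc)
        then show ?thesis using 2 ed ne[OF d] by (simp add: p'_def) argo
      next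
        case 3
        then show ?thesis using p[OF z 3(1)] ne[OF 3(1)] by (simp add: p'_def)
      qed
    qed
    then show "\<exists>p :: 'a \<Rightarrow> 'v \<Rightarrow> bool. \<forall>x\<in>carrier G. \<forall>e\<in>edges ?D.
       (p x (src ?D e) \<noteq> p (x \<otimes> lab ?D e) (tgt ?D e)) = c x e"
      by blast
  qed
  moreover have "conn_graph ?D"
  proof (rule conn_graph_transfer[OF goodD(1)[OF assms(1)] wf' po' goodD(4)[OF assms(1)], of id])
    fix f assume f: "f \<in> edges \<Delta>"
    show "\<exists>q. walk ?D (id (src \<Delta> f)) q (id (tgt \<Delta> f)) \<and> word_value G (letters ?D q) = lab \<Delta> f"
    proof (cases "f = d")
      case True
      then show ?thesis using xy ne[OF d] ed d
        by (intro exI[of _ "[(True, d), (True, e)]"]) auto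
    next
      case False
      then show ?thesis using f wf ne[OF f] by (intro exI[of _ "[(True, f)]"]) auto
    qed
  next
    fix i assume "i \<in> verts ?D"
    then consider "i \<in> verts \<Delta>" | "i = n" by auto
    then show "\<exists>k\<in>verts \<Delta>. id k \<in> verts ?D \<and> pos ?D (id k) = pos \<Delta> k \<and> (\<exists>q. walk ?D (id k) q i)"
    proof cases
      case 1
      then show ?thesis using n by (intro bexI[of _ i]) (auto intro: exI[of _ "[]"])
    next
      case 2
      then show ?thesis using wf d n ed ne[OF d]
        by (intro bexI[of _ "src \<Delta> d"]) (auto intro!: exI[of _ "[(True, d)]"])
    qed
  qed
  ultimately show ?thesis using wf' po' by (simp add: good_def)
qed

text \<open>The new vertex copies the source of \<open>d\<close>, transported along
  \<open>x\<close>. The first half then has the full entropy of the copy as mutual information,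
  which cancels the new vertex, and the second half keeps the old term: \<open>graph_F\<close> is
  unchanged.\<close>

lemma solvable_subdivide_edge:
  fixes \<Delta> :: "('v, 'e, 'a, 'c) lgraph"
  assumes "good \<Delta>" "labelling \<Delta> P" and d: "d \<in> edges \<Delta>" and n: "n \<notin> verts \<Delta>"
    and e: "e \<notin> edges \<Delta>" and xy: "x \<in> carrier G" "y \<in> carrier G" "lab \<Delta> d = x \<otimes> y"
    and solve: "\<And>Q. labelling (subdivide_edge d n e x y \<Delta>) Q \<Longrightarrow>
       solvable (subdivide_edge d n e x y \<Delta>) Q"
  shows "solvable \<Delta> P"
proof -
  note wf = wf_graphD[OF goodD(1)[OF assms(1)]]
  let ?D = "subdivide_edge d n e x y \<Delta>" and ?i = "src \<Delta> d" and ?j = "tgt \<Delta> d"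
  have ed: "e \<noteq> d" and ne: "\<And>f. f \<in> edges \<Delta> \<Longrightarrow> src \<Delta> f \<noteq> n \<and> tgt \<Delta> f \<noteq> n \<and> f \<noteq> e"
    using e d n wf by auto
  define Q where "Q = P(n := a (inv x) ` P ?i)"
  have fP: "fin (P ?i)" "fin (P ?j)" using labellingD(3)[OF assms(2)] wf d by auto
  have "fin (a (inv x) ` P ?i)" using fP xy by (intro fin_image) auto
  then have lQ: "labelling ?D Q" using assms(2) by (auto simp: labelling_def Q_def)
  have 1: "mi (a (inv x) ` P ?i) (a y ` P ?j) = mi (P ?i) (a (lab \<Delta> d) ` P ?j)"
    using fP xy by (simp add: mi_image_inv image_mult)
  have "mi (P ?i) (a x ` a (inv x) ` P ?i) = h (P ?i)"
    using fP xy by (simp add: image_image_inv mi_absorb)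
  then have "(\<Sum>f\<in>edges ?D. mi (Q (src ?D f)) (a (lab ?D f) ` Q (tgt ?D f))) =
      mi (P ?i) (a (lab \<Delta> d) ` P ?j) +
      (\<Sum>f\<in>edges \<Delta>. if f = d then h (P ?i) else mi (P (src \<Delta> f)) (a (lab \<Delta> f) ` P (tgt \<Delta> f)))"
    using wf(2) e ed ne ne[OF d] 1 by (auto simp: Q_def intro!: sum.cong)
  also have "\<dots> = h (P ?i) + (\<Sum>f\<in>edges \<Delta>. mi (P (src \<Delta> f)) (a (lab \<Delta> f) ` P (tgt \<Delta> f)))"
    using wf(2) d by (simp add: sum.remove[of _ d])
  finally have "graph_F ?D Q = (\<Sum>k\<in>insert n (verts \<Delta>). h (Q k)) - h (P ?i) -
      (\<Sum>f\<in>edges \<Delta>. mi (P (src \<Delta> f)) (a (lab \<Delta> f) ` P (tgt \<Delta> f)))"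
    by (simp add: graph_F_def)
  also have "(\<Sum>k\<in>insert n (verts \<Delta>). h (Q k)) = h (P ?i) + (\<Sum>k\<in>verts \<Delta>. h (P k))"
  proof -
    have "h (a (inv x) ` P ?i) = h (P ?i)" using fP xy by (intro h_invariant) auto
    moreover have "(\<Sum>k\<in>verts \<Delta>. h (Q k)) = (\<Sum>k\<in>verts \<Delta>. h (P k))"
      using n by (intro sum.cong) (auto simp: Q_def)
    ultimately show ?thesis using wf(1) n by (simp add: Q_def)
  qed
  finally have "graph_F ?D Q = graph_F \<Delta> P" by (simp add: graph_F_def)
  then show ?thesis
    by (intro solvable_move[OF solve[OF lQ]]) (use n in \<open>auto simp: Q_def\<close>)
qed

definition add_leaf ::
  "'v \<Rightarrow> 'v \<Rightarrow> 'e \<Rightarrow> 'a \<Rightarrow> ('v, 'e, 'a, 'c) lgraph \<Rightarrow> ('v, 'e, 'a, 'c) lgraph" where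
  "add_leaf i n e y \<Delta> = \<Delta>\<lparr>verts := insert n (verts \<Delta>), edges := insert e (edges \<Delta>),
     src := (src \<Delta>)(e := i), tgt := (tgt \<Delta>)(e := n),
     lab := (lab \<Delta>)(e := y), pos := (pos \<Delta>)(n := r (pos \<Delta> i) y)\<rparr>"

lemma add_leaf_simps [simp]:
  "verts (add_leaf i n e y \<Delta>) = insert n (verts \<Delta>)"
  "edges (add_leaf i n e y \<Delta>) = insert e (edges \<Delta>)"
  "src (add_leaf i n e y \<Delta>) = (src \<Delta>)(e := i)" "tgt (add_leaf i n e y \<Delta>) = (tgt \<Delta>)(e := n)"
  "lab (add_leaf i n e y \<Delta>) = (lab \<Delta>)(e := y)"
  "pos (add_leaf i n e y \<Delta>) = (pos \<Delta>)(n := r (pos \<Delta> i) y)"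
  by (auto simp: add_leaf_def)

lemma good_add_leaf:
  fixes \<Delta> :: "('v, 'e, 'a, 'c) lgraph"
  assumes "good \<Delta>" and i: "i \<in> verts \<Delta>" and n: "n \<notin> verts \<Delta>" and e: "e \<notin> edges \<Delta>"
    and y: "y \<in> carrier G"
  shows "good (add_leaf i n e y \<Delta>)"
proof -
  note wf = wf_graphD[OF goodD(1)[OF assms(1)]] and po = positionedD[OF goodD(2)[OF assms(1)]]
  let ?D = "add_leaf i n e y \<Delta>"
  have wf': "wf_graph ?D" using wf i y by (auto simp: wf_graph_def)
  have ne: "\<And>f. f \<in> edges \<Delta> \<Longrightarrow> src \<Delta> f \<noteq> n \<and> tgt \<Delta> f \<noteq> n \<and> f \<noteq> e" and ni: "n \<noteq> i"
    using e i n wf by auto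
  have po': "positioned ?D"
    using po wf i y ne n unfolding positioned_def by auto
  have "forest_cover ?D"
    unfolding forest_cover_def
  proof
    fix c :: "'a \<Rightarrow> 'e \<Rightarrow> bool"
    obtain p :: "'a \<Rightarrow> 'v \<Rightarrow> bool" where p: "\<And>z f. z \<in> carrier G \<Longrightarrow> f \<in> edges \<Delta> \<Longrightarrow>
        (p z (src \<Delta> f) \<noteq> p (z \<otimes> lab \<Delta> f) (tgt \<Delta> f)) = c z f"
      using forest_coverE[OF goodD(3)[OF assms(1)], of c] by blast
    define p' where "p' z k = (if k = n then p (z \<otimes> inv y) i \<noteq> c (z \<otimes> inv y) e else p z k)" for z k
    have "(p' z (src ?D f) \<noteq> p' (z \<otimes> lab ?D f) (tgt ?D f)) = c z f"
      if z: "z \<in> carrier G" and f: "f \<in> edges ?D" for z f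
    proof (cases "f = e")
      case True
      have "z \<otimes> y \<otimes> inv y = z" using z y by (simp add: m_assoc)
      then show ?thesis using True ni by (simp add: p'_def) argo
    next
      case False
      then have "f \<in> edges \<Delta>" using f by simp
      then show ?thesis using p[OF z] ne[of f] False by (simp add: p'_def)
    qed
    then show "\<exists>p :: 'a \<Rightarrow> 'v \<Rightarrow> bool. \<forall>x\<in>carrier G. \<forall>e\<in>edges ?D.
       (p x (src ?D e) \<noteq> p (x \<otimes> lab ?D e) (tgt ?D e)) = c x e"
      by blast
  qed
  moreover have "conn_graph ?D"
  proof (rule conn_graph_transfer[OF goodD(1)[OF assms(1)] wf' po' goodD(4)[OF assms(1)], of id])
    fix f assume f: "f \<in> edges \<Delta>"
    show "\<exists>q. walk ?D (id (src \<Delta> f)) q (id (tgt \<Delta> f)) \<and> word_value G (letters ?D q) = lab \<Delta> f"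
      using f wf ne[OF f] by (intro exI[of _ "[(True, f)]"]) auto
  next
    fix k assume "k \<in> verts ?D"
    then consider "k \<in> verts \<Delta>" | "k = n" by auto
    then show "\<exists>j\<in>verts \<Delta>. id j \<in> verts ?D \<and> pos ?D (id j) = pos \<Delta> j \<and> (\<exists>q. walk ?D (id j) q k)"
    proof cases
      case 1
      then show ?thesis using n by (intro bexI[of _ k]) (auto intro: exI[of _ "[]"])
    next
      case 2
      then show ?thesis using i ni
        by (intro bexI[of _ i]) (auto intro!: exI[of _ "[(True, e)]"])
    qed
  qed
  ultimately show ?thesis using wf' po' by (simp add: good_def)
qed

text \<open>A leaf with a translated copy of its neighbour adds one vertex entropy and subtracts the
  same amount on its edge.\<close>

lemma solvable_add_leaf:
  fixes \<Delta> :: "('v, 'e, 'a, 'c) lgraph"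
  assumes "good \<Delta>" "labelling \<Delta> P" and i: "i \<in> verts \<Delta>" and n: "n \<notin> verts \<Delta>"
    and e: "e \<notin> edges \<Delta>" and y: "y \<in> carrier G"
    and solve: "\<And>Q. labelling (add_leaf i n e y \<Delta>) Q \<Longrightarrow> solvable (add_leaf i n e y \<Delta>) Q"
  shows "solvable \<Delta> P"
proof -
  note wf = wf_graphD[OF goodD(1)[OF assms(1)]]
  let ?D = "add_leaf i n e y \<Delta>"
  have ne: "\<And>f. f \<in> edges \<Delta> \<Longrightarrow> src \<Delta> f \<noteq> n \<and> tgt \<Delta> f \<noteq> n \<and> f \<noteq> e" and ni: "n \<noteq> i"
    using e i n wf by auto
  define Q where "Q = P(n := a (inv y) ` P i)"
  have fP: "fin (P i)" using labellingD(3)[OF assms(2)] i by auto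
  have "fin (a (inv y) ` P i)" using fP y by (intro fin_image) auto
  then have lQ: "labelling ?D Q" using assms(2) by (auto simp: labelling_def Q_def)
  have "mi (P i) (a y ` a (inv y) ` P i) = h (P i)"
    using fP y by (simp add: image_image_inv mi_absorb)
  then have "(\<Sum>f\<in>edges ?D. mi (Q (src ?D f)) (a (lab ?D f) ` Q (tgt ?D f))) =
      h (P i) + (\<Sum>f\<in>edges \<Delta>. mi (P (src \<Delta> f)) (a (lab \<Delta> f) ` P (tgt \<Delta> f)))"
    using wf(2) e ne ni by (auto simp: Q_def intro!: sum.cong)
  moreover have "(\<Sum>k\<in>insert n (verts \<Delta>). h (Q k)) = h (P i) + (\<Sum>k\<in>verts \<Delta>. h (P k))"
  proof -
    have "h (a (inv y) ` P i) = h (P i)" using fP y by (intro h_invariant) auto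
    moreover have "(\<Sum>k\<in>verts \<Delta>. h (Q k)) = (\<Sum>k\<in>verts \<Delta>. h (P k))"
      using n by (intro sum.cong) (auto simp: Q_def)
    ultimately show ?thesis using wf(1) n by (simp add: Q_def)
  qed
  ultimately have "graph_F ?D Q = graph_F \<Delta> P" by (simp add: graph_F_def)
  then show ?thesis
    by (intro solvable_move[OF solve[OF lQ]]) (use n in \<open>auto simp: Q_def\<close>)
qed

subsection \<open>Folding\<close>

lemma schreier_simps [simp]:
  "verts schreier = C" "edges schreier = C \<times> S" "src schreier = fst"
  "tgt schreier = (\<lambda>(c, s). r c s)" "lab schreier = snd" "pos schreier = id"
  by (auto simp: schreier_def)

lemma wf_schreier: "wf_graph schreier"
  using finite_C finite_S S_carrier by (auto simp: wf_graph_def)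

text \<open>With letters as labels and \<open>pos\<close> bijective on vertices, the graph embeds in
  the Schreier graph. Edges of the latter outside the image only lower the functional, since mutual
  information is nonnegative.\<close>

lemma solvable_immersed:
  fixes \<Delta> :: "('v, 'e, 'a, 'c) lgraph"
  assumes "good \<Delta>" "labelling \<Delta> P" and lab: "\<And>d. d \<in> edges \<Delta> \<Longrightarrow> lab \<Delta> d \<in> S"
    and surj: "pos \<Delta> ` verts \<Delta> = C" and inj: "inj_on (pos \<Delta>) (verts \<Delta>)"
  shows "solvable \<Delta> P"
proof -
  note wf = wf_graphD[OF goodD(1)[OF assms(1)]] and po = positionedD[OF goodD(2)[OF assms(1)]]
  define f where "f = inv_into (verts \<Delta>) (pos \<Delta>)"
  define Q where "Q = P \<circ> f"
  have f: "f (pos \<Delta> i) = i" if "i \<in> verts \<Delta>" for i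
    using inj that by (simp add: f_def)
  have fv: "f c \<in> verts \<Delta>" if "c \<in> C" for c
    using that surj by (simp add: f_def inv_into_into)
  have lQ: "labelling schreier Q"
    using assms(2) fv by (auto simp: labelling_def Q_def)
  let ?e = "\<lambda>d. (pos \<Delta> (src \<Delta> d), lab \<Delta> d)"
  \<comment> \<open>Two edges with the same image would be parallel with equal labels, and the
    cochain marking one of them would be no coboundary. Here the forest condition prevents the loss
    of a mutual-information term.\<close>
  have inj_e: "inj_on ?e (edges \<Delta>)"
  proof (rule inj_onI, rule ccontr)
    fix d d' assume d: "d \<in> edges \<Delta>" "d' \<in> edges \<Delta>" "?e d = ?e d'" "d \<noteq> d'"
    have s: "src \<Delta> d = src \<Delta> d'" using d wf inj by (auto dest: inj_onD)
    have "pos \<Delta> (tgt \<Delta> d) = pos \<Delta> (tgt \<Delta> d')" using d po by simp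
    then have t: "tgt \<Delta> d = tgt \<Delta> d'" using d wf inj by (auto dest: inj_onD)
    obtain p :: "'a \<Rightarrow> 'v \<Rightarrow> bool" where p: "\<And>z f. z \<in> carrier G \<Longrightarrow> f \<in> edges \<Delta> \<Longrightarrow>
        (p z (src \<Delta> f) \<noteq> p (z \<otimes> lab \<Delta> f) (tgt \<Delta> f)) = (f = d)"
      using forest_coverE[OF goodD(3)[OF assms(1)], of "\<lambda>_ f. f = d"] by blast
    show False using p[of \<one> d] p[of \<one> d'] d s t by auto
  qed
  have "(\<Sum>k\<in>verts \<Delta>. h (P k)) = (\<Sum>c\<in>C. h (Q c))"
    using inj surj f by (intro sum.reindex_cong[of f]) (auto simp: Q_def inj_on_def image_iff f_def)
  moreover have "(\<Sum>d\<in>edges \<Delta>. mi (P (src \<Delta> d)) (a (lab \<Delta> d) ` P (tgt \<Delta> d))) =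
      (\<Sum>x\<in>?e ` edges \<Delta>. mi (Q (fst x)) (a (snd x) ` Q (r (fst x) (snd x))))"
    unfolding sum.reindex[OF inj_e] o_def
    using f wf po by (intro sum.cong) (auto simp: Q_def simp flip: po(2))
  moreover have "(\<Sum>x\<in>?e ` edges \<Delta>. mi (Q (fst x)) (a (snd x) ` Q (r (fst x) (snd x)))) \<le>
      (\<Sum>x\<in>C \<times> S. mi (Q (fst x)) (a (snd x) ` Q (r (fst x) (snd x))))"
  proof (rule sum_mono2)
    show "?e ` edges \<Delta> \<subseteq> C \<times> S" using po wf lab by auto
    fix x assume "x \<in> C \<times> S - ?e ` edges \<Delta>"
    then have "fst x \<in> C" "snd x \<in> carrier G" using S_carrier by auto
    then show "0 \<le> mi (Q (fst x)) (a (snd x) ` Q (r (fst x) (snd x)))"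
      by (intro mi_nonneg fin_image h_empty labellingD(3)[OF lQ]) auto
  qed (use finite_C finite_S in auto)
  ultimately have "graph_F schreier Q \<le> graph_F \<Delta> P"
    by (simp add: graph_F_def case_prod_beta)
  then show ?thesis using lQ f by (auto simp: solvable_def Q_def)
qed

lemma not_successively_split:
  "\<not> successively R q \<Longrightarrow> \<exists>xs x y ys. q = xs @ x # y # ys \<and> \<not> R x y"
proof (induction R q rule: successively.induct)
  case (3 R x y xs)
  show ?case
  proof (cases "R x y")
    case True
    then obtain us u v vs where "y # xs = us @ u # v # vs" "\<not> R u v" using 3 by auto
    then show ?thesis by (intro exI[of _ "x # us"]) auto
  qed (metis append_Nil)
qed auto

text \<open>Two vertices over one position are joined by a walk of value \<open>\<one>\<close>. By
  freeness its letters cannot form a nonempty reduced word, so two neighbouring letters cancel. In a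
  shortest such walk they come from different edges, as a backtrack could be cut out.\<close>

lemma foldable_edges:
  fixes \<Delta> :: "('v, 'e, 'a, 'c) lgraph"
  assumes "good \<Delta>" and lab: "\<And>d. d \<in> edges \<Delta> \<Longrightarrow> lab \<Delta> d \<in> S"
    and "\<not> inj_on (pos \<Delta>) (verts \<Delta>)"
  obtains d d' where "d \<in> edges \<Delta>" "d' \<in> edges \<Delta>" "d \<noteq> d'" "lab \<Delta> d = lab \<Delta> d'"
    "tgt \<Delta> d = tgt \<Delta> d' \<or> src \<Delta> d = src \<Delta> d'"
proof -
  note po = positionedD[OF goodD(2)[OF assms(1)]]
  let ?Q = "\<lambda>i j q. walk \<Delta> i q j \<and> word_value G (letters \<Delta> q) = \<one>"
  obtain i j where ij: "i \<in> verts \<Delta>" "j \<in> verts \<Delta>" "i \<noteq> j" "pos \<Delta> i = pos \<Delta> j"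
    using assms(3) by (auto simp: inj_on_def)
  then have "\<exists>q. ?Q i j q"
    using goodD(4)[OF assms(1)] po unfolding conn_graph_def by fastforce
  then obtain q0 where q0: "?Q i j q0" ..
  define q where "q = arg_min length (?Q i j)"
  have q: "?Q i j q" unfolding q_def by (rule arg_min_natI[of "?Q i j", OF q0])
  have min: "length q \<le> length q'" if "?Q i j q'" for q'
    unfolding q_def by (rule arg_min_nat_le[of "?Q i j", OF that])
  have wS: "letters \<Delta> q \<in> words_on S" if "walk \<Delta> i q j" for i q
    using that lab
  proof (induction q arbitrary: i)
    case (Cons p q) then show ?case by (cases p) auto
  qed simp
  have inj: "inj_on (word_value G) (reduced_words_on S)"
    using free by (simp add: free_generating_set_def bij_betw_def)
  have "letters \<Delta> q \<notin> reduced_words_on S"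
  proof
    assume "letters \<Delta> q \<in> reduced_words_on S"
    moreover have "[] \<in> reduced_words_on S" by (simp add: reduced_words_on_def)
    ultimately have "letters \<Delta> q = []" using inj_onD[OF inj, of "letters \<Delta> q" "[]"] q by simp
    then have "q = []" by (simp add: letters_def)
    then show False using q ij by simp
  qed
  then have "\<not> successively (\<lambda>x y. \<not> (snd x = snd y \<and> fst x \<noteq> fst y)) (letters \<Delta> q)"
    using wS q by (auto simp: reduced_words_on_def)
  then have "\<not> successively (\<lambda>x y. \<not> (lab \<Delta> (snd x) = lab \<Delta> (snd y) \<and> fst x \<noteq> fst y)) q"
    unfolding letters_def successively_map by (simp add: case_prod_beta)
  then obtain xs x y ys where xy: "q = xs @ x # y # ys" "lab \<Delta> (snd x) = lab \<Delta> (snd y)"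
    "fst x \<noteq> fst y"
    by (blast dest: not_successively_split)
  obtain b d where x: "x = (b, d)" by (cases x)
  obtain d' where y: "y = (\<not> b, d')" using xy(3) x by (cases y) auto
  from q obtain u where u: "walk \<Delta> i xs u" "d \<in> edges \<Delta>" "d' \<in> edges \<Delta>"
    "u = (if b then src \<Delta> d else tgt \<Delta> d)"
    "(if b then tgt \<Delta> d else src \<Delta> d) = (if b then tgt \<Delta> d' else src \<Delta> d')"
    "walk \<Delta> (if b then src \<Delta> d' else tgt \<Delta> d') ys j"
    by (auto simp: xy(1) x y split: if_splits)
  have "d \<noteq> d'"
  proof
    assume "d = d'"
    then have "walk \<Delta> i (xs @ ys) j" using u by auto
    moreover have "word_value G (letters \<Delta> (xs @ ys)) = \<one>"
    proof -
      have w: "letters \<Delta> xs \<in> words_on (carrier G)" "letters \<Delta> ys \<in> words_on (carrier G)"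
        using u letters_in_words_on[OF goodD(1)[OF assms(1)]] by auto
      have l: "lab \<Delta> d \<in> carrier G" using u(2) lab S_carrier by blast
      have "\<one> = word_value G (letters \<Delta> q)" using q by simp
      also have "\<dots> = word_value G (letters \<Delta> xs) \<otimes>
          word_value G ((b, lab \<Delta> d) # (\<not> b, lab \<Delta> d) # letters \<Delta> ys)"
        using w l by (simp add: xy(1) x y word_value_append flip: \<open>d = d'\<close>)
      also have "word_value G ((b, lab \<Delta> d) # (\<not> b, lab \<Delta> d) # letters \<Delta> ys) =
          word_value G (letters \<Delta> ys)"
        using w l by (cases b) (simp_all add: word_value_closed flip: m_assoc)
      finally show ?thesis using w by (simp add: word_value_append)
    qed
    ultimately show False using min[of "xs @ ys"] by (simp add: xy(1))
  qed
  then show thesis using that[of d d'] u xy(2) x y by (cases b) auto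
qed

text \<open>A fold is a slide followed by the contraction of the resulting unit edge, and each
  contraction removes a vertex, which is the induction measure. When no unit edge is left and
  \<open>pos\<close> is injective, the graph is immersed.\<close>

lemma solvable_letters:
  fixes \<Delta> :: "('v, 'e, 'a, 'c) lgraph"
  assumes "good \<Delta>" "labelling \<Delta> P" "\<And>d. d \<in> edges \<Delta> \<Longrightarrow> lab \<Delta> d \<in> insert \<one> S"
    and "pos \<Delta> ` verts \<Delta> = C"
  shows "solvable \<Delta> P"
  using assms
proof (induction "card (verts \<Delta>)" arbitrary: \<Delta> P rule: less_induct)
  case less
  note wf = wf_graphD[OF goodD(1)[OF less.prems(1)]]
  have contract: "good (contract_edge d \<Delta>') \<and> card (verts (contract_edge d \<Delta>')) < card (verts \<Delta>) \<and>
      pos (contract_edge d \<Delta>') ` verts (contract_edge d \<Delta>') = C"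
    if D: "good \<Delta>'" "d \<in> edges \<Delta>'" "lab \<Delta>' d = \<one>" "verts \<Delta>' = verts \<Delta>" "pos \<Delta>' = pos \<Delta>"
    for \<Delta>' :: "('v, 'e, 'a, 'c) lgraph" and d
  proof -
    note wf' = wf_graphD[OF goodD(1)[OF D(1)]] and po' = positionedD[OF goodD(2)[OF D(1)]]
    have "src \<Delta>' d \<noteq> tgt \<Delta>' d" by (rule unit_edge_not_loop[OF D(1-3)])
    moreover have "pos \<Delta>' (tgt \<Delta>' d) = pos \<Delta>' (src \<Delta>' d)"
      using po'(2)[OF D(2)] po'(1) wf'(3)[OF D(2)] D(3) by simp
    moreover have "src \<Delta>' d \<in> verts \<Delta>" "tgt \<Delta>' d \<in> verts \<Delta>" using wf' D by auto
    ultimately have "pos \<Delta> ` (verts \<Delta> - {tgt \<Delta>' d}) = pos \<Delta> ` verts \<Delta>"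
      using D(5) by (auto simp: image_iff)
    moreover have "card (verts \<Delta> - {tgt \<Delta>' d}) < card (verts \<Delta>)"
      using wf'(4)[OF D(2)] D(4) wf(1) by (intro psubset_card_mono) auto
    ultimately show ?thesis
      using good_contract_edge[OF D(1-3)] D(4,5) less.prems(4) by simp
  qed
  show ?case
  proof (cases "\<exists>d\<in>edges \<Delta>. lab \<Delta> d = \<one>")
    case True
    then obtain d where d: "d \<in> edges \<Delta>" "lab \<Delta> d = \<one>" by blast
    show ?thesis
      by (rule solvable_contract_edge[OF less.prems(1,2) d], rule less.hyps)
        (use contract[OF less.prems(1) d] less.prems(3) in auto)
  next
    case False
    then have lab: "lab \<Delta> d \<in> S" if "d \<in> edges \<Delta>" for d using less.prems(3)[OF that] that by auto
    show ?thesis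
    proof (cases "inj_on (pos \<Delta>) (verts \<Delta>)")
      case True
      then show ?thesis using less.prems lab by (intro solvable_immersed) auto
    next
      case False
      then obtain d d' where d: "d \<in> edges \<Delta>" "d' \<in> edges \<Delta>" "d \<noteq> d'" "lab \<Delta> d = lab \<Delta> d'"
        and dd: "tgt \<Delta> d = tgt \<Delta> d' \<or> src \<Delta> d = src \<Delta> d'"
        using foldable_edges[OF less.prems(1) lab] by blast
      from dd show ?thesis
      proof
        assume t: "tgt \<Delta> d = tgt \<Delta> d'"
        let ?D1 = "slide_edge d d' \<Delta>"
        have g1: "good ?D1" by (rule good_slide_edge[OF less.prems(1) d(1-3) t d(4)])
        have d1: "d' \<in> edges ?D1" "lab ?D1 d' = \<one>" using d by auto
        show ?thesis
          by (rule solvable_slide_edge[OF less.prems(1,2) d(1-3) t d(4)],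
              rule solvable_contract_edge[OF g1 _ d1], assumption, rule less.hyps)
            (use contract[OF g1 d1] less.prems(3) in auto)
      next
        assume s: "src \<Delta> d = src \<Delta> d'"
        \<comment> \<open>Edges with a common source are reversed so that they share their target.
          After the fold the surviving edge \<open>d\<close> is turned back, which brings its label
          back into \<open>S\<close>.\<close>
        let ?D2 = "flip_edge d' (flip_edge d \<Delta>)"
        let ?D3 = "slide_edge d d' ?D2"
        let ?D4 = "contract_edge d' ?D3"
        let ?D5 = "flip_edge d ?D4"
        have g2': "good (flip_edge d \<Delta>)" by (rule good_flip_edge[OF less.prems(1) d(1)])
        have g2: "good ?D2" by (rule good_flip_edge[OF g2']) (use d in auto)
        have d2: "d \<in> edges ?D2" "d' \<in> edges ?D2" "d \<noteq> d'" "tgt ?D2 d = tgt ?D2 d'"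
          "lab ?D2 d = lab ?D2 d'" using d s by auto
        have g3: "good ?D3" by (rule good_slide_edge[OF g2 d2])
        have d3: "d' \<in> edges ?D3" "lab ?D3 d' = \<one>" using d by auto
        note c = contract[OF g3 d3]
        have g4: "good ?D4" using c by simp
        have d4: "d \<in> edges ?D4" using d by auto
        have g5: "good ?D5" by (rule good_flip_edge[OF g4 d4])
        have ll: "inv (inv (lab \<Delta> d)) = lab \<Delta> d" using wf d by simp
        have lab5: "lab ?D5 e \<in> insert \<one> S" if "e \<in> edges ?D5" for e
          using that less.prems(3)[of e] d ll by (cases "e = d") auto
        have s5: "solvable ?D5 Q" if "labelling ?D5 Q" for Q
          by (rule less.hyps[OF _ g5 that lab5]) (use c in auto)
        have s4: "solvable ?D4 Q" if "labelling ?D4 Q" for Q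
          by (rule solvable_flip_edge[OF g4 that, of d], rule s5) (use that in simp)
        have s2: "solvable ?D2 P"
          by (rule solvable_slide_edge[OF g2 _ d2], use less.prems(2) in simp,
              rule solvable_contract_edge[OF g3 _ d3 s4])
        show ?thesis
          by (rule solvable_flip_edge[OF less.prems(1,2), of d],
              rule solvable_flip_edge[OF g2' _ s2]) (use less.prems(2) in simp)
      qed
    qed
  qed
qed

end

section \<open>Spelling arbitrary labels in the free basis, and the folding theorem\<close>

context graph_folding
begin

lemma word_exists:
  assumes "g \<in> carrier G" obtains w where "w \<in> words_on S" "word_value G w = g"
proof -
  have "g \<in> word_value G ` reduced_words_on S"
    using free assms by (simp add: free_generating_set_def bij_betw_def)
  then show thesis using that by (auto simp: reduced_words_on_def)
qed

definition word_len :: "'a \<Rightarrow> nat" where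
  "word_len g = (LEAST n. \<exists>w\<in>words_on S. word_value G w = g \<and> length w = n)"

lemma word_len_le: "w \<in> words_on S \<Longrightarrow> word_len (word_value G w) \<le> length w"
  unfolding word_len_def by (rule Least_le) blast

lemma word_len_witness:
  assumes "g \<in> carrier G"
  obtains w where "w \<in> words_on S" "word_value G w = g" "length w = word_len g"
proof -
  obtain w where "w \<in> words_on S" "word_value G w = g" using word_exists[OF assms] .
  then have "\<exists>n. \<exists>w\<in>words_on S. word_value G w = g \<and> length w = n" by blast
  from LeastI_ex[OF this] show thesis using that by (auto simp flip: word_len_def)
qed

text \<open>Chosen so that it decreases both when a label splits into its first letter and the rest and
  when an inverse letter is turned around.\<close>

definition cost :: "'a \<Rightarrow> nat" where
  "cost g = (if g \<in> insert \<one> S then 0 else 2 * word_len g - 1)"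

lemma cost_le: "w \<in> words_on S \<Longrightarrow> cost (word_value G w) \<le> 2 * length w - 1"
  using word_len_le[of w] by (auto simp: cost_def)

text \<open>The total cost of the labels is the induction measure: the inverse of a single letter is
  removed by reversing its edge, a longer word is cut after its first letter. Infinite types supply
  the fresh vertex and edge for the cut.\<close>

lemma solvable_surjective:
  fixes \<Delta> :: "('v, 'e, 'a, 'c) lgraph"
  assumes inf: "infinite (UNIV :: 'v set)" "infinite (UNIV :: 'e set)"
    and "good \<Delta>" "labelling \<Delta> P" "pos \<Delta> ` verts \<Delta> = C"
  shows "solvable \<Delta> P"
  using assms(3-)
proof (induction "\<Sum>d\<in>edges \<Delta>. cost (lab \<Delta> d)" arbitrary: \<Delta> P rule: less_induct)
  case less
  note wf = wf_graphD[OF goodD(1)[OF less.prems(1)]] and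
    po = positionedD[OF goodD(2)[OF less.prems(1)]]
  show ?case
  proof (cases "\<forall>d\<in>edges \<Delta>. lab \<Delta> d \<in> insert \<one> S")
    case True
    then show ?thesis using less.prems by (intro solvable_letters) auto
  next
    case False
    then obtain d where d: "d \<in> edges \<Delta>" "lab \<Delta> d \<notin> insert \<one> S" by blast
    let ?l = "lab \<Delta> d"
    have l: "?l \<in> carrier G" using wf d by auto
    obtain w where w: "w \<in> words_on S" "word_value G w = ?l" "length w = word_len ?l"
      using word_len_witness[OF l] .
    have "w \<noteq> []" using w d by auto
    then obtain b s v where v: "w = (b, s) # v" by (metis list.exhaust surj_pair)
    have sv: "s \<in> S" "s \<in> carrier G" "v \<in> words_on S" "v \<in> words_on (carrier G)"
      using w v S_carrier by (auto intro: words_on_mono)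
    have cost_l: "cost ?l = 2 * length v + 1" using d w v by (simp add: cost_def)
    have cost_sum: "(\<Sum>f\<in>edges \<Delta>. cost (lab \<Delta> f)) =
        cost ?l + (\<Sum>f\<in>edges \<Delta> - {d}. cost (lab \<Delta> f))"
      using wf d by (simp add: sum.remove)
    show ?thesis
    proof (cases "v = []")
      case True
      have "\<not> b" using True w v sv d by (cases b) auto
      then have inv: "inv ?l = s" using True w v sv by (simp flip: w(2))
      have g: "good (flip_edge d \<Delta>)" by (rule good_flip_edge[OF less.prems(1) d(1)])
      have "(\<Sum>f\<in>edges \<Delta>. cost (lab (flip_edge d \<Delta>) f)) = (\<Sum>f\<in>edges \<Delta> - {d}. cost (lab \<Delta> f))"
      proof -
        have "(\<Sum>f\<in>edges \<Delta>. cost (lab (flip_edge d \<Delta>) f)) =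
            cost (lab (flip_edge d \<Delta>) d) + (\<Sum>f\<in>edges \<Delta> - {d}. cost (lab (flip_edge d \<Delta>) f))"
          using wf d by (intro sum.remove) auto
        also have "cost (lab (flip_edge d \<Delta>) d) = 0" using inv sv by (simp add: cost_def)
        also have "(\<Sum>f\<in>edges \<Delta> - {d}. cost (lab (flip_edge d \<Delta>) f)) =
            (\<Sum>f\<in>edges \<Delta> - {d}. cost (lab \<Delta> f))"
          by (intro sum.cong) auto
        finally show ?thesis by simp
      qed
      then have c: "(\<Sum>f\<in>edges (flip_edge d \<Delta>). cost (lab (flip_edge d \<Delta>) f)) <
          (\<Sum>f\<in>edges \<Delta>. cost (lab \<Delta> f))" using cost_sum cost_l by simp
      show ?thesis
        by (rule solvable_flip_edge[OF less.prems(1,2)], rule less.hyps[OF c g])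
          (use less.prems in auto)
    next
      case False
      define x where "x = (if b then s else inv s)"
      define y where "y = word_value G v"
      have xy: "x \<in> carrier G" "y \<in> carrier G" "?l = x \<otimes> y"
        using sv w v by (auto simp: x_def y_def word_value_closed)
      have "x = word_value G [(b, s)]" using sv by (simp add: x_def)
      \<comment> \<open>Together the halves cost at most \<open>1 + (2 * length v - 1)\<close>, one
        less than \<open>cost ?l\<close>. As \<open>v\<close> is nonempty, the subtraction is not
        truncated.\<close>
      then have "cost x \<le> 1" using cost_le[of "[(b, s)]"] sv by simp
      moreover have "cost y \<le> 2 * length v - 1" unfolding y_def using sv by (intro cost_le)
      moreover have "length v > 0" using False by simp
      ultimately have cxy: "cost x + cost y < cost ?l" using cost_l by linarith
      obtain n where n: "n \<notin> verts \<Delta>" using ex_new_if_finite[OF inf(1) wf(1)] by blast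
      obtain e where e: "e \<notin> edges \<Delta>" using ex_new_if_finite[OF inf(2) wf(2)] by blast
      let ?D = "subdivide_edge d n e x y \<Delta>"
      have ed: "e \<noteq> d" using e d by auto
      have g: "good ?D" by (rule good_subdivide_edge[OF less.prems(1) d(1) n e xy])
      have "(\<Sum>f\<in>edges ?D. cost (lab ?D f)) = cost y + (\<Sum>f\<in>edges \<Delta>. cost (if f = d then x else lab \<Delta> f))"
        using wf(2) e by (auto intro!: sum.cong)
      also have "\<dots> = cost y + cost x + (\<Sum>f\<in>edges \<Delta> - {d}. cost (lab \<Delta> f))"
        using wf d by (simp add: sum.remove)
      finally have c: "(\<Sum>f\<in>edges ?D. cost (lab ?D f)) < (\<Sum>f\<in>edges \<Delta>. cost (lab \<Delta> f))"
        using cost_sum cxy by simp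
      have "pos ?D ` verts ?D = insert (r (pos \<Delta> (src \<Delta> d)) x) (pos \<Delta> ` verts \<Delta>)"
        using n by (auto simp: image_iff)
      then have surj: "pos ?D ` verts ?D = C"
        using less.prems(3) po wf d xy by (auto simp: insert_absorb)
      show ?thesis
        by (rule solvable_subdivide_edge[OF less.prems(1,2) d(1) n e xy], rule less.hyps[OF c g])
          (use surj in auto)
    qed
  qed
qed

text \<open>Positions not yet reached are covered by attaching leaves, which leaves the functional
  unchanged; transitivity provides their labels. Once \<open>pos\<close> is onto \<open>C\<close>,
  the spelling and folding steps apply.\<close>

theorem fold_to_schreier:
  fixes \<Delta> :: "('v, 'e, 'a, 'c) lgraph"
  assumes inf: "infinite (UNIV :: 'v set)" "infinite (UNIV :: 'e set)"
    and transitive: "\<And>c c'. c \<in> C \<Longrightarrow> c' \<in> C \<Longrightarrow> \<exists>y\<in>carrier G. r c y = c'"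
    and "good \<Delta>" "labelling \<Delta> P" "verts \<Delta> \<noteq> {}"
  shows "\<exists>Q. labelling schreier Q \<and> graph_F schreier Q \<le> graph_F \<Delta> P \<and>
     (\<forall>i\<in>verts \<Delta>. P i \<subseteq> Q (pos \<Delta> i))"
proof -
  have "solvable \<Delta> P" using assms(4-)
  proof (induction "card (C - pos \<Delta> ` verts \<Delta>)" arbitrary: \<Delta> P rule: less_induct)
    case less
    note wf = wf_graphD[OF goodD(1)[OF less.prems(1)]] and
      po = positionedD[OF goodD(2)[OF less.prems(1)]]
    show ?case
    proof (cases "pos \<Delta> ` verts \<Delta> = C")
      case True
      then show ?thesis using less.prems inf by (intro solvable_surjective)
    next
      case False
      then obtain c where c: "c \<in> C" "c \<notin> pos \<Delta> ` verts \<Delta>" using po by blast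
      obtain i where i: "i \<in> verts \<Delta>" using less.prems(3) by blast
      then obtain y where y: "y \<in> carrier G" "r (pos \<Delta> i) y = c"
        using transitive[of "pos \<Delta> i" c] po c by auto
      obtain n where n: "n \<notin> verts \<Delta>" using ex_new_if_finite[OF inf(1) wf(1)] by blast
      obtain e where e: "e \<notin> edges \<Delta>" using ex_new_if_finite[OF inf(2) wf(2)] by blast
      let ?D = "add_leaf i n e y \<Delta>"
      have g: "good ?D" by (rule good_add_leaf[OF less.prems(1) i n e y(1)])
      have "pos ?D ` verts ?D = insert c (pos \<Delta> ` verts \<Delta>)"
        using n y by (auto simp: image_iff)
      then have "card (C - pos ?D ` verts ?D) < card (C - pos \<Delta> ` verts \<Delta>)"
        using c finite_C by (intro psubset_card_mono) auto
      from less.hyps[OF this g] show ?thesis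
        by (intro solvable_add_leaf[OF less.prems(1,2) i n e y(1)]) auto
    qed
  qed
  then show ?thesis by (simp add: solvable_def)
qed

end

section \<open>Word balls\<close>

lemma word_ball_mono: "m \<le> n \<Longrightarrow> word_ball G S m \<subseteq> word_ball G S n"
  by (auto simp: word_ball_def)

lemma finite_word_ball:
  fixes S :: "'a set"
  assumes "finite S" shows "finite (word_ball G S n)"
proof -
  have "finite {w :: (bool \<times> 'a) list. set w \<subseteq> UNIV \<times> S \<and> length w \<le> n}" for n
    using assms by (intro finite_lists_length_le) auto
  moreover have "{w \<in> words_on S. length w \<le> n} = {w. set w \<subseteq> UNIV \<times> S \<and> length w \<le> n}"
    by (auto simp: words_on_def)
  ultimately show ?thesis by (simp add: word_ball_def)
qed

lemma word_ball_0: "word_ball G S 0 = {\<one>\<^bsub>G\<^esub>}"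
  by (auto simp: word_ball_def intro!: image_eqI[of _ _ "[]"])

lemma one_in_word_ball: "\<one>\<^bsub>G\<^esub> \<in> word_ball G S n"
  using word_ball_mono[of 0 n G S] by (auto simp: word_ball_0)

lemma word_ball_SucE:
  assumes "y \<in> word_ball G S (Suc n)"
  obtains "y \<in> word_ball G S n"
  | b s z where "s \<in> S" "z \<in> word_ball G S n" "y = (if b then s else inv\<^bsub>G\<^esub> s) \<otimes>\<^bsub>G\<^esub> z"
proof -
  obtain w where w: "w \<in> words_on S" "length w \<le> Suc n" "y = word_value G w"
    using assms by (auto simp: word_ball_def)
  show thesis
  proof (cases w)
    case Nil
    then show ?thesis using w one_in_word_ball that(1) by fastforce
  next
    case (Cons p v)
    then show ?thesis using w that(2)[of "snd p" "word_value G v" "fst p"]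
      by (cases p) (auto simp: word_ball_def)
  qed
qed

lemma (in group) word_ball_closed: "S \<subseteq> carrier G \<Longrightarrow> word_ball G S n \<subseteq> carrier G"
  by (auto simp: word_ball_def intro!: word_value_closed intro: words_on_mono)

lemma (in group) ex_word_ball:
  assumes "free_generating_set G S" "y \<in> carrier G" shows "\<exists>n. y \<in> word_ball G S n"
proof -
  have "y \<in> word_value G ` reduced_words_on S"
    using assms by (simp add: free_generating_set_def bij_betw_def)
  then show ?thesis by (auto simp: word_ball_def reduced_words_on_def)
qed

section \<open>Stability of the functional when labels are enlarged, and its values on balls\<close>

context invariant_polymatroid
begin

text \<open>Edge terms only grow under enlargement and enter negatively, so the vertex entropies
  account for any increase.\<close>

lemma graph_F_le_enlarged:
  assumes "wf_graph \<Delta>" "labelling \<Delta> Q" "\<And>i. i \<in> verts \<Delta> \<Longrightarrow> P i \<subseteq> Q i"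
  shows "graph_F \<Delta> Q \<le> graph_F \<Delta> P + (\<Sum>i\<in>verts \<Delta>. h (Q i) - h (P i))"
proof -
  note wf = wf_graphD[OF assms(1)]
  have "(\<Sum>d\<in>edges \<Delta>. mi (P (src \<Delta> d)) (a (lab \<Delta> d) ` P (tgt \<Delta> d))) \<le>
      (\<Sum>d\<in>edges \<Delta>. mi (Q (src \<Delta> d)) (a (lab \<Delta> d) ` Q (tgt \<Delta> d)))"
    using wf by (intro sum_mono mi_edge_mono labellingD(3)[OF assms(2)] assms(3)) auto
  then show ?thesis by (simp add: graph_F_def sum_subtractf)
qed

text \<open>In the mutual information of an edge each of the two single entropies rises by at most
  \<open>\<delta>\<close>, while the joint entropy, which enters negatively, cannot fall. This gives
  \<open>2 * \<delta>\<close> per edge.\<close>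

lemma graph_F_ge_enlarged:
  assumes "wf_graph \<Delta>" "labelling \<Delta> Q" "\<And>i. i \<in> verts \<Delta> \<Longrightarrow> P i \<subseteq> Q i"
    and \<delta>: "\<And>i. i \<in> verts \<Delta> \<Longrightarrow> h (Q i) - h (P i) \<le> \<delta>"
  shows "graph_F \<Delta> P \<le> graph_F \<Delta> Q + 2 * \<delta> * card (edges \<Delta>)"
proof -
  note wf = wf_graphD[OF assms(1)]
  have "(\<Sum>d\<in>edges \<Delta>. mi (Q (src \<Delta> d)) (a (lab \<Delta> d) ` Q (tgt \<Delta> d))) \<le>
      (\<Sum>d\<in>edges \<Delta>. mi (P (src \<Delta> d)) (a (lab \<Delta> d) ` P (tgt \<Delta> d)) + 2 * \<delta>)"
  proof (intro sum_mono)
    fix d assume d: "d \<in> edges \<Delta>"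
    let ?i = "src \<Delta> d" and ?j = "tgt \<Delta> d" and ?l = "lab \<Delta> d"
    have v: "?i \<in> verts \<Delta>" "?j \<in> verts \<Delta>" "?l \<in> carrier G" using wf d by auto
    note Q = labellingD[OF assms(2) v(1)] labellingD[OF assms(2) v(2)]
    note P = assms(3)[OF v(1)] assms(3)[OF v(2)]
    have fP: "fin (P ?j)" using P Q by (auto intro: finite_subset)
    have "fin (a ?l ` Q ?j)" using Q v by (intro fin_image) auto
    then have "h (P ?i \<union> a ?l ` P ?j) \<le> h (Q ?i \<union> a ?l ` Q ?j)"
      using P Q by (intro h_mono) auto
    moreover have "h (a ?l ` Q ?j) = h (Q ?j)" "h (a ?l ` P ?j) = h (P ?j)"
      using v Q fP by (auto intro!: h_invariant)
    ultimately show "mi (Q ?i) (a ?l ` Q ?j) \<le> mi (P ?i) (a ?l ` P ?j) + 2 * \<delta>"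
      using \<delta>[OF v(1)] \<delta>[OF v(2)] by (simp add: mi_def)
  qed
  moreover have "(\<Sum>i\<in>verts \<Delta>. h (P i)) \<le> (\<Sum>i\<in>verts \<Delta>. h (Q i))"
    using assms(3) labellingD[OF assms(2)] by (intro sum_mono h_mono) auto
  ultimately show ?thesis by (simp add: graph_F_def sum.distrib mult.commute)
qed

text \<open>When \<open>w\<close> is the observable of a partition, this is the finite set of
  observables behind the join of its translates over a word ball.\<close>

definition orbit_ball :: "'a set \<Rightarrow> 'w \<Rightarrow> nat \<Rightarrow> 'w set" where
  "orbit_ball S w n = (\<lambda>y. a y w) ` word_ball G S n"

lemma fin_orbit_ball: "finite S \<Longrightarrow> S \<subseteq> carrier G \<Longrightarrow> w \<in> W \<Longrightarrow> fin (orbit_ball S w n)"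
  using word_ball_closed[of S n] finite_word_ball[of S G n] by (auto simp: orbit_ball_def)

lemma orbit_ball_mono: "m \<le> n \<Longrightarrow> orbit_ball S w m \<subseteq> orbit_ball S w n"
  unfolding orbit_ball_def by (intro image_mono word_ball_mono)

lemma orbit_ball_0: "w \<in> W \<Longrightarrow> orbit_ball S w 0 = {w}"
  by (simp add: orbit_ball_def word_ball_0)

text \<open>Bowen's functional at stage \<open>n\<close>, rewritten with mutual information.\<close>

definition basis_F :: "'a set \<Rightarrow> 'w \<Rightarrow> nat \<Rightarrow> real" where
  "basis_F S w n = h (orbit_ball S w n) -
     (\<Sum>s\<in>S. mi (orbit_ball S w n) (a s ` orbit_ball S w n))"

end

section \<open>Approximation of an arbitrary labelling of the Schreier graph by orbit balls\<close>

context graph_folding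
begin

text \<open>A label that does not depend on the coset repeats the same vertex and edge terms over
  every coset; this is multiplicativity under the covering.\<close>

lemma graph_F_schreier_orbit_ball:
  "graph_F schreier (\<lambda>_. orbit_ball S w n) = card C * basis_F S w n"
proof -
  let ?m = "\<lambda>s. mi (orbit_ball S w n) (a s ` orbit_ball S w n)"
  have "(\<Sum>d\<in>C \<times> S. ?m (snd d)) = (\<Sum>(c, s)\<in>C \<times> S. ?m s)"
    by (simp add: case_prod_beta)
  also have "\<dots> = (\<Sum>c\<in>C. \<Sum>s\<in>S. ?m s)" by (rule sum.cartesian_product[symmetric])
  also have "\<dots> = card C * (\<Sum>s\<in>S. ?m s)" by simp
  finally show ?thesis by (simp add: graph_F_def basis_F_def right_diff_distrib)
qed

text \<open>What the vertex \<open>c\<close> sees within \<open>n\<close> steps: the label at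
  \<open>r c y\<close> is brought back to \<open>c\<close> by \<open>y\<close>.\<close>

definition neighbourhood :: "nat \<Rightarrow> ('c \<Rightarrow> 'w set) \<Rightarrow> 'c \<Rightarrow> 'w set" where
  "neighbourhood n Q c = (\<Union>y\<in>word_ball G S n. a y ` Q (r c y))"

lemma labelling_neighbourhood:
  assumes "labelling schreier Q" shows "labelling schreier (neighbourhood n Q)"
proof -
  have "fin (a y ` Q (r c y))" if "c \<in> C" "y \<in> word_ball G S n" for c y
  proof -
    have "y \<in> carrier G" using that word_ball_closed[OF S_carrier, of n] by auto
    then show ?thesis
      using labellingD(3)[OF assms, of "r c y"] that by (intro fin_image) simp_all
  qed
  then show ?thesis
    using finite_word_ball[OF finite_S, of G n]
    by (fastforce simp: labelling_def neighbourhood_def)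
qed

lemma neighbourhood_mono: "m \<le> n \<Longrightarrow> neighbourhood m Q c \<subseteq> neighbourhood n Q c"
  using word_ball_mono[of m n G S] by (auto simp: neighbourhood_def)

lemma neighbourhood_0:
  assumes "labelling schreier Q" "c \<in> C" shows "neighbourhood 0 Q c = Q c"
  using labellingD(2)[OF assms(1)] assms(2) by (simp add: neighbourhood_def word_ball_0 image_one)

text \<open>A step by an inverse letter is a passage against the edge that leaves
  \<open>r c (inv s)\<close>, which is why both orientations of \<open>graph_F_splitting\<close>
  occur.\<close>

lemma schreier_splitting:
  assumes "labelling schreier P" "labelling schreier Q"
    and "\<And>c. c \<in> C \<Longrightarrow> P c \<subseteq> Q c"
    and "\<And>c w. c \<in> C \<Longrightarrow> w \<in> Q c - P c \<Longrightarrow>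
      \<exists>b. \<exists>s\<in>S. w \<in> a (if b then s else inv s) ` P (r c (if b then s else inv s))"
  shows "graph_F schreier Q \<le> graph_F schreier P"
proof (rule graph_F_splitting[OF wf_schreier assms(1,2)])
  fix c w assume cw: "c \<in> verts schreier" "w \<in> Q c - P c"
  then obtain b s where s: "s \<in> S" "w \<in> a (if b then s else inv s) ` P (r c (if b then s else inv s))"
    using assms(4)[of c w] by auto
  have sc: "s \<in> carrier G" using s S_carrier by auto
  show "(\<exists>d\<in>edges schreier. src schreier d = c \<and> w \<in> a (lab schreier d) ` P (tgt schreier d)) \<or>
    (\<exists>d\<in>edges schreier. tgt schreier d = c \<and> w \<in> a (inv (lab schreier d)) ` P (src schreier d))"
  proof (cases b)
    case True
    then show ?thesis using s cw by (intro disjI1 bexI[of _ "(c, s)"]) auto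
  next
    case False
    have "r (r c (inv s)) s = c" using cw sc by (simp flip: r_mult)
    then show ?thesis using False s cw sc by (intro disjI2 bexI[of _ "(r c (inv s), s)"]) auto
  qed
qed (use assms(3) in auto)

text \<open>Cutting off the first letter of a word shows that whatever enters at radius
  \<open>Suc n\<close> was seen by an adjacent vertex at radius \<open>n\<close>. Growing the radius
  is thus a splitting.\<close>

lemma graph_F_neighbourhood:
  assumes "labelling schreier Q"
  shows "graph_F schreier (neighbourhood n Q) \<le> graph_F schreier Q"
proof (induction n)
  case 0
  then show ?case
    using neighbourhood_0[OF assms] by (intro eq_refl graph_F_eqI wf_schreier) auto
next
  case (Suc n)
  have "graph_F schreier (neighbourhood (Suc n) Q) \<le> graph_F schreier (neighbourhood n Q)"
  proof (intro schreier_splitting labelling_neighbourhood assms)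
    fix c w assume c: "c \<in> C" and w: "w \<in> neighbourhood (Suc n) Q c - neighbourhood n Q c"
    then obtain y u where y: "y \<in> word_ball G S (Suc n)" "u \<in> Q (r c y)" "w = a y u"
      by (auto simp: neighbourhood_def)
    from y(1) show "\<exists>b. \<exists>s\<in>S. w \<in> a (if b then s else inv s) `
        neighbourhood n Q (r c (if b then s else inv s))"
    proof (cases rule: word_ball_SucE)
      case 1
      then show ?thesis using w y by (auto simp: neighbourhood_def)
    next
      case (2 b s z)
      let ?s = "if b then s else inv s"
      have carr: "?s \<in> carrier G" "z \<in> carrier G"
        using 2 S_carrier word_ball_closed[OF S_carrier, of n] by auto
      have "r c y = r (r c ?s) z" using 2 carr c by (simp add: r_mult)
      moreover have "u \<in> W" using labellingD(2)[OF assms, of "r c y"] y c 2 carr by auto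
      ultimately have "w = a ?s (a z u)" "u \<in> Q (r (r c ?s) z)"
        using y 2 carr by (simp_all add: a_mult)
      moreover have "a z u \<in> neighbourhood n Q (r c ?s)"
        unfolding neighbourhood_def by (intro UN_I[OF 2(2)] imageI calculation)
      ultimately show ?thesis using 2 by blast
    qed
  qed (use neighbourhood_mono in auto)
  with Suc show ?case by simp
qed

text \<open>With \<open>w\<close> present at every vertex, larger balls of its orbit reach each
  vertex through the edges, again by splittings.\<close>

lemma graph_F_Un_orbit_ball:
  assumes "labelling schreier Q" "w \<in> W" "\<And>c. c \<in> C \<Longrightarrow> w \<in> Q c"
  shows "graph_F schreier (\<lambda>c. Q c \<union> orbit_ball S w n) \<le> graph_F schreier Q"
proof (induction n)
  case 0
  then show ?case using assms
    by (intro eq_refl graph_F_eqI wf_schreier) (auto simp: orbit_ball_0)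
next
  case (Suc n)
  have lab: "labelling schreier (\<lambda>c. Q c \<union> orbit_ball S w n)" for n
    using assms(1) fin_orbit_ball[OF finite_S S_carrier assms(2), of n]
    by (auto simp: labelling_def)
  have "graph_F schreier (\<lambda>c. Q c \<union> orbit_ball S w (Suc n)) \<le>
      graph_F schreier (\<lambda>c. Q c \<union> orbit_ball S w n)"
  proof (intro schreier_splitting lab)
    fix c v assume c: "c \<in> C" and v: "v \<in> Q c \<union> orbit_ball S w (Suc n) - (Q c \<union> orbit_ball S w n)"
    then obtain y where y: "y \<in> word_ball G S (Suc n)" "v = a y w" by (auto simp: orbit_ball_def)
    from y(1) show "\<exists>b. \<exists>s\<in>S. v \<in> a (if b then s else inv s) `
        (Q (r c (if b then s else inv s)) \<union> orbit_ball S w n)"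
    proof (cases rule: word_ball_SucE)
      case 1
      then show ?thesis using v y by (auto simp: orbit_ball_def)
    next
      case (2 b s z)
      let ?s = "if b then s else inv s"
      have carr: "?s \<in> carrier G" "z \<in> carrier G"
        using 2 S_carrier word_ball_closed[OF S_carrier, of n] by auto
      then have "v = a ?s (a z w)" "a z w \<in> orbit_ball S w n"
        using y 2 assms(2) by (auto simp: orbit_ball_def a_mult)
      then show ?thesis using 2 by blast
    qed
  qed (use orbit_ball_mono[of n "Suc n" S w] in auto)
  with Suc show ?case by simp
qed

text \<open>Three changes lead from \<open>Q\<close> to the orbit ball of \<open>w\<close>. First
  pass to a neighbourhood that almost determines \<open>w\<close> and add \<open>w\<close>. Then
  spread the orbit of \<open>w\<close>, which costs nothing. Finally drop all but the orbit ball,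
  which by then almost determines the rest. The first and the last change cost at most
  \<open>\<epsilon> / 2\<close> each.\<close>

lemma schreier_lower_bound:
  assumes lQ: "labelling schreier Q" and w: "w \<in> W"
    and det1: "\<And>v. v \<in> W \<Longrightarrow> determined_by ((\<lambda>y. a y w) ` carrier G) v"
    and det2: "\<And>c. c \<in> C \<Longrightarrow> determined_by (\<Union>y\<in>carrier G. a y ` Q (r c y)) w"
    and "0 < \<epsilon>"
  shows "\<exists>n. card C * basis_F S w n \<le> graph_F schreier Q + \<epsilon>"
proof -
  \<comment> \<open>The share of \<open>\<epsilon> / 2\<close> for one vertex; the added one keeps
    the denominator positive.\<close>
  define \<delta> where "\<delta> = \<epsilon> / (2 * (card C + 1))"
  have \<delta>: "0 < \<delta>" "card C * \<delta> \<le> \<epsilon> / 2"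
    using \<open>0 < \<epsilon>\<close> by (auto simp: \<delta>_def field_simps)
  have "\<exists>m. \<forall>n\<ge>m. h (insert w (neighbourhood n Q c)) - h (neighbourhood n Q c) \<le> \<delta>" if c: "c \<in> C" for c
  proof -
    obtain B where B: "finite B" "B \<subseteq> (\<Union>y\<in>carrier G. a y ` Q (r c y))" "h (insert w B) - h B < \<delta>"
      using det2[OF c] \<delta>(1) unfolding determined_by_def by blast
    have "\<exists>m. b \<in> neighbourhood m Q c" if "b \<in> B" for b
    proof -
      have "b \<in> (\<Union>y\<in>carrier G. a y ` Q (r c y))" using B(2) that by (rule subsetD)
      then obtain y where y: "y \<in> carrier G" "b \<in> a y ` Q (r c y)" by (rule UN_E)
      obtain m where "y \<in> word_ball G S m" using ex_word_ball[OF free y(1)] ..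
      then show ?thesis using y(2) by (auto simp: neighbourhood_def)
    qed
    then obtain m where m: "\<And>b. b \<in> B \<Longrightarrow> b \<in> neighbourhood (m b) Q c" by metis
    show ?thesis
    proof (intro exI[of _ "Max (insert 0 (m ` B))"] allI impI)
      fix n assume n: "Max (insert 0 (m ` B)) \<le> n"
      have "B \<subseteq> neighbourhood n Q c"
      proof
        fix b assume b: "b \<in> B"
        then have "m b \<le> n" using n B(1) by (auto simp: Max_le_iff)
        then show "b \<in> neighbourhood n Q c" using m[OF b] neighbourhood_mono by blast
      qed
      then have "h ({w} \<union> neighbourhood n Q c) - h (neighbourhood n Q c) \<le> h ({w} \<union> B) - h B"
        using labellingD(3)[OF labelling_neighbourhood[OF lQ], of c n] c w
        by (intro increment_antimono) simp_all
      then show "h (insert w (neighbourhood n Q c)) - h (neighbourhood n Q c) \<le> \<delta>" using B(3) by simp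
    qed
  qed
  then obtain m where m: "\<And>c n. c \<in> C \<Longrightarrow> m c \<le> n \<Longrightarrow>
      h (insert w (neighbourhood n Q c)) - h (neighbourhood n Q c) \<le> \<delta>" by metis
  define N where "N = Max (insert 0 (m ` C))"
  have N: "m c \<le> N" if "c \<in> C" for c using that finite_C by (auto simp: N_def)
  define Q' where "Q' = (\<lambda>c. insert w (neighbourhood N Q c))"
  have lN: "labelling schreier (neighbourhood N Q)" by (rule labelling_neighbourhood[OF lQ])
  then have lQ': "labelling schreier Q'" using w by (auto simp: Q'_def labelling_def)
  have "graph_F schreier Q' \<le> graph_F schreier (neighbourhood N Q) +
      (\<Sum>c\<in>verts schreier. h (Q' c) - h (neighbourhood N Q c))"
    by (rule graph_F_le_enlarged[OF wf_schreier lQ']) (auto simp: Q'_def)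
  also have "(\<Sum>c\<in>verts schreier. h (Q' c) - h (neighbourhood N Q c)) \<le> (\<Sum>c\<in>C. \<delta>)"
    unfolding schreier_simps Q'_def using m N by (intro sum_mono) auto
  also have "\<dots> \<le> \<epsilon> / 2" using \<delta>(2) by simp
  finally have F1: "graph_F schreier Q' \<le> graph_F schreier Q + \<epsilon> / 2"
    using graph_F_neighbourhood[OF lQ, of N] by simp
  \<comment> \<open>Dropping observables costs \<open>2 * \<eta>\<close> per edge, hence the factor
    four for a total of at most \<open>\<epsilon> / 2\<close>.\<close>
  define \<eta> where "\<eta> = \<epsilon> / (4 * (card (C \<times> S) + 1))"
  have \<eta>: "0 < \<eta>" "2 * \<eta> * card (C \<times> S) \<le> \<epsilon> / 2"
    using \<open>0 < \<epsilon>\<close> by (auto simp: \<eta>_def field_simps)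
  have "\<exists>m. \<forall>n\<ge>m. h (Q' c \<union> orbit_ball S w n) - h (orbit_ball S w n) \<le> \<eta>" if c: "c \<in> C" for c
  proof -
    have fQ: "finite (Q' c)" "Q' c \<subseteq> W" using labellingD[OF lQ'] c by auto
    have "(\<lambda>y. a y w) ` carrier G \<subseteq> W" using w by auto
    from determined_by_finite[OF fQ this det1 \<eta>(1)] fQ(2)
    obtain B where B: "finite B" "B \<subseteq> (\<lambda>y. a y w) ` carrier G"
      "\<And>B'. fin B' \<Longrightarrow> B \<subseteq> B' \<Longrightarrow> h (Q' c \<union> B') - h B' < \<eta>"
      by auto
    have "\<exists>m. b \<in> orbit_ball S w m" if "b \<in> B" for b
    proof -
      have "b \<in> (\<lambda>y. a y w) ` carrier G" using B(2) \<open>b \<in> B\<close> by (rule subsetD)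
      then obtain y where y: "y \<in> carrier G" "b = a y w" by (auto simp only: image_iff)
      obtain m where "y \<in> word_ball G S m" using ex_word_ball[OF free y(1)] ..
      then show ?thesis using y(2) by (auto simp: orbit_ball_def)
    qed
    then obtain m where m: "\<And>b. b \<in> B \<Longrightarrow> b \<in> orbit_ball S w (m b)" by metis
    show ?thesis
    proof (intro exI[of _ "Max (insert 0 (m ` B))"] allI impI)
      fix n assume n: "Max (insert 0 (m ` B)) \<le> n"
      have "B \<subseteq> orbit_ball S w n"
      proof
        fix b assume b: "b \<in> B"
        then have "m b \<le> n" using n B(1) by (auto simp: Max_le_iff)
        then show "b \<in> orbit_ball S w n" using m[OF b] orbit_ball_mono by blast
      qed
      then show "h (Q' c \<union> orbit_ball S w n) - h (orbit_ball S w n) \<le> \<eta>"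
        using B(3) fin_orbit_ball[OF finite_S S_carrier w] by (intro less_imp_le) auto
    qed
  qed
  then obtain k where k: "\<And>c n. c \<in> C \<Longrightarrow> k c \<le> n \<Longrightarrow>
      h (Q' c \<union> orbit_ball S w n) - h (orbit_ball S w n) \<le> \<eta>" by metis
  define n where "n = Max (insert 0 (k ` C))"
  have n: "k c \<le> n" if "c \<in> C" for c using that finite_C by (auto simp: n_def)
  have "labelling schreier (\<lambda>c. Q' c \<union> orbit_ball S w n)"
    using lQ' fin_orbit_ball[OF finite_S S_carrier w, of n] by (auto simp: labelling_def)
  then have "graph_F schreier (\<lambda>_. orbit_ball S w n) \<le>
      graph_F schreier (\<lambda>c. Q' c \<union> orbit_ball S w n) + 2 * \<eta> * card (edges schreier)"
    using k n by (intro graph_F_ge_enlarged[OF wf_schreier]) auto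
  also have "graph_F schreier (\<lambda>c. Q' c \<union> orbit_ball S w n) \<le> graph_F schreier Q'"
    using lQ' w by (intro graph_F_Un_orbit_ball) (auto simp: Q'_def)
  finally show ?thesis
    using F1 \<eta>(2) by (intro exI[of _ n]) (simp add: graph_F_schreier_orbit_ball)
qed

end

section \<open>Coboundaries on graphs of free actions\<close>

section \<open>Potentials on free orbits\<close>

context group
begin

text \<open>The sum mod 2 of the cochain \<open>c\<close> along the path that a word spells from
  \<open>\<omega>\<close>. An inverse letter traverses the edge that leaves
  \<open>r \<omega> (inv s)\<close>.\<close>

fun parity :: "('o \<Rightarrow> 'a \<Rightarrow> 'o) \<Rightarrow> ('o \<Rightarrow> 'a \<Rightarrow> bool) \<Rightarrow> 'o \<Rightarrow> (bool \<times> 'a) list \<Rightarrow> bool" where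
  "parity r c \<omega> [] = False"
| "parity r c \<omega> ((b, s) # w) =
     ((if b then c \<omega> s else c (r \<omega> (inv s)) s) \<noteq> parity r c (r \<omega> (if b then s else inv s)) w)"

text \<open>On a free orbit a point is the base point moved by a unique element, hence by a unique
  reduced word, so the sum of \<open>c\<close> along this word is well defined.
  \<open>\<beta>\<close> gives the base point and \<open>\<gamma>\<close> the element; the
  equivariance of \<open>\<gamma>\<close> expresses freeness.\<close>

lemma free_potential:
  fixes r :: "'o \<Rightarrow> 'a \<Rightarrow> 'o" and c :: "'o \<Rightarrow> 'a \<Rightarrow> bool"
  assumes free: "free_generating_set G S"
    and r_closed: "\<And>\<omega> g. \<omega> \<in> \<Omega> \<Longrightarrow> g \<in> carrier G \<Longrightarrow> r \<omega> g \<in> \<Omega>"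
    and r_one: "\<And>\<omega>. \<omega> \<in> \<Omega> \<Longrightarrow> r \<omega> \<one> = \<omega>"
    and r_mult: "\<And>\<omega> g k. \<omega> \<in> \<Omega> \<Longrightarrow> g \<in> carrier G \<Longrightarrow> k \<in> carrier G \<Longrightarrow> r \<omega> (g \<otimes> k) = r (r \<omega> g) k"
    and sect: "\<And>\<omega>. \<omega> \<in> \<Omega> \<Longrightarrow> \<beta> \<omega> \<in> \<Omega> \<and> \<gamma> \<omega> \<in> carrier G \<and> r (\<beta> \<omega>) (\<gamma> \<omega>) = \<omega>"
    and sect_r: "\<And>\<omega> g. \<omega> \<in> \<Omega> \<Longrightarrow> g \<in> carrier G \<Longrightarrow> \<beta> (r \<omega> g) = \<beta> \<omega> \<and> \<gamma> (r \<omega> g) = \<gamma> \<omega> \<otimes> g"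
  shows "\<exists>p :: 'o \<Rightarrow> bool. \<forall>\<omega>\<in>\<Omega>. \<forall>s\<in>S. (p \<omega> \<noteq> p (r \<omega> s)) = c \<omega> s"
proof -
  have S: "S \<subseteq> carrier G" and bij: "bij_betw (word_value G) (reduced_words_on S) (carrier G)"
    using free by (auto simp: free_generating_set_def)
  define rw where "rw = inv_into (reduced_words_on S) (word_value G)"
  have rw: "rw g \<in> reduced_words_on S" "word_value G (rw g) = g" if "g \<in> carrier G" for g
    using bij that unfolding rw_def
    by (metis bij_betw_imp_surj_on inv_into_into, metis bij_betw_inv_into_right)
  have rw_eq: "rw (word_value G w) = w" if "w \<in> reduced_words_on S" for w
    using bij that unfolding rw_def by (metis bij_betw_inv_into_left)
  have wS: "w \<in> words_on (carrier G)" if "w \<in> words_on S" for w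
    using words_on_mono[OF S that] .
  have par_append: "parity r c \<omega> (v @ w) = (parity r c \<omega> v \<noteq> parity r c (r \<omega> (word_value G v)) w)"
    if "\<omega> \<in> \<Omega>" "v \<in> words_on S" for \<omega> v w
    using that
  proof (induction v arbitrary: \<omega>)
    case Nil
    then show ?case by (simp add: r_one)
  next
    case (Cons x v)
    obtain b s where x: "x = (b, s)" by (cases x)
    let ?s = "if b then s else inv s"
    have s: "?s \<in> carrier G" "v \<in> words_on S" using Cons.prems x S by auto
    then have "word_value G v \<in> carrier G" using wS by (intro word_value_closed)
    then have "r (r \<omega> ?s) (word_value G v) = r \<omega> (?s \<otimes> word_value G v)"
      using r_mult[OF Cons.prems(1) s(1)] by simp
    then show ?case using Cons.IH[OF r_closed[OF Cons.prems(1) s(1)] s(2)] x by auto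
  qed
  \<comment> \<open>Multiplication by \<open>s\<close> either extends the reduced word or cancels a
    final inverse letter. Either way the sum changes by the value of one edge.\<close>
  have step: "parity r c \<omega> (rw (g \<otimes> s)) = (parity r c \<omega> (rw g) \<noteq> c (r \<omega> g) s)"
    if \<omega>: "\<omega> \<in> \<Omega>" and g: "g \<in> carrier G" and s: "s \<in> S" for \<omega> g s
  proof (cases "rw g \<noteq> [] \<and> last (rw g) = (False, s)")
    case True
    define v where "v = butlast (rw g)"
    have v: "rw g = v @ [(False, s)]" using True by (metis append_butlast_last_id v_def)
    have sc: "s \<in> carrier G" using s S by auto
    have vr: "v \<in> reduced_words_on S" "v \<in> words_on S"
      using rw(1)[OF g] by (auto simp: v reduced_words_on_def successively_append_iff)
    have vc: "word_value G v \<in> carrier G" using vr wS by (intro word_value_closed)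
    have "g = word_value G v \<otimes> inv s"
      using rw(2)[OF g] vr wS sc by (simp add: v word_value_append)
    then have gs: "g \<otimes> s = word_value G v" using vc sc by (simp add: m_assoc)
    have "r (r \<omega> (g \<otimes> s)) (inv s) = r \<omega> g"
      using \<omega> g sc by (simp add: m_assoc flip: r_mult)
    then show ?thesis using par_append[OF \<omega> vr(2), of "[(False, s)]"] rw_eq[OF vr(1)] gs
      by (auto simp: v)
  next
    case False
    have sc: "s \<in> carrier G" using s S by auto
    have w: "rw g \<in> words_on S" using rw(1)[OF g] by (auto simp: reduced_words_on_def)
    have "\<not> (snd (last (rw g)) = s \<and> \<not> fst (last (rw g)))" if "rw g \<noteq> []"
      using False that by (cases "last (rw g)") auto
    then have "rw g @ [(True, s)] \<in> reduced_words_on S"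
      using rw(1)[OF g] s by (auto simp: reduced_words_on_def successively_append_iff)
    moreover have "word_value G (rw g @ [(True, s)]) = g \<otimes> s"
      using rw(2)[OF g] w wS sc by (simp add: word_value_append)
    ultimately have "rw (g \<otimes> s) = rw g @ [(True, s)]" using rw_eq by metis
    then show ?thesis using par_append[OF \<omega> w, of "[(True, s)]"] rw(2)[OF g] by auto
  qed
  show ?thesis
  proof (intro exI[of _ "\<lambda>\<omega>. parity r c (\<beta> \<omega>) (rw (\<gamma> \<omega>))"] ballI)
    fix \<omega> s assume \<omega>: "\<omega> \<in> \<Omega>" and s: "s \<in> S"
    have "s \<in> carrier G" using s S by auto
    then show "(parity r c (\<beta> \<omega>) (rw (\<gamma> \<omega>)) \<noteq> parity r c (\<beta> (r \<omega> s)) (rw (\<gamma> (r \<omega> s)))) = c \<omega> s"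
      using sect[OF \<omega>] sect_r[OF \<omega>, of s] step[of "\<beta> \<omega>" "\<gamma> \<omega>" s] s by auto
  qed
qed

lemma word_value_subgroup:
  assumes "subgroup L G" "w \<in> words_on L"
  shows "word_value (G\<lparr>carrier := L\<rparr>) w = word_value G w"
  using assms(2)
proof (induction w)
  case (Cons x w)
  then show ?case using m_inv_consistent[OF assms(1)] by (cases x) simp
qed simp

lemma word_ball_subgroup:
  assumes "subgroup L G" "S \<subseteq> L" shows "word_ball (G\<lparr>carrier := L\<rparr>) S n = word_ball G S n"
  unfolding word_ball_def using word_value_subgroup[OF assms(1)] words_on_mono[OF assms(2)]
  by (intro image_cong) auto

text \<open>Right multiplication by \<open>L\<close> is free on the ambient group, hence on pairs
  with a coset of \<open>K\<close>. A transversal of the left cosets of \<open>L\<close> supplies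
  the base points.\<close>

lemma free_potential_subgroup:
  assumes L: "subgroup L G" and K: "K \<subseteq> L" "subgroup K G"
    and free: "free_generating_set (G\<lparr>carrier := L\<rparr>) S"
  shows "\<exists>p :: 'a \<times> 'a set \<Rightarrow> bool. \<forall>x\<in>carrier G. \<forall>\<kappa>\<in>(#>) K ` L. \<forall>s\<in>S.
    (p (x, \<kappa>) \<noteq> p (x \<otimes> s, \<kappa> #> s)) = c (x, \<kappa>) s"
proof -
  let ?L = "G\<lparr>carrier := L\<rparr>"
  interpret L: group ?L by (rule subgroup.subgroup_is_group[OF L is_group])
  have LG: "L \<subseteq> carrier G" and KG: "K \<subseteq> carrier G"
    using subgroup.subset[OF L] subgroup.subset[OF K(2)] by simp_all
  \<comment> \<open>\<open>\<tau> x\<close> depends only on the coset \<open>x <# L\<close>; this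
    makes \<open>\<gamma>\<close> equivariant.\<close>
  define \<tau> where "\<tau> x = (SOME y. y \<in> x <# L)" for x
  define \<gamma> where "\<gamma> x = inv (\<tau> x) \<otimes> x" for x
  have \<tau>: "\<tau> x \<in> x <# L" if "x \<in> carrier G" for x
  proof -
    have "x \<in> x <# L" using that L
      by (auto simp: l_coset_def subgroup.one_closed intro!: bexI[of _ \<one>])
    then show ?thesis unfolding \<tau>_def by (rule someI)
  qed
  have \<tau>_mult: "\<tau> (x \<otimes> g) = \<tau> x" if "x \<in> carrier G" "g \<in> L" for x g
  proof -
    have "(x \<otimes> g) <# L = x <# (g <# L)" using that LG by (intro lcos_m_assoc[symmetric]) auto
    also have "g <# L = L" using that L LG by (intro coset_join3) auto
    finally show ?thesis by (simp add: \<tau>_def)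
  qed
  have \<gamma>: "\<tau> x \<in> carrier G \<and> \<gamma> x \<in> L \<and> \<tau> x \<otimes> \<gamma> x = x" if x: "x \<in> carrier G" for x
  proof -
    obtain l where l: "l \<in> L" "\<tau> x = x \<otimes> l" using \<tau>[OF x] by (auto simp: l_coset_def)
    have lc: "l \<in> carrier G" using l LG by auto
    have "\<gamma> x = inv l" using x lc l by (simp add: \<gamma>_def inv_mult_group m_assoc)
    then show ?thesis using l lc x subgroup.m_inv_closed[OF L l(1)] by (simp add: m_assoc)
  qed
  let ?\<Omega> = "carrier G \<times> ((#>) K ` L)"
  let ?r = "\<lambda>(x, \<kappa>) g. (x \<otimes> g, \<kappa> #> g)"
  have "\<exists>p :: 'a \<times> 'a set \<Rightarrow> bool. \<forall>\<omega>\<in>?\<Omega>. \<forall>s\<in>S. (p \<omega> \<noteq> p (?r \<omega> s)) = c \<omega> s"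
  proof (rule L.free_potential[OF free, where \<beta> = "\<lambda>(x, \<kappa>). (\<tau> x, \<kappa> #> inv (\<gamma> x))"
        and \<gamma> = "\<lambda>(x, \<kappa>). \<gamma> x"])
    fix \<omega> g assume \<omega>: "\<omega> \<in> ?\<Omega>" and g': "g \<in> carrier ?L"
    obtain x l where x: "\<omega> = (x, K #> l)" "x \<in> carrier G" "l \<in> L" "l \<in> carrier G"
      using \<omega> LG by auto
    have g: "g \<in> L" "g \<in> carrier G" using g' LG by auto
    have "K #> l #> g = K #> (l \<otimes> g)" using coset_mult_assoc KG x g by simp
    moreover have "l \<otimes> g \<in> L" using subgroup.m_closed[OF L] x g by simp
    ultimately show "?r \<omega> g \<in> ?\<Omega>" using x g by auto
    have gx: "\<gamma> x \<in> carrier G" "\<tau> x \<in> carrier G" using \<gamma>[OF x(2)] LG by auto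
    have "\<gamma> (x \<otimes> g) = \<gamma> x \<otimes> g" using x g \<tau>_mult gx by (simp add: \<gamma>_def m_assoc)
    moreover have "K #> l #> g #> inv (\<gamma> x \<otimes> g) = K #> l #> inv (\<gamma> x)"
      using KG x g gx by (simp add: coset_mult_assoc inv_mult_group m_assoc)
        (simp add: m_assoc[symmetric])
    ultimately show "(\<lambda>(x, \<kappa>). (\<tau> x, \<kappa> #> inv (\<gamma> x))) (?r \<omega> g) = (\<lambda>(x, \<kappa>). (\<tau> x, \<kappa> #> inv (\<gamma> x))) \<omega> \<and>
      (\<lambda>(x, \<kappa>). \<gamma> x) (?r \<omega> g) = (\<lambda>(x, \<kappa>). \<gamma> x) \<omega> \<otimes>\<^bsub>?L\<^esub> g"
      using x g \<tau>_mult by simp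
  next
    fix \<omega> assume \<omega>: "\<omega> \<in> ?\<Omega>"
    obtain x l where x: "\<omega> = (x, K #> l)" "x \<in> carrier G" "l \<in> L" "l \<in> carrier G"
      using \<omega> LG by auto
    show "?r \<omega> \<one>\<^bsub>?L\<^esub> = \<omega>" using x KG by (simp add: coset_mult_assoc)
    note gx = \<gamma>[OF x(2)]
    have gc: "\<gamma> x \<in> carrier G" using gx LG by auto
    have "K #> l #> inv (\<gamma> x) = K #> (l \<otimes> inv (\<gamma> x))" using KG x gc by (simp add: coset_mult_assoc)
    moreover have "l \<otimes> inv (\<gamma> x) \<in> L"
      using gx x subgroup.m_closed[OF L] subgroup.m_inv_closed[OF L] by simp
    moreover have "K #> l #> inv (\<gamma> x) #> \<gamma> x = K #> l"
      using KG x gc by (simp add: coset_mult_assoc m_assoc)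
    ultimately show "(\<lambda>(x, \<kappa>). (\<tau> x, \<kappa> #> inv (\<gamma> x))) \<omega> \<in> ?\<Omega> \<and>
       (\<lambda>(x, \<kappa>). \<gamma> x) \<omega> \<in> carrier ?L \<and>
       ?r ((\<lambda>(x, \<kappa>). (\<tau> x, \<kappa> #> inv (\<gamma> x))) \<omega>) ((\<lambda>(x, \<kappa>). \<gamma> x) \<omega>) = \<omega>"
      using gx x by auto
  next
    fix \<omega> g k assume "\<omega> \<in> ?\<Omega>" "g \<in> carrier ?L" "k \<in> carrier ?L"
    then show "?r \<omega> (g \<otimes>\<^bsub>?L\<^esub> k) = ?r (?r \<omega> g) k"
      using LG KG by (auto simp: m_assoc coset_mult_assoc subset_iff)
  qed
  then obtain p :: "'a \<times> 'a set \<Rightarrow> bool" where p: "\<forall>\<omega>\<in>?\<Omega>. \<forall>s\<in>S. (p \<omega> \<noteq> p (?r \<omega> s)) = c \<omega> s" ..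
  show ?thesis by (rule exI[of _ p]) (use p in auto)
qed

end


section \<open>The entropy inequality between two free subgroups with finite-index
  intersection\<close>

section \<open>Comparing two free subgroups of finite index\<close>

context invariant_polymatroid
begin

lemma invariant_polymatroid_subgroup:
  assumes "subgroup L G" shows "invariant_polymatroid (G\<lparr>carrier := L\<rparr>) W a h"
proof -
  interpret L: group "G\<lparr>carrier := L\<rparr>" by (rule subgroup.subgroup_is_group[OF assms is_group])
  have "L \<subseteq> carrier G" using assms subgroup.subset by auto
  then show ?thesis
    by unfold_locales (auto simp: a_mult h_submodular h_invariant subset_iff intro: h_mono)
qed

lemma basis_F_subgroup:
  assumes "subgroup L G" "S \<subseteq> L"
  shows "invariant_polymatroid.basis_F (G\<lparr>carrier := L\<rparr>) a h S w n = basis_F S w n"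
proof -
  interpret L: invariant_polymatroid "G\<lparr>carrier := L\<rparr>" W a h
    by (rule invariant_polymatroid_subgroup[OF assms(1)])
  show ?thesis
    unfolding L.basis_F_def basis_F_def L.orbit_ball_def orbit_ball_def
      word_ball_subgroup[OF assms] ..
qed

text \<open>The rose of \<open>S\<close> is lifted to the cover belonging to
  \<open>L \<inter> M\<close> and relabelled by Schreier generators of \<open>L \<inter> M\<close>.
  These are elements of \<open>M\<close> as well, so the cover folds onto the Schreier graph of
  \<open>L \<inter> M\<close> in \<open>M\<close>, where \<open>schreier_lower_bound\<close>
  applies.\<close>

theorem two_subgroups_inequality:
  assumes L: "subgroup L G" and M: "subgroup M G"
    and finL: "finite ((#>) (L \<inter> M) ` L)" and finM: "finite ((#>) (L \<inter> M) ` M)"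
    and S: "finite S" "free_generating_set (G\<lparr>carrier := L\<rparr>) S"
    and T: "finite T" "free_generating_set (G\<lparr>carrier := M\<rparr>) T"
    and z: "z \<in> W" "\<And>v. v \<in> W \<Longrightarrow> determined_by ((\<lambda>y. a y z) ` L) v"
    and w: "w \<in> W" "\<And>v. v \<in> W \<Longrightarrow> determined_by ((\<lambda>y. a y w) ` M) v"
    and h0: "h {} = 0" and \<epsilon>: "0 < \<epsilon>"
  shows "\<exists>n. card ((#>) (L \<inter> M) ` M) * basis_F T w n \<le>
    card ((#>) (L \<inter> M) ` L) * basis_F S z m + \<epsilon>"
proof -
  define K where "K = L \<inter> M"
  define CL where "CL = (#>) K ` L"
  define CM where "CM = (#>) K ` M"
  let ?L = "G\<lparr>carrier := L\<rparr>" and ?M = "G\<lparr>carrier := M\<rparr>"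
  have K: "subgroup K G" "K \<subseteq> L" "K \<subseteq> M"
    unfolding K_def using subgroups_Inter_pair[OF L M] by auto
  have LG: "L \<subseteq> carrier G" and MG: "M \<subseteq> carrier G" and KG: "K \<subseteq> carrier G"
    using subgroup.subset[OF L] subgroup.subset[OF M] subgroup.subset[OF K(1)] by simp_all
  have SL: "S \<subseteq> L" and TM: "T \<subseteq> M" using S T by (auto simp: free_generating_set_def)
  interpret L: group ?L by (rule subgroup.subgroup_is_group[OF L is_group])
  interpret MP: invariant_polymatroid ?M W a h by (rule invariant_polymatroid_subgroup[OF M])
  interpret MF: graph_folding ?M W a h T CM "\<lambda>\<kappa> g. \<kappa> #> g"
  proof unfold_locales
    fix c g k assume "c \<in> CM" "g \<in> carrier ?M" "k \<in> carrier ?M"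
    then show "c #> (g \<otimes>\<^bsub>?M\<^esub> k) = c #> g #> k"
      using MG KG by (auto simp: CM_def coset_mult_assoc m_assoc subset_iff)
  next
    fix c g assume "c \<in> CM" "g \<in> carrier ?M"
    then obtain x where x: "c = K #> x" "x \<in> M" "g \<in> M" by (auto simp: CM_def)
    have "c #> g = K #> (x \<otimes> g)" using x MG KG by (simp add: coset_mult_assoc subset_iff)
    then show "c #> g \<in> CM" using x subgroup.m_closed[OF M] by (auto simp: CM_def)
  next
    fix c assume "c \<in> CM"
    then show "c #> \<one>\<^bsub>?M\<^esub> = c" using MG KG by (auto simp: CM_def coset_mult_assoc subset_iff)
  qed (use T TM finM h0 in \<open>auto simp: CM_def K_def\<close>)
  define \<rho> where "\<rho> \<kappa> = (SOME x. x \<in> \<kappa>)" for \<kappa> :: "'a set"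
  have \<rho>: "\<rho> \<kappa> \<in> L \<and> \<rho> \<kappa> \<in> carrier G \<and> K #> \<rho> \<kappa> = \<kappa>" if \<kappa>: "\<kappa> \<in> CL" for \<kappa>
  proof -
    obtain x where x: "x \<in> L" "x \<in> carrier G" "\<kappa> = K #> x" using \<kappa> LG by (auto simp: CL_def)
    have "x \<in> \<kappa>" using rcos_self[OF x(2) K(1)] x(3) by simp
    then have r: "\<rho> \<kappa> \<in> K #> x" unfolding \<rho>_def x(3)[symmetric] by (rule someI)
    then have "\<rho> \<kappa> \<in> L" using subgroup.m_closed[OF L] K(2) x(1) by (auto simp: r_coset_def)
    then show ?thesis using repr_independence[OF r x(2) K(1)] LG x(3) by blast
  qed
  have CL_mult: "\<kappa> #> g \<in> CL" if "\<kappa> \<in> CL" "g \<in> L" for \<kappa> g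
  proof -
    have "\<kappa> #> g = K #> (\<rho> \<kappa> \<otimes> g)"
      using \<rho>[OF that(1)] coset_mult_assoc[OF KG, of "\<rho> \<kappa>" g] that LG by auto
    then show ?thesis using \<rho>[OF that(1)] that subgroup.m_closed[OF L] by (auto simp: CL_def)
  qed
  \<comment> \<open>Schreier generators: \<open>\<rho> \<kappa> \<otimes> g\<close> differs from the
    representative of its own coset by an element of \<open>K\<close>.\<close>
  define lb where "lb \<kappa> g = \<rho> \<kappa> \<otimes> g \<otimes> inv (\<rho> (\<kappa> #> g))" for \<kappa> g
  have lb: "lb \<kappa> g \<in> K" if "\<kappa> \<in> CL" "g \<in> L" for \<kappa> g
  proof -
    have gc: "g \<in> carrier G" using that LG by auto
    have "K #> (\<rho> \<kappa> \<otimes> g) = K #> \<rho> (\<kappa> #> g)"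
      using \<rho>[OF that(1)] \<rho>[OF CL_mult[OF that]] coset_mult_assoc[OF KG, of "\<rho> \<kappa>" g] gc by simp
    then have "\<rho> \<kappa> \<otimes> g \<in> K #> \<rho> (\<kappa> #> g)"
      using rcos_self[of "\<rho> \<kappa> \<otimes> g" K] \<rho>[OF that(1)] gc K(1) by simp
    then show ?thesis unfolding lb_def
      using subgroup.rcos_module_imp[OF K(1) is_group] \<rho>[OF CL_mult[OF that]] by blast
  qed
  \<comment> \<open>The factor \<open>nat\<close> makes the types of vertices and edges infinite, so
    that folding finds fresh names. All labels lie in \<open>K\<close>, hence all vertices can be
    placed over the coset \<open>K\<close>.\<close>
  define \<Delta> :: "('a set \<times> nat, ('a set \<times> 'a) \<times> nat, 'a, 'a set) lgraph" where
    "\<Delta> = \<lparr>verts = CL \<times> {0}, edges = (CL \<times> S) \<times> {0}, src = (\<lambda>((\<kappa>, s), n). (\<kappa>, 0)),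
       tgt = (\<lambda>((\<kappa>, s), n). (\<kappa> #> s, 0)), lab = (\<lambda>((\<kappa>, s), n). lb \<kappa> s), pos = (\<lambda>_. K)\<rparr>"
  have \<Delta>: "verts \<Delta> = CL \<times> {0}" "edges \<Delta> = (CL \<times> S) \<times> {0}" "src \<Delta> = (\<lambda>((\<kappa>, s), n). (\<kappa>, 0))"
     "tgt \<Delta> = (\<lambda>((\<kappa>, s), n). (\<kappa> #> s, 0))" "lab \<Delta> = (\<lambda>((\<kappa>, s), n). lb \<kappa> s)" "pos \<Delta> = (\<lambda>_. K)"
    by (auto simp: \<Delta>_def)
  have K_CM: "K \<in> CM"
    unfolding CM_def using coset_mult_one[OF KG] subgroup.one_closed[OF M] by force
  have wf: "MP.wf_graph \<Delta>"
    using finL S(1) CL_mult lb SL K(3) unfolding MP.wf_graph_def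
    by (auto simp: \<Delta> CL_def K_def subset_iff)
  have pos: "MF.positioned \<Delta>"
    using K_CM lb SL KG coset_join2[OF _ K(1)]
    by (auto simp: MF.positioned_def \<Delta> subset_iff)
  \<comment> \<open>The map \<open>(x, \<kappa>) \<mapsto> (x \<otimes> \<rho> \<kappa>,
    \<kappa>)\<close> carries the cover of \<open>\<Delta>\<close> into the graph of a free action
    of \<open>L\<close>, where potentials exist.\<close>
  have forest: "MP.forest_cover \<Delta>"
    unfolding MP.forest_cover_def
  proof
    fix c :: "'a \<Rightarrow> ('a set \<times> 'a) \<times> nat \<Rightarrow> bool"
    obtain q :: "'a \<times> 'a set \<Rightarrow> bool" where q: "\<And>x \<kappa> s. x \<in> carrier G \<Longrightarrow> \<kappa> \<in> CL \<Longrightarrow> s \<in> S \<Longrightarrow>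
        (q (x, \<kappa>) \<noteq> q (x \<otimes> s, \<kappa> #> s)) = c (x \<otimes> inv (\<rho> \<kappa>)) ((\<kappa>, s), 0)"
      using free_potential_subgroup[OF L K(2,1) S(2),
          of "\<lambda>(x, \<kappa>) s. c (x \<otimes> inv (\<rho> \<kappa>)) ((\<kappa>, s), 0)"] by (auto simp: CL_def)
    have "(q (x \<otimes> \<rho> \<kappa>, \<kappa>) \<noteq> q (x \<otimes> lb \<kappa> s \<otimes> \<rho> (\<kappa> #> s), \<kappa> #> s)) = c x ((\<kappa>, s), 0)"
      if "x \<in> M" "\<kappa> \<in> CL" "s \<in> S" for x \<kappa> s
    proof -
      have sL: "s \<in> L" using that SL by auto
      have carr: "x \<in> carrier G" "s \<in> carrier G" "\<rho> \<kappa> \<in> carrier G" "\<rho> (\<kappa> #> s) \<in> carrier G"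
        using that MG sL LG \<rho>[OF that(2)] \<rho>[OF CL_mult[OF that(2) sL]] by auto
      have "x \<otimes> lb \<kappa> s \<otimes> \<rho> (\<kappa> #> s) = x \<otimes> \<rho> \<kappa> \<otimes> s" "x \<otimes> \<rho> \<kappa> \<otimes> inv (\<rho> \<kappa>) = x"
        using carr by (simp_all add: lb_def m_assoc)
      then show ?thesis using q[of "x \<otimes> \<rho> \<kappa>" \<kappa> s] carr that by simp
    qed
    then show "\<exists>p :: 'a \<Rightarrow> 'a set \<times> nat \<Rightarrow> bool. \<forall>x\<in>carrier ?M. \<forall>d\<in>edges \<Delta>.
        (p x (src \<Delta> d) \<noteq> p (x \<otimes>\<^bsub>?M\<^esub> lab \<Delta> d) (tgt \<Delta> d)) = c x d"
      by (intro exI[of _ "\<lambda>x (\<kappa>, n). q (x \<otimes> \<rho> \<kappa>, \<kappa>)"]) (auto simp: \<Delta>)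
  qed
  \<comment> \<open>Words in \<open>S\<close> lift to walks from \<open>\<kappa>\<close>, and the
    representatives in the labels cancel telescopically.\<close>
  have walk: "\<exists>q. walk \<Delta> (\<kappa>, 0) q (\<kappa> #> word_value G v, 0) \<and>
      word_value ?M (letters \<Delta> q) = lb \<kappa> (word_value G v)"
    if "v \<in> words_on S" "\<kappa> \<in> CL" for v \<kappa>
    using that
  proof (induction v arbitrary: \<kappa>)
    case Nil
    have "\<kappa> #> \<one> = \<kappa>" using \<rho>[OF Nil(2)] coset_mult_one
      by (metis KG r_coset_subset_G)
    then show ?case using \<rho>[OF Nil(2)] by (intro exI[of _ "[]"]) (simp add: lb_def)
  next
    case (Cons x v)
    obtain b s where x: "x = (b, s)" by (cases x)
    define g where "g = (if b then s else inv s)"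
    have s: "s \<in> S" "s \<in> L" "s \<in> carrier G" "v \<in> words_on S"
      using Cons.prems x SL LG by auto
    have g: "g \<in> L" "g \<in> carrier G" using s subgroup.m_inv_closed[OF L] by (auto simp: g_def)
    have "v \<in> words_on L" using words_on_mono[OF SL s(4)] .
    then have "word_value ?L v \<in> carrier ?L" using L.word_value_closed[of v] by simp
    then have v: "word_value G v \<in> L" "word_value G v \<in> carrier G"
      using word_value_subgroup[OF L \<open>v \<in> words_on L\<close>] LG by auto
    have k1: "\<kappa> #> g \<in> CL" using CL_mult[OF Cons.prems(2) g(1)] .
    obtain q where q: "walk \<Delta> (\<kappa> #> g, 0) q (\<kappa> #> g #> word_value G v, 0)"
      "word_value ?M (letters \<Delta> q) = lb (\<kappa> #> g) (word_value G v)"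
      using Cons.IH[OF s(4) k1] by blast
    have \<kappa>G: "\<kappa> \<subseteq> carrier G" using \<rho>[OF Cons.prems(2)] r_coset_subset_G[OF KG] by metis
    have assoc: "\<kappa> #> g #> word_value G v = \<kappa> #> (g \<otimes> word_value G v)"
      using coset_mult_assoc[OF \<kappa>G g(2) v(2)] .
    have \<rho>s: "\<rho> \<kappa> \<in> carrier G" "\<rho> (\<kappa> #> g) \<in> carrier G" "\<rho> (\<kappa> #> g #> word_value G v) \<in> carrier G"
      using \<rho> Cons.prems k1 CL_mult[OF k1 v(1)] by auto
    have lbs: "lb \<kappa> g \<otimes> lb (\<kappa> #> g) (word_value G v) = lb \<kappa> (g \<otimes> word_value G v)"
      using \<rho>s g v assoc by (simp add: lb_def m_assoc) (simp add: m_assoc[symmetric])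
    define d where "d = ((if b then \<kappa> else \<kappa> #> g, s), 0::nat)"
    have return: "\<kappa> #> inv s #> s = \<kappa>" 
      using coset_mult_assoc[OF \<kappa>G, of "inv s" s] s(3) coset_mult_one[OF \<kappa>G] by simp
    have "walk \<Delta> (\<kappa>, 0) ((b, d) # q) (\<kappa> #> (g \<otimes> word_value G v), 0)"
      using q(1) Cons.prems(2) k1 s return assoc by (auto simp: \<Delta> d_def g_def)
    moreover have "(if b then lab \<Delta> d else inv\<^bsub>?M\<^esub> (lab \<Delta> d)) = lb \<kappa> g"
    proof (cases b)
      case False
      have m: "lab \<Delta> d \<in> M" using lb[OF k1 s(2)] K(3) False by (auto simp: \<Delta> d_def)
      have "inv (lab \<Delta> d) = lb \<kappa> g"
        using False \<rho>s s return by (simp add: \<Delta> d_def lb_def g_def inv_mult_group m_assoc)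
      then show ?thesis using False m_inv_consistent[OF M m] by simp
    qed (simp add: \<Delta> d_def g_def)
    ultimately show ?case using q(2) lbs
      by (intro exI[of _ "(b, d) # q"]) (auto simp: x g_def)
  qed
  have conn: "MF.conn_graph \<Delta>"
    unfolding MF.conn_graph_def
  proof (intro ballI impI)
    fix i j y assume ij: "i \<in> verts \<Delta>" "j \<in> verts \<Delta>" and "y \<in> carrier ?M" and eq: "pos \<Delta> i #> y = pos \<Delta> j"
    obtain \<kappa> \<kappa>' where \<kappa>: "i = (\<kappa>, 0)" "j = (\<kappa>', 0)" "\<kappa> \<in> CL" "\<kappa>' \<in> CL" using ij by (auto simp: \<Delta>)
    have yK: "y \<in> K" using eq \<open>y \<in> carrier ?M\<close> MG coset_join1[of K y] K(1) by (auto simp: \<Delta>)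
    \<comment> \<open>Chosen to give \<open>\<kappa> #> g = \<kappa>'\<close> and
      \<open>lb \<kappa> g = y\<close>. It lies in \<open>L\<close>, so \<open>S\<close> spells it
      and the lifted walk has value \<open>y\<close>.\<close>
    define g where "g = inv (\<rho> \<kappa>) \<otimes> y \<otimes> \<rho> \<kappa>'"
    note r = \<rho>[OF \<kappa>(3)] \<rho>[OF \<kappa>(4)]
    have yc: "y \<in> carrier G" "y \<in> L" using yK KG K(2) by auto
    have g: "g \<in> L" using r yc subgroup.m_closed[OF L] subgroup.m_inv_closed[OF L] by (simp add: g_def)
    have gc: "g \<in> carrier G" using g LG by auto
    have "g \<in> word_value ?L ` reduced_words_on S"
      using S(2) g by (simp add: free_generating_set_def bij_betw_def)
    then obtain v where v: "v \<in> words_on S" "word_value G v = g"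
      using word_value_subgroup[OF L words_on_mono[OF SL]] by (auto simp: reduced_words_on_def)
    have rg: "\<rho> \<kappa> \<otimes> g = y \<otimes> \<rho> \<kappa>'"
      using r yc by (simp add: g_def m_assoc) (simp add: m_assoc[symmetric])
    have "\<kappa> #> g = K #> (\<rho> \<kappa> \<otimes> g)" using r gc coset_mult_assoc[OF KG, of "\<rho> \<kappa>" g] by simp
    also have "\<dots> = K #> y #> \<rho> \<kappa>'" using rg r yc coset_mult_assoc[OF KG] by simp
    also have "K #> y = K" using eq by (simp add: \<Delta>)
    finally have kg: "\<kappa> #> g = \<kappa>'" using r by simp
    have "lb \<kappa> g = y" using kg rg r yc by (simp add: lb_def m_assoc)
    then show "\<exists>q. walk \<Delta> i q j \<and> word_value ?M (letters \<Delta> q) = y"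
      using walk[OF v(1) \<kappa>(3)] v(2) kg \<kappa> by simp
  qed
  have good: "MF.good \<Delta>" using wf pos forest conn by (simp add: MF.good_def)
  define A where "A = orbit_ball S z m"
  have A: "fin A" unfolding A_def using SL LG S(1) z(1) by (intro fin_orbit_ball) auto
  \<comment> \<open>Moving the ball by representatives undoes the relabelling: both terms of an edge
    acquire the common factor \<open>\<rho> \<kappa>\<close>, which invariance removes.\<close>
  define P where "P = (\<lambda>(\<kappa>, n :: nat). a (\<rho> \<kappa>) ` A)"
  have lab: "MP.labelling \<Delta> P"
    using A \<rho> unfolding MP.labelling_def by (auto simp: \<Delta> P_def intro!: a_closed)
  have FP: "MP.graph_F \<Delta> P = card CL * basis_F S z m"
  proof -
    have "(\<Sum>i\<in>verts \<Delta>. h (P i)) = (\<Sum>i\<in>verts \<Delta>. h A)"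
      using A \<rho> by (intro sum.cong) (auto simp: \<Delta> P_def h_invariant)
    moreover have "(\<Sum>d\<in>edges \<Delta>. mi (P (src \<Delta> d)) (a (lab \<Delta> d) ` P (tgt \<Delta> d))) =
        (\<Sum>d\<in>edges \<Delta>. mi A (a (snd (fst d)) ` A))"
    proof (intro sum.cong refl)
      fix d assume "d \<in> edges \<Delta>"
      then obtain \<kappa> s where d: "d = ((\<kappa>, s), 0)" "\<kappa> \<in> CL" "s \<in> S" by (auto simp: \<Delta>)
      have s: "s \<in> L" "s \<in> carrier G" using d SL LG by auto
      note r = \<rho>[OF d(2)] \<rho>[OF CL_mult[OF d(2) s(1)]]
      have lbc: "lb \<kappa> s \<in> carrier G" using lb[OF d(2) s(1)] KG by auto
      have "a (lb \<kappa> s) ` a (\<rho> (\<kappa> #> s)) ` A = a (lb \<kappa> s \<otimes> \<rho> (\<kappa> #> s)) ` A"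
        using r lbc A by (intro image_mult) auto
      also have "lb \<kappa> s \<otimes> \<rho> (\<kappa> #> s) = \<rho> \<kappa> \<otimes> s" using r s by (simp add: lb_def m_assoc)
      also have "a (\<rho> \<kappa> \<otimes> s) ` A = a (\<rho> \<kappa>) ` a s ` A" using r s A by (intro image_mult[symmetric]) auto
      finally have "a (lb \<kappa> s) ` a (\<rho> (\<kappa> #> s)) ` A = a (\<rho> \<kappa>) ` a s ` A" .
      then show "mi (P (src \<Delta> d)) (a (lab \<Delta> d) ` P (tgt \<Delta> d)) = mi A (a (snd (fst d)) ` A)"
        using mi_invariant[of "\<rho> \<kappa>" A "a s ` A"] r A s fin_image[of s A] by (simp add: \<Delta> P_def d)
    qed
    moreover have "(\<Sum>d\<in>edges \<Delta>. mi A (a (snd (fst d)) ` A)) = card CL * (\<Sum>s\<in>S. mi A (a s ` A))"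
    proof -
      have "(\<Sum>d\<in>edges \<Delta>. mi A (a (snd (fst d)) ` A)) = (\<Sum>d\<in>CL \<times> S. mi A (a (snd d) ` A))"
        by (intro sum.reindex_bij_witness[of _ "\<lambda>d. (d, 0)" fst]) (auto simp: \<Delta>)
      also have "\<dots> = (\<Sum>(\<kappa>, s)\<in>CL \<times> S. mi A (a s ` A))" by (simp add: case_prod_beta)
      also have "\<dots> = (\<Sum>\<kappa>\<in>CL. \<Sum>s\<in>S. mi A (a s ` A))" by (rule sum.cartesian_product[symmetric])
      finally show ?thesis by simp
    qed
    ultimately show ?thesis
      by (simp add: MP.graph_F_def basis_F_def \<Delta>(1) A_def right_diff_distrib card_cartesian_product)
  qed
  have "\<exists>y\<in>carrier ?M. c #> y = c'" if "c \<in> CM" "c' \<in> CM" for c c'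
  proof -
    obtain x x' where x: "x \<in> M" "x' \<in> M" "c = K #> x" "c' = K #> x'" using \<open>c \<in> CM\<close> \<open>c' \<in> CM\<close> by (auto simp: CM_def)
    have xc: "x \<in> carrier G" "x' \<in> carrier G" using x MG by auto
    have "c #> (inv x \<otimes> x') = c'"
      using x xc KG by (simp add: coset_mult_assoc) (simp add: m_assoc[symmetric])
    then show ?thesis using x subgroup.m_closed[OF M] subgroup.m_inv_closed[OF M]
      by (intro bexI[of _ "inv x \<otimes> x'"]) auto
  qed
  moreover have "infinite (UNIV :: ('a set \<times> nat) set)" "infinite (UNIV :: (('a set \<times> 'a) \<times> nat) set)"
    by (simp_all add: finite_prod)
  moreover have "verts \<Delta> \<noteq> {}" using subgroup.one_closed[OF L] by (auto simp: \<Delta> CL_def)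
  ultimately obtain Q where Q: "MP.labelling MF.schreier Q"
    "MP.graph_F MF.schreier Q \<le> MP.graph_F \<Delta> P"
    and PQ: "\<And>i. i \<in> verts \<Delta> \<Longrightarrow> P i \<subseteq> Q (pos \<Delta> i)"
    using MF.fold_to_schreier[of \<Delta> P] good lab by blast
  have zA: "z \<in> A"
    using z(1) one_in_word_ball[of G S m] by (force simp: A_def orbit_ball_def)
  \<comment> \<open>With \<open>c = K #> x\<close>, approximate \<open>a x w\<close> from the
    \<open>L\<close>-orbit of \<open>z\<close> and move back by \<open>inv x\<close>. Writing
    \<open>l = k \<otimes> \<rho> \<kappa>\<close> with \<open>k \<in> K\<close>, the point
    \<open>a (\<rho> \<kappa>) z\<close> belongs to \<open>Q K\<close>, and
    \<open>inv x \<otimes> k\<close> leads from the coset \<open>c\<close> to \<open>K\<close>. The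
    translate is therefore visible from \<open>c\<close>.\<close>
  have det2: "determined_by (\<Union>y\<in>carrier ?M. a y ` Q (c #> y)) w" if c: "c \<in> CM" for c
    unfolding determined_by_def
  proof (intro allI impI)
    fix \<epsilon> :: real assume "0 < \<epsilon>"
    obtain x where x: "x \<in> M" "c = K #> x" "x \<in> carrier G" using c MG by (auto simp: CM_def)
    obtain B where B: "finite B" "B \<subseteq> (\<lambda>y. a y z) ` L" "h (insert (a x w) B) - h B < \<epsilon>"
      using z(2)[of "a x w"] w(1) x \<open>0 < \<epsilon>\<close> unfolding determined_by_def by auto
    have "(\<lambda>y. a y z) ` L \<subseteq> W" using z(1) LG by (auto intro!: a_closed)
    then have BW: "B \<subseteq> W" using B(2) by blast
    have "a (inv x) ` insert (a x w) B = insert w (a (inv x) ` B)"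
      using x w(1) by (simp flip: a_mult)
    then have "h (insert w (a (inv x) ` B)) = h (insert (a x w) B)"
      using h_invariant[of "inv x" "insert (a x w) B"] B(1) BW x w(1) by simp
    moreover have "h (a (inv x) ` B) = h B" using B(1) BW x by (intro h_invariant) auto
    moreover have "a (inv x) ` B \<subseteq> (\<Union>y\<in>carrier ?M. a y ` Q (c #> y))"
    proof
      fix b assume "b \<in> a (inv x) ` B"
      then obtain l where l: "l \<in> L" "b = a (inv x) (a l z)" using B(2) by auto
      define \<kappa> where "\<kappa> = K #> l"
      have \<kappa>: "\<kappa> \<in> CL" using l by (simp add: \<kappa>_def CL_def)
      note r = \<rho>[OF \<kappa>]
      have lc: "l \<in> carrier G" using l LG by auto
      have "l \<in> \<kappa>" using rcos_self[OF lc K(1)] by (simp add: \<kappa>_def)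
      then have "l \<in> K #> \<rho> \<kappa>" using r by simp
      then obtain k where k: "k \<in> K" "l = k \<otimes> \<rho> \<kappa>" by (auto simp: r_coset_def)
      have kc: "k \<in> carrier G" "k \<in> M" using k KG K(3) by auto
      have "b = a (inv x \<otimes> k) (a (\<rho> \<kappa>) z)"
        using l k kc x r z(1) by (simp add: a_mult)
      moreover have "a (\<rho> \<kappa>) z \<in> Q K" using PQ[of "(\<kappa>, 0)"] zA \<kappa> by (auto simp: \<Delta> P_def)
      moreover have "c #> (inv x \<otimes> k) = K"
      proof -
        have "c #> (inv x \<otimes> k) = K #> k"
          using x kc KG by (simp add: coset_mult_assoc) (simp add: m_assoc[symmetric])
        then show ?thesis using coset_join2[OF kc(1) K(1) k(1)] by simp
      qed
      moreover have "inv x \<otimes> k \<in> M"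
        using x kc subgroup.m_closed[OF M] subgroup.m_inv_closed[OF M] by simp
      ultimately show "b \<in> (\<Union>y\<in>carrier ?M. a y ` Q (c #> y))" by auto
    qed
    ultimately show "\<exists>B. finite B \<and> B \<subseteq> (\<Union>y\<in>carrier ?M. a y ` Q (c #> y)) \<and> h (insert w B) - h B < \<epsilon>"
      using B by (intro exI[of _ "a (inv x) ` B"]) auto
  qed
  obtain n where n: "card CM * MP.basis_F T w n \<le> MP.graph_F MF.schreier Q + \<epsilon>"
    using MF.schreier_lower_bound[OF Q(1) w(1) _ det2 \<epsilon>] w(2)
    by (auto simp: determined_by_def)
  have "card CM * basis_F T w n \<le> card CL * basis_F S z m + \<epsilon>"
    using n Q(2) FP basis_F_subgroup[OF M TM, of w n] by simp
  then show ?thesis unfolding CL_def CM_def K_def by (rule exI[of _ n])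
qed

end

section \<open>Shannon entropy as an integral, and its submodularity\<close>

section \<open>Entropy of discrete random variables\<close>

text \<open>Connects the unordered sum that defines entropy with counting-measure integrals, for
  which sums and integrals can be exchanged.\<close>

lemma infsum_ennreal_eq_nn_integral:
  fixes g :: "'i \<Rightarrow> ennreal"
  assumes "countable I"
  shows "infsum g I = (\<integral>\<^sup>+ i. g i \<partial>count_space I)"
proof (rule antisym)
  have "infsum g I = (SUP F\<in>{F. finite F \<and> F \<subseteq> I}. sum g F)"
    by (rule nonneg_infsum_complete) simp
  also have "\<dots> \<le> (\<integral>\<^sup>+ i. g i \<partial>count_space I)"
  proof (rule SUP_least)
    fix F assume "F \<in> {F. finite F \<and> F \<subseteq> I}"
    then have "sum g F = (\<integral>\<^sup>+ i. g i * indicator F i \<partial>count_space I)"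
      by (subst nn_integral_count_space'[of F]) (auto intro!: sum.cong)
    also have "\<dots> \<le> (\<integral>\<^sup>+ i. g i \<partial>count_space I)"
      by (intro nn_integral_mono) (auto simp: indicator_def)
    finally show "sum g F \<le> (\<integral>\<^sup>+ i. g i \<partial>count_space I)" .
  qed
  finally show "infsum g I \<le> (\<integral>\<^sup>+ i. g i \<partial>count_space I)" .
next
  have le: "sum g F \<le> infsum g I" if "finite F" "F \<subseteq> I" for F
    using that by (subst nonneg_infsum_complete) (auto intro!: SUP_upper)
  show "(\<integral>\<^sup>+ i. g i \<partial>count_space I) \<le> infsum g I"
  proof (cases "finite I")
    case True
    then show ?thesis using le[of I] by (simp add: nn_integral_count_space_finite)
  next
    case False
    have bij: "bij_betw (from_nat_into I) UNIV I"
      by (rule bij_betw_from_nat_into[OF assms False])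
    have "(\<integral>\<^sup>+ i. g i \<partial>count_space I) = suminf (\<lambda>n. g (from_nat_into I n))"
      by (simp add: nn_integral_bij_count_space[OF bij, symmetric] nn_integral_count_space_nat)
    also have "\<dots> \<le> infsum g I"
    proof (rule suminf_le_const)
      fix n
      have "(\<Sum>i<n. g (from_nat_into I i)) = sum g (from_nat_into I ` {..<n})"
        using bij by (subst sum.reindex) (auto simp: bij_betw_def inj_on_def)
      also have "\<dots> \<le> infsum g I"
        using False assms by (intro le) (auto intro: from_nat_into)
      finally show "(\<Sum>i<n. g (from_nat_into I i)) \<le> infsum g I" .
    qed simp
    finally show ?thesis .
  qed
qed

text \<open>The value type carries no sigma-algebra, so measurability is asked of single fibres;
  countability of the range makes this enough.\<close>

definition discrete_rv :: "'x measure \<Rightarrow> ('x \<Rightarrow> 'c) \<Rightarrow> bool" where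
  "discrete_rv M f \<longleftrightarrow> countable (f ` space M) \<and> (\<forall>v. {x \<in> space M. f x = v} \<in> sets M)"

definition fibres :: "'x measure \<Rightarrow> ('x \<Rightarrow> 'c) \<Rightarrow> 'x set set" where
  "fibres M f = (\<lambda>v. {x \<in> space M. f x = v}) ` f ` space M"

lemma discrete_rv_sets: "discrete_rv M f \<Longrightarrow> {x \<in> space M. f x = v} \<in> sets M"
  by (auto simp: discrete_rv_def)

lemma discrete_rv_measurable:
  assumes "discrete_rv M f" shows "f \<in> measurable M (count_space UNIV)"
proof (rule measurableI)
  fix A
  have "f -` A \<inter> space M = (\<Union>v\<in>A \<inter> f ` space M. {x \<in> space M. f x = v})" by auto
  also have "\<dots> \<in> sets M"
    using assms by (intro sets.countable_UN' countable_Int2) (auto simp: discrete_rv_def)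
  finally show "f -` A \<inter> space M \<in> sets M" .
qed simp

lemma discrete_rv_Pair:
  assumes "discrete_rv M f" "discrete_rv M g" shows "discrete_rv M (\<lambda>x. (f x, g x))"
  unfolding discrete_rv_def
proof (intro conjI allI)
  have "(\<lambda>x. (f x, g x)) ` space M \<subseteq> f ` space M \<times> g ` space M" by auto
  moreover have "countable (f ` space M \<times> g ` space M)"
    using assms by (auto simp: discrete_rv_def)
  ultimately show "countable ((\<lambda>x. (f x, g x)) ` space M)" by (rule countable_subset)
  fix v
  have "{x \<in> space M. (f x, g x) = v} = {x \<in> space M. f x = fst v} \<inter> {x \<in> space M. g x = snd v}"
    by (auto simp: prod_eq_iff)
  then show "{x \<in> space M. (f x, g x) = v} \<in> sets M"
    using assms by (auto simp: discrete_rv_def)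
qed

lemma discrete_rv_comp:
  assumes "discrete_rv M f" shows "discrete_rv M (\<lambda>x. u (f x))"
  unfolding discrete_rv_def
proof (intro conjI allI)
  have "(\<lambda>x. u (f x)) ` space M = u ` f ` space M" by auto
  then show "countable ((\<lambda>x. u (f x)) ` space M)" using assms by (simp add: discrete_rv_def)
  fix v
  have "{x \<in> space M. u (f x) = v} = f -` (u -` {v}) \<inter> space M" by auto
  then show "{x \<in> space M. u (f x) = v} \<in> sets M"
    using measurable_sets[OF discrete_rv_measurable[OF assms], of "u -` {v}"] by simp
qed

context prob_space
begin

text \<open>The mass of the fibre through \<open>x\<close>. Entropy becomes the mean of its negative
  logarithm, and finiteness of entropy becomes integrability.\<close>

definition pmass :: "('a \<Rightarrow> 'c) \<Rightarrow> 'a \<Rightarrow> real" where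
  "pmass f x = prob {y \<in> space M. f y = f x}"

definition info :: "('a \<Rightarrow> 'c) \<Rightarrow> 'a \<Rightarrow> real" where
  "info f x = - ln (pmass f x)"

definition ent :: "('a \<Rightarrow> 'c) \<Rightarrow> real" where
  "ent f = (\<integral>x. info f x \<partial>M)"

definition finite_ent :: "('a \<Rightarrow> 'c) \<Rightarrow> bool" where
  "finite_ent f \<longleftrightarrow> discrete_rv M f \<and> integrable M (info f)"

lemma pmass_nonneg: "0 \<le> pmass f x" and pmass_le_1: "pmass f x \<le> 1"
  by (auto simp: pmass_def)

lemma info_nonneg: "0 \<le> info f x"
  using pmass_nonneg[of f x] pmass_le_1[of f x]
  \<comment> \<open>At mass zero the convention \<open>ln 0 = 0\<close> gives information
    zero.\<close>
  by (cases "pmass f x = 0") (auto simp: info_def)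

lemma pmass_measurable:
  assumes "discrete_rv M f" shows "pmass f \<in> borel_measurable M"
proof -
  have "(\<lambda>x. (\<lambda>v. prob {y \<in> space M. f y = v}) (f x)) \<in> borel_measurable M"
    by (rule measurable_compose[OF discrete_rv_measurable[OF assms]]) simp
  then show ?thesis by (simp add: pmass_def[abs_def])
qed

lemma info_measurable:
  assumes "discrete_rv M f" shows "info f \<in> borel_measurable M"
  unfolding info_def[abs_def]
  by (intro borel_measurable_uminus borel_measurable_ln pmass_measurable assms)

text \<open>The points of mass zero fill countably many null fibres.\<close>

lemma AE_pmass_pos:
  assumes "discrete_rv M f" shows "AE x in M. 0 < pmass f x"
proof (rule AE_I')
  let ?R = "{v \<in> f ` space M. prob {y \<in> space M. f y = v} = 0}"
  have "countable ?R" using assms by (auto simp: discrete_rv_def intro: countable_subset)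
  then show "(\<Union>v\<in>?R. {y \<in> space M. f y = v}) \<in> null_sets M"
    using assms by (intro null_sets_UN') (auto simp: null_sets_def discrete_rv_def emeasure_eq_measure)
  show "{x \<in> space M. \<not> 0 < pmass f x} \<subseteq> (\<Union>v\<in>?R. {y \<in> space M. f y = v})"
    using pmass_nonneg[of f] by (force simp: pmass_def not_less intro: antisym)
qed

lemma nn_integral_discrete_on:
  fixes \<psi> :: "'c \<Rightarrow> ennreal"
  assumes "discrete_rv M f" "A \<in> sets M"
  shows "(\<integral>\<^sup>+ x. \<psi> (f x) * indicator A x \<partial>M) =
    (\<integral>\<^sup>+ v. \<psi> v * emeasure M {x \<in> A. f x = v} \<partial>count_space (f ` space M))"
proof -
  have A: "{x \<in> A. f x = v} \<in> sets M" for v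
  proof -
    have "{x \<in> A. f x = v} = A \<inter> {x \<in> space M. f x = v}"
      using sets.sets_into_space[OF assms(2)] by auto
    then show ?thesis using assms by (auto simp: discrete_rv_def)
  qed
  have "(\<integral>\<^sup>+ x. \<psi> (f x) * indicator A x \<partial>M) =
     (\<integral>\<^sup>+ x. \<integral>\<^sup>+ v. \<psi> v * indicator {x \<in> A. f x = v} x \<partial>count_space (f ` space M) \<partial>M)"
  proof (intro nn_integral_cong)
    fix x assume "x \<in> space M"
    then show "\<psi> (f x) * indicator A x =
        (\<integral>\<^sup>+ v. \<psi> v * indicator {x \<in> A. f x = v} x \<partial>count_space (f ` space M))"
      by (subst nn_integral_count_space'[of "{f x}"]) (auto simp: indicator_def)
  qed
  also have "\<dots> = (\<integral>\<^sup>+ v. \<integral>\<^sup>+ x. \<psi> v * indicator {x \<in> A. f x = v} x \<partial>M \<partial>count_space (f ` space M))"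
    using assms A by (intro nn_integral_count_space_nn_integral) (auto simp: discrete_rv_def)
  also have "\<dots> = (\<integral>\<^sup>+ v. \<psi> v * emeasure M {x \<in> A. f x = v} \<partial>count_space (f ` space M))"
    using A by (intro nn_integral_cong nn_integral_cmult_indicator)
  finally show ?thesis .
qed

lemma nn_integral_discrete:
  fixes \<psi> :: "'c \<Rightarrow> ennreal"
  assumes "discrete_rv M f"
  shows "(\<integral>\<^sup>+ x. \<psi> (f x) \<partial>M) =
    (\<integral>\<^sup>+ v. \<psi> v * emeasure M {x \<in> space M. f x = v} \<partial>count_space (f ` space M))"
proof -
  have "(\<integral>\<^sup>+ x. \<psi> (f x) \<partial>M) = (\<integral>\<^sup>+ x. \<psi> (f x) * indicator (space M) x \<partial>M)"
    by (intro nn_integral_cong) auto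
  then show ?thesis using nn_integral_discrete_on[OF assms sets.top, of \<psi>] by simp
qed

lemma emeasure_eq_sum_fibres:
  assumes "discrete_rv M f" "A \<in> sets M"
  shows "(\<integral>\<^sup>+ v. emeasure M {x \<in> A. f x = v} \<partial>count_space (f ` space M)) = emeasure M A"
  using nn_integral_discrete_on[OF assms, of "\<lambda>_. 1"] assms(2) by simp

text \<open>The ratio compares the law that makes \<open>f\<close> and \<open>g\<close> independent
  given \<open>k\<close> with the joint law. For fixed values of \<open>g\<close> and
  \<open>k\<close>, summation over the values of \<open>f\<close> yields at most the mass of that
  pair, and these masses add up to one.\<close>

lemma nn_integral_conditional_independence_ratio:
  fixes f :: "'a \<Rightarrow> 'c" and g :: "'a \<Rightarrow> 'd" and k :: "'a \<Rightarrow> 'e"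
  assumes f: "discrete_rv M f" and g: "discrete_rv M g" and k: "discrete_rv M k"
  shows "(\<integral>\<^sup>+ x. ennreal (pmass (\<lambda>x. (f x, k x)) x * pmass (\<lambda>x. (g x, k x)) x /
      (pmass k x * pmass (\<lambda>x. (f x, g x, k x)) x)) \<partial>M) \<le> 1"
proof -
  let ?pa = "\<lambda>u w. prob {x \<in> space M. f x = u \<and> k x = w}"
  let ?pb = "\<lambda>v w. prob {x \<in> space M. g x = v \<and> k x = w}"
  let ?pc = "\<lambda>w. prob {x \<in> space M. k x = w}"
  let ?pd = "\<lambda>u v w. prob {x \<in> space M. f x = u \<and> g x = v \<and> k x = w}"
  let ?Y = "\<lambda>x. (g x, k x)"
  let ?\<psi> = "\<lambda>u (v, w). ennreal (?pa u w * ?pb v w / (?pc w * ?pd u v w))"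
  have Y: "discrete_rv M ?Y" by (rule discrete_rv_Pair[OF g k])
  have Ys: "{x \<in> space M. ?Y x = y} \<in> sets M" for y by (rule discrete_rv_sets[OF Y])
  have "(\<integral>\<^sup>+ x. ennreal (pmass (\<lambda>x. (f x, k x)) x * pmass (\<lambda>x. (g x, k x)) x /
      (pmass k x * pmass (\<lambda>x. (f x, g x, k x)) x)) \<partial>M) = (\<integral>\<^sup>+ x. ?\<psi> (f x) (?Y x) \<partial>M)"
    by (simp add: pmass_def)
  also have "\<dots> = (\<integral>\<^sup>+ x. \<integral>\<^sup>+ y. ?\<psi> (f x) y * indicator {x \<in> space M. ?Y x = y} x
      \<partial>count_space (?Y ` space M) \<partial>M)"
  proof (intro nn_integral_cong)
    fix x assume "x \<in> space M"
    then show "?\<psi> (f x) (?Y x) = (\<integral>\<^sup>+ y. ?\<psi> (f x) y * indicator {x \<in> space M. ?Y x = y} x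
      \<partial>count_space (?Y ` space M))"
      by (subst nn_integral_count_space'[of "{?Y x}"]) (auto simp: indicator_def)
  qed
  also have "\<dots> = (\<integral>\<^sup>+ y. \<integral>\<^sup>+ x. ?\<psi> (f x) y * indicator {x \<in> space M. ?Y x = y} x \<partial>M
      \<partial>count_space (?Y ` space M))"
  proof (intro nn_integral_count_space_nn_integral)
    show "countable (?Y ` space M)" using Y by (simp add: discrete_rv_def)
    fix y :: "'d \<times> 'e"
    have "(\<lambda>x. (\<lambda>u. ?\<psi> u y) (f x)) \<in> borel_measurable M"
      by (rule measurable_compose[OF discrete_rv_measurable[OF f]]) simp
    then show "(\<lambda>x. ?\<psi> (f x) y * indicator {x \<in> space M. ?Y x = y} x) \<in> borel_measurable M"
      using Ys[of y] by measurable
  qed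
  also have "\<dots> \<le> (\<integral>\<^sup>+ y. emeasure M {x \<in> space M. ?Y x = y} \<partial>count_space (?Y ` space M))"
  proof (intro nn_integral_mono)
    fix y :: "'d \<times> 'e"
    obtain v w where y: "y = (v, w)" by (cases y)
    have "(\<integral>\<^sup>+ x. ?\<psi> (f x) y * indicator {x \<in> space M. ?Y x = y} x \<partial>M) =
       (\<integral>\<^sup>+ u. ?\<psi> u y * emeasure M {x \<in> {x \<in> space M. ?Y x = y}. f x = u} \<partial>count_space (f ` space M))"
      by (rule nn_integral_discrete_on[OF f Ys])
    also have "\<dots> \<le> (\<integral>\<^sup>+ u. ennreal (?pb v w / ?pc w) *
        emeasure M {x \<in> {x \<in> space M. k x = w}. f x = u} \<partial>count_space (f ` space M))"
    proof (intro nn_integral_mono)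
      fix u
      have "{x \<in> {x \<in> space M. ?Y x = y}. f x = u} = {x \<in> space M. f x = u \<and> g x = v \<and> k x = w}"
        "{x \<in> {x \<in> space M. k x = w}. f x = u} = {x \<in> space M. f x = u \<and> k x = w}"
        by (auto simp: y)
      \<comment> \<open>Equality fails where the joint mass is zero: there the left side vanishes by
        the convention for division by zero.\<close>
      moreover have "?pa u w * ?pb v w / (?pc w * ?pd u v w) * ?pd u v w \<le> ?pb v w / ?pc w * ?pa u w"
        by (cases "?pd u v w = 0") (auto simp: field_simps)
      ultimately show "?\<psi> u y * emeasure M {x \<in> {x \<in> space M. ?Y x = y}. f x = u} \<le>
          ennreal (?pb v w / ?pc w) * emeasure M {x \<in> {x \<in> space M. k x = w}. f x = u}"
        by (simp add: y emeasure_eq_measure flip: ennreal_mult)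
    qed
    also have "\<dots> = ennreal (?pb v w / ?pc w) *
        (\<integral>\<^sup>+ u. emeasure M {x \<in> {x \<in> space M. k x = w}. f x = u} \<partial>count_space (f ` space M))"
      by (rule nn_integral_cmult) simp
    also have "\<dots> = ennreal (?pb v w / ?pc w) * ennreal (?pc w)"
      using emeasure_eq_sum_fibres[OF f discrete_rv_sets[OF k, of w]] by (simp add: emeasure_eq_measure)
    also have "\<dots> \<le> ennreal (?pb v w)"
      by (simp add: flip: ennreal_mult)
    also have "\<dots> = emeasure M {x \<in> space M. ?Y x = y}" by (simp add: y emeasure_eq_measure)
    finally show "(\<integral>\<^sup>+ x. ?\<psi> (f x) y * indicator {x \<in> space M. ?Y x = y} x \<partial>M) \<le>
        emeasure M {x \<in> space M. ?Y x = y}" .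
  qed
  also have "\<dots> = emeasure M (space M)" by (rule emeasure_eq_sum_fibres[OF Y sets.top])
  finally show ?thesis by (simp add: emeasure_space_1)
qed

lemma pmass_mono:
  assumes "discrete_rv M f" "\<And>x y. x \<in> space M \<Longrightarrow> y \<in> space M \<Longrightarrow> g x = g y \<Longrightarrow> f x = f y"
    and "x \<in> space M"
  shows "pmass g x \<le> pmass f x"
  unfolding pmass_def
proof (rule finite_measure_mono)
  show "{y \<in> space M. g y = g x} \<subseteq> {y \<in> space M. f y = f x}"
    using assms(2)[OF _ assms(3)] by blast
qed (rule discrete_rv_sets[OF assms(1)])

text \<open>The fibres of \<open>g\<close> refine those of \<open>f\<close>, so masses, and almost
  everywhere information, compare pointwise.\<close>

lemma finite_ent_mono:
  assumes f: "discrete_rv M f" and g: "finite_ent g"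
    and "\<And>x y. x \<in> space M \<Longrightarrow> y \<in> space M \<Longrightarrow> g x = g y \<Longrightarrow> f x = f y"
  shows "finite_ent f" "ent f \<le> ent g"
proof -
  have gd: "discrete_rv M g" and gi: "integrable M (info g)" using g by (auto simp: finite_ent_def)
  have le: "AE x in M. info f x \<le> info g x"
    using AE_pmass_pos[OF gd] AE_space
  proof eventually_elim
    case (elim x)
    have "pmass g x \<le> pmass f x" by (rule pmass_mono[OF f _ elim(2)]) (rule assms(3))
    then show ?case using elim by (simp add: info_def)
  qed
  then have fi: "integrable M (info f)"
    using info_nonneg[of f] by (intro Bochner_Integration.integrable_bound[OF gi info_measurable[OF f]]) auto
  then show "finite_ent f" using f by (simp add: finite_ent_def)
  show "ent f \<le> ent g" unfolding ent_def by (rule integral_mono_AE[OF fi gi le])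
qed

lemma ent_cong:
  assumes "\<And>x y. x \<in> space M \<Longrightarrow> y \<in> space M \<Longrightarrow> g x = g y \<longleftrightarrow> f x = f y"
  shows "ent f = ent g"
proof -
  have "pmass f x = pmass g x" if "x \<in> space M" for x
    using assms that unfolding pmass_def by (intro arg_cong[where f = prob]) auto
  then show ?thesis unfolding ent_def info_def
    by (intro Bochner_Integration.integral_cong) auto
qed

lemma ent_const: "ent (\<lambda>_. c) = 0" and finite_ent_const: "finite_ent (\<lambda>_. c)"
proof -
  have "discrete_rv M (\<lambda>_. c)" by (auto simp: discrete_rv_def image_constant_conv)
  moreover have "info (\<lambda>_. c) = (\<lambda>_. 0)" by (auto simp: info_def pmass_def prob_space fun_eq_iff)
  ultimately show "ent (\<lambda>_. c) = 0" "finite_ent (\<lambda>_. c)" by (auto simp: ent_def finite_ent_def)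
qed

text \<open>Gibbs' inequality: \<open>ln t \<le> t - 1\<close> is integrated at the conditional
  independence ratio, whose mean is at most one. The same pointwise estimate dominates the joint
  information and so yields its integrability.\<close>

lemma ent_submodular:
  assumes f: "discrete_rv M f" and g: "discrete_rv M g" and k: "discrete_rv M k"
    and fk: "finite_ent (\<lambda>x. (f x, k x))" and gk: "finite_ent (\<lambda>x. (g x, k x))"
  shows "finite_ent (\<lambda>x. (f x, g x, k x))"
    and "ent (\<lambda>x. (f x, g x, k x)) + ent k \<le> ent (\<lambda>x. (f x, k x)) + ent (\<lambda>x. (g x, k x))"
proof -
  let ?a = "\<lambda>x. (f x, k x)" and ?b = "\<lambda>x. (g x, k x)" and ?d = "\<lambda>x. (f x, g x, k x)"
  have d: "discrete_rv M ?d" by (intro discrete_rv_Pair f g k)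
  have a: "discrete_rv M ?a" "integrable M (info ?a)" and b: "discrete_rv M ?b" "integrable M (info ?b)"
    using fk gk by (auto simp: finite_ent_def)
  have "finite_ent k" by (rule finite_ent_mono(1)[OF k fk]) auto
  then have c: "integrable M (info k)" by (simp add: finite_ent_def)
  let ?\<rho> = "\<lambda>x. pmass ?a x * pmass ?b x / (pmass k x * pmass ?d x)"
  have \<rho>0: "0 \<le> ?\<rho> x" for x by (simp add: pmass_nonneg)
  have "?\<rho> \<in> borel_measurable M"
    using pmass_measurable[OF a(1)] pmass_measurable[OF b(1)] pmass_measurable[OF k]
      pmass_measurable[OF d] by measurable
  moreover have \<rho>1: "(\<integral>\<^sup>+ x. ennreal (?\<rho> x) \<partial>M) \<le> 1"
    by (rule nn_integral_conditional_independence_ratio[OF f g k])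
  ultimately have \<rho>: "integrable M ?\<rho>"
    using \<rho>0 by (intro integrableI_nonneg) (auto intro: le_less_trans)
  have "ennreal (\<integral>x. ?\<rho> x \<partial>M) \<le> 1"
    using \<rho>1 nn_integral_eq_integral[OF \<rho>] \<rho>0 by simp
  then have \<rho>_le: "(\<integral>x. ?\<rho> x \<partial>M) \<le> 1" by simp
  have ineq: "AE x in M. info ?d x \<le> info ?a x + info ?b x - info k x + ?\<rho> x - 1"
    using AE_pmass_pos[OF a(1)] AE_pmass_pos[OF b(1)] AE_pmass_pos[OF k] AE_pmass_pos[OF d]
  proof eventually_elim
    case (elim x)
    then have "ln (?\<rho> x) = ln (pmass ?a x) + ln (pmass ?b x) - ln (pmass k x) - ln (pmass ?d x)"
      by (simp add: ln_div ln_mult)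
    moreover have "ln (?\<rho> x) \<le> ?\<rho> x - 1" using elim by (intro ln_le_minus_one) simp
    ultimately show ?case by (simp add: info_def)
  qed
  have bound: "AE x in M. norm (info ?d x) \<le> norm (info ?a x + info ?b x + ?\<rho> x)"
    using ineq
  proof eventually_elim
    case (elim x)
    then show ?case
      using info_nonneg[of ?a x] info_nonneg[of ?b x] info_nonneg[of ?d x] info_nonneg[of k x] \<rho>0[of x]
      by simp
  qed
  then have di: "integrable M (info ?d)"
    by (rule Bochner_Integration.integrable_bound[rotated 2])
      (use a b \<rho> in \<open>auto intro: info_measurable[OF d]\<close>)
  then show "finite_ent ?d" using d by (simp add: finite_ent_def)
  have "ent ?d \<le> (\<integral>x. info ?a x + info ?b x - info k x + ?\<rho> x - 1 \<partial>M)"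
    unfolding ent_def using a b c \<rho> di by (intro integral_mono_AE[OF _ _ ineq]) auto
  also have "\<dots> = ent ?a + ent ?b - ent k + (\<integral>x. ?\<rho> x \<partial>M) - 1"
    unfolding ent_def using a b c \<rho> by (simp add: prob_space)
  finally show "ent ?d + ent k \<le> ent ?a + ent ?b" using \<rho>_le by simp
qed

text \<open>Both sides sum \<open>- p * ln p\<close> over the masses of the fibres. In
  \<open>ennreal\<close> this holds without assuming the entropy finite, so it can serve to test
  finiteness.\<close>

lemma shannon_entropy_fibres:
  assumes f: "discrete_rv M f"
  shows "shannon_entropy M (fibres M f) = enn2ereal (\<integral>\<^sup>+ x. ennreal (info f x) \<partial>M)"
proof -
  let ?R = "f ` space M" and ?A = "\<lambda>v. {x \<in> space M. f x = v}"
  let ?e = "\<lambda>v. - prob (?A v) * ln (prob (?A v))"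
  have e0: "0 \<le> ?e v" for v
  proof (cases "prob (?A v) = 0")
    case False
    then have "ln (prob (?A v)) \<le> 0" by (simp add: less_le)
    then show ?thesis by (simp add: mult_nonneg_nonpos)
  qed simp
  have "inj_on ?A ?R" by (auto simp: inj_on_def)
  then have "shannon_entropy M (fibres M f) = (\<Sum>\<^sub>\<infinity>v\<in>?R. ereal (?e v))"
    unfolding shannon_entropy_def fibres_def by (subst infsum_reindex) (auto simp: o_def)
  also have "\<dots> = infsum (enn2ereal \<circ> (\<lambda>v. ennreal (?e v))) ?R"
    using e0 by (intro infsum_cong) simp
  also have "\<dots> = enn2ereal (infsum (\<lambda>v. ennreal (?e v)) ?R)"
    by (intro infsum_comm_additive_general)
      (auto simp: continuous_at_enn2ereal plus_ennreal.rep_eq nonneg_summable_on_complete)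
  also have "infsum (\<lambda>v. ennreal (?e v)) ?R = (\<integral>\<^sup>+ v. ennreal (?e v) \<partial>count_space ?R)"
    using f by (intro infsum_ennreal_eq_nn_integral) (simp add: discrete_rv_def)
  also have "\<dots> = (\<integral>\<^sup>+ v. ennreal (- ln (prob (?A v))) * emeasure M (?A v) \<partial>count_space ?R)"
  proof (intro nn_integral_cong)
    fix v
    have "0 \<le> - ln (prob (?A v))" by (cases "prob (?A v) = 0") (auto simp: less_le)
    then show "ennreal (?e v) = ennreal (- ln (prob (?A v))) * emeasure M (?A v)"
      by (simp add: emeasure_eq_measure mult.commute flip: ennreal_mult)
  qed
  also have "\<dots> = (\<integral>\<^sup>+ x. ennreal (- ln (prob (?A (f x)))) \<partial>M)"
    by (rule nn_integral_discrete[OF f, symmetric])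
  finally show ?thesis by (simp add: info_def pmass_def)
qed

lemma shannon_entropy_finite_ent:
  assumes "finite_ent f" shows "shannon_entropy M (fibres M f) = ereal (ent f)"
proof -
  have "0 \<le> ent f" unfolding ent_def by (intro Bochner_Integration.integral_nonneg info_nonneg)
  then show ?thesis
    using assms shannon_entropy_fibres[of f] nn_integral_eq_integral[of M "info f"] info_nonneg[of f]
    by (simp add: finite_ent_def ent_def)
qed

lemma finite_ent_iff_shannon_entropy:
  "finite_ent f \<longleftrightarrow> discrete_rv M f \<and> shannon_entropy M (fibres M f) < \<infinity>"
proof (cases "discrete_rv M f")
  case True
  have "integrable M (info f) \<longleftrightarrow> (\<integral>\<^sup>+ x. ennreal (info f x) \<partial>M) < \<infinity>"
    using info_measurable[OF True] info_nonneg[of f]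
    by (simp add: integrable_iff_bounded)
  moreover have "c < \<infinity> \<longleftrightarrow> enn2ereal c < \<infinity>" for c
    by (cases c) auto
  ultimately show ?thesis
    using True shannon_entropy_fibres[OF True] by (simp add: finite_ent_def)
qed (simp add: finite_ent_def)

end

section \<open>The polymatroid of random variables\<close>

definition joint :: "('x \<Rightarrow> 'c) set \<Rightarrow> 'x \<Rightarrow> ('x \<Rightarrow> 'c) \<Rightarrow> 'c" where
  "joint A x = restrict (\<lambda>f. f x) A"

lemma joint_eq_iff: "joint A x = joint A y \<longleftrightarrow> (\<forall>f\<in>A. f x = f y)"
  by (auto simp: joint_def restrict_def fun_eq_iff)

lemma discrete_rv_const: "discrete_rv M (\<lambda>_. c)"
  by (auto simp: discrete_rv_def image_constant_conv)

lemma restrict_eq_iff: "restrict f I = restrict g I \<longleftrightarrow> (\<forall>i\<in>I. f i = g i)"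
  by (auto simp: restrict_def fun_eq_iff)

lemma discrete_rv_joint:
  fixes A :: "('x \<Rightarrow> 'c) set"
  assumes "finite A" "\<And>f. f \<in> A \<Longrightarrow> discrete_rv M f" shows "discrete_rv M (joint A)"
  using assms
proof (induction A rule: finite_induct)
  case empty
  have "joint ({} :: ('x \<Rightarrow> 'c) set) = (\<lambda>_. \<lambda>_. undefined)" by (auto simp: joint_def fun_eq_iff)
  then show ?case by (simp add: discrete_rv_const)
next
  case (insert f A)
  have "joint (insert f A) = (\<lambda>x. (\<lambda>(v, u). u(f := v)) (f x, joint A x))"
    using insert.hyps by (auto simp: joint_def fun_eq_iff restrict_def)
  moreover have p: "discrete_rv M (\<lambda>x. (f x, joint A x))"
    using insert by (intro discrete_rv_Pair) auto
  ultimately show ?case using discrete_rv_comp[OF p, of "\<lambda>(v, u). u(f := v)"]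
    by (simp only: prod.case)
qed

context prob_space
begin

text \<open>Values outside \<open>space M\<close> are fixed so that translation by the identity is
  the identity on functions.\<close>

definition rvs :: "('a \<Rightarrow> 'c) set" where
  "rvs = {f. f \<in> extensional (space M) \<and> finite_ent f}"

text \<open>\<open>ent_submodular\<close> over a constant variable is subadditivity, which admits
  one more observable at a time.\<close>

lemma finite_ent_joint:
  assumes "finite A" "A \<subseteq> rvs" shows "finite_ent (joint A)"
  using assms
proof (induction A rule: finite_induct)
  case empty
  show ?case by (rule finite_ent_mono(1)[OF discrete_rv_joint finite_ent_const[of undefined]])
      (auto simp: joint_eq_iff)
next
  case (insert f A)
  have f: "finite_ent f" "discrete_rv M f" and A: "finite_ent (joint A)" "discrete_rv M (joint A)"
    using insert by (auto simp: rvs_def finite_ent_def)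
  have u: "discrete_rv M (\<lambda>_. ())" by (rule discrete_rv_const)
  have "finite_ent (\<lambda>x. (f x, ()))" "finite_ent (\<lambda>x. (joint A x, ()))"
    by (rule finite_ent_mono(1)[OF discrete_rv_Pair[OF f(2) u] f(1)], simp)
      (rule finite_ent_mono(1)[OF discrete_rv_Pair[OF A(2) u] A(1)], simp)
  from ent_submodular(1)[OF f(2) A(2) u this]
  show ?case
  proof (rule finite_ent_mono(1)[rotated])
    show "discrete_rv M (joint (insert f A))"
      using insert by (intro discrete_rv_joint) (auto simp: rvs_def finite_ent_def)
  qed (auto simp: joint_eq_iff)
qed

definition joint_ent :: "('a \<Rightarrow> 'c) set \<Rightarrow> real" where
  "joint_ent A = ent (joint A)"

lemma joint_ent_empty: "joint_ent {} = 0"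
proof -
  have "ent (joint {}) = ent (\<lambda>_. undefined)" by (rule ent_cong) (simp add: joint_eq_iff)
  then show ?thesis by (simp add: joint_ent_def ent_const)
qed

text \<open>Submodularity is \<open>ent_submodular\<close> given
  \<open>joint (A \<inter> B)\<close>; pairing \<open>joint A\<close> or \<open>joint B\<close> with
  this variable does not change the fibres.\<close>

lemma polymatroid_joint_ent: "polymatroid rvs joint_ent"
proof
  fix A B :: "('a \<Rightarrow> 'c) set"
  assume B: "finite B" "B \<subseteq> rvs" and "A \<subseteq> B"
  then have A: "finite A" "A \<subseteq> rvs" by (auto intro: finite_subset)
  then show "joint_ent A \<le> joint_ent B"
    unfolding joint_ent_def using \<open>A \<subseteq> B\<close> finite_ent_joint[OF B] finite_ent_joint[OF A]
    by (intro finite_ent_mono(2)) (auto simp: joint_eq_iff finite_ent_def)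
next
  fix A B :: "('a \<Rightarrow> 'c) set"
  assume A: "finite A" "A \<subseteq> rvs" and B: "finite B" "B \<subseteq> rvs"
  have AB: "finite (A \<inter> B)" "A \<inter> B \<subseteq> rvs" using A by auto
  let ?k = "joint (A \<inter> B)"
  note fA = finite_ent_joint[OF A] and fB = finite_ent_joint[OF B] and fk = finite_ent_joint[OF AB]
  have d: "discrete_rv M (joint A)" "discrete_rv M (joint B)" "discrete_rv M ?k"
    using fA fB fk by (auto simp: finite_ent_def)
  have "finite_ent (\<lambda>x. (joint A x, ?k x))"
    by (rule finite_ent_mono(1)[OF discrete_rv_Pair[OF d(1,3)] fA]) (auto simp: joint_eq_iff)
  moreover have "finite_ent (\<lambda>x. (joint B x, ?k x))"
    by (rule finite_ent_mono(1)[OF discrete_rv_Pair[OF d(2,3)] fB]) (auto simp: joint_eq_iff)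
  ultimately have "ent (\<lambda>x. (joint A x, joint B x, ?k x)) + ent ?k \<le>
      ent (\<lambda>x. (joint A x, ?k x)) + ent (\<lambda>x. (joint B x, ?k x))"
    by (rule ent_submodular(2)[OF d])
  moreover have "ent (\<lambda>x. (joint A x, joint B x, ?k x)) = ent (joint (A \<union> B))"
    "ent (\<lambda>x. (joint A x, ?k x)) = ent (joint A)" "ent (\<lambda>x. (joint B x, ?k x)) = ent (joint B)"
    by (rule ent_cong; auto simp: joint_eq_iff)+
  ultimately show "joint_ent (A \<union> B) + joint_ent (A \<inter> B) \<le> joint_ent A + joint_ent B"
    by (simp add: joint_ent_def)
qed

lemma discrete_rv_compose_measurable:
  assumes "T \<in> measurable M M" "discrete_rv M f" shows "discrete_rv M (f \<circ> T)"
  unfolding discrete_rv_def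
proof (intro conjI allI)
  have "(f \<circ> T) ` space M \<subseteq> f ` space M" using measurable_space[OF assms(1)] by auto
  then show "countable ((f \<circ> T) ` space M)"
    using assms(2) by (auto simp: discrete_rv_def intro: countable_subset)
  fix v
  have "{x \<in> space M. (f \<circ> T) x = v} = T -` {x \<in> space M. f x = v} \<inter> space M"
    using measurable_space[OF assms(1)] by auto
  then show "{x \<in> space M. (f \<circ> T) x = v} \<in> sets M"
    using measurable_sets[OF assms(1) discrete_rv_sets[OF assms(2)]] by simp
qed

lemma info_compose:
  assumes "T \<in> measurable M M" "distr M M T = M" "discrete_rv M f" "x \<in> space M"
  shows "info (f \<circ> T) x = info f (T x)"
proof -
  let ?A = "{y \<in> space M. f y = f (T x)}"
  have "prob ?A = measure (distr M M T) ?A" using assms(2) by simp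
  also have "\<dots> = prob (T -` ?A \<inter> space M)"
    using assms discrete_rv_sets by (intro measure_distr) auto
  also have "T -` ?A \<inter> space M = {y \<in> space M. (f \<circ> T) y = (f \<circ> T) x}"
    using measurable_space[OF assms(1)] by auto
  finally show ?thesis by (simp add: info_def pmass_def)
qed

lemma ent_compose:
  assumes T: "T \<in> measurable M M" "distr M M T = M" and f: "discrete_rv M f"
  shows "ent (f \<circ> T) = ent f" "finite_ent f \<Longrightarrow> finite_ent (f \<circ> T)"
proof -
  note m = info_measurable[OF f]
  have "ent (f \<circ> T) = (\<integral>x. info f (T x) \<partial>M)"
    unfolding ent_def using info_compose[OF T f]
    by (intro Bochner_Integration.integral_cong) auto
  also have "\<dots> = (\<integral>x. info f x \<partial>distr M M T)" by (rule integral_distr[OF T(1) m, symmetric])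
  finally show "ent (f \<circ> T) = ent f" by (simp add: T(2) ent_def)
  assume "finite_ent f"
  then have "integrable (distr M M T) (info f)" by (simp add: T(2) finite_ent_def)
  then have "integrable M (\<lambda>x. info f (T x))" using integrable_distr_eq[OF T(1) m] by simp
  then have "integrable M (info (f \<circ> T))"
    using info_compose[OF T f] by (subst Bochner_Integration.integrable_cong[OF refl]) auto
  then show "finite_ent (f \<circ> T)"
    using discrete_rv_compose_measurable[OF T(1) f] by (simp add: finite_ent_def)
qed

lemma finite_ent_cong:
  assumes "finite_ent f" "\<And>x. x \<in> space M \<Longrightarrow> f x = g x" shows "finite_ent g"
proof (rule finite_ent_mono(1)[OF _ assms(1)])
  have "{x \<in> space M. g x = v} = {x \<in> space M. f x = v}" for v using assms(2) by auto
  moreover have "g ` space M = f ` space M" using assms(2) by (auto simp: image_iff)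
  ultimately show "discrete_rv M g" using assms(1) by (simp add: finite_ent_def discrete_rv_def)
qed (use assms(2) in metis)

end

section \<open>Countable partitions as fibres of observables\<close>

lemma fibres_alt: "fibres M f = (\<lambda>x. {y \<in> space M. f y = f x}) ` space M"
  by (auto simp: fibres_def)

lemma fibre_eq: "A \<in> fibres M f \<Longrightarrow> x \<in> A \<Longrightarrow> A = {y \<in> space M. f y = f x}"
  by (auto simp: fibres_alt)

lemma fibres_cong:
  assumes "\<And>x y. x \<in> space M \<Longrightarrow> y \<in> space M \<Longrightarrow> f x = f y \<longleftrightarrow> g x = g y"
  shows "fibres M f = fibres M g"
  unfolding fibres_alt using assms by (intro image_cong Collect_cong conj_cong refl) auto

text \<open>If one block is chosen from each partition and the blocks meet in \<open>x\<close>, each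
  of them is the fibre through \<open>x\<close>, so their intersection is the joint fibre through
  \<open>x\<close>.\<close>

lemma common_refinement_fibres:
  assumes "I \<noteq> {}"
  shows "common_refinement ((\<lambda>i. fibres M (F i)) ` I) = fibres M (\<lambda>x. restrict (\<lambda>i. F i x) I)"
proof -
  let ?P = "(\<lambda>i. fibres M (F i)) ` I"
  let ?cell = "\<lambda>x. {y \<in> space M. \<forall>i\<in>I. F i y = F i x}"
  have "restrict (\<lambda>i. F i y) I = restrict (\<lambda>i. F i x) I \<longleftrightarrow> (\<forall>i\<in>I. F i y = F i x)" for x y
    by (auto simp: restrict_def fun_eq_iff)
  then have fib: "fibres M (\<lambda>x. restrict (\<lambda>i. F i x) I) = ?cell ` space M"
    by (simp add: fibres_alt)
  have one: "\<Inter> (c ` ?P) = ?cell x" if c: "\<And>P. P \<in> ?P \<Longrightarrow> c P \<in> P" and x: "x \<in> \<Inter> (c ` ?P)" for c x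
  proof -
    have "c (fibres M (F i)) = {y \<in> space M. F i y = F i x}" if i: "i \<in> I" for i
    proof -
      have "c (fibres M (F i)) \<in> fibres M (F i)" by (rule c[OF imageI[OF i]])
      moreover have "x \<in> c (fibres M (F i))" using x i by blast
      ultimately show ?thesis by (rule fibre_eq)
    qed
    then have "(\<Inter>i\<in>I. c (fibres M (F i))) = (\<Inter>i\<in>I. {y \<in> space M. F i y = F i x})" by simp
    also have "\<dots> = ?cell x" using assms by blast
    finally show ?thesis by (simp add: image_image)
  qed
  show ?thesis unfolding fib
  proof (rule antisym)
    show "common_refinement ?P \<subseteq> ?cell ` space M"
    proof
      fix B assume "B \<in> common_refinement ?P"
      then obtain c where c: "\<And>P. P \<in> ?P \<Longrightarrow> c P \<in> P" "B = \<Inter> (c ` ?P)" and "B \<noteq> {}"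
        unfolding common_refinement by auto
      then obtain x where x: "x \<in> \<Inter> (c ` ?P)" by blast
      then have "B = ?cell x" using one[OF c(1), of x] c(2) by blast
      moreover have "x \<in> ?cell x" using one[OF c(1) x] x by blast
      ultimately show "B \<in> ?cell ` space M" by blast
    qed
    show "?cell ` space M \<subseteq> common_refinement ?P"
    proof
      fix B assume "B \<in> ?cell ` space M"
      then obtain x where x: "x \<in> space M" "B = ?cell x" by blast
      define c where "c P = \<Union>{A \<in> P. x \<in> A}" for P
      have c: "c (fibres M (F i)) = {y \<in> space M. F i y = F i x}" for i
      proof -
        have "{A \<in> fibres M (F i). x \<in> A} = {{y \<in> space M. F i y = F i x}}"
          using x(1) by (auto simp: fibres_alt)
        then show ?thesis by (simp add: c_def)
      qed
      then have cP: "c P \<in> P" if "P \<in> ?P" for P using that x(1) by (auto simp: fibres_alt)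
      moreover have xc: "x \<in> \<Inter> (c ` ?P)" using c x(1) by auto
      ultimately have "B = \<Inter> (c ` ?P)" using one[of c x] x(2) by metis
      then show "B \<in> common_refinement ?P"
        unfolding common_refinement using cP xc by blast
    qed
  qed
qed

text \<open>The observable that names the block containing a point; for a partition this block is
  unique, so the union is the block itself.\<close>

definition cell_of :: "'x measure \<Rightarrow> 'x set set \<Rightarrow> 'x \<Rightarrow> 'x set" where
  "cell_of M \<alpha> = restrict (\<lambda>x. \<Union>{A \<in> \<alpha>. x \<in> A}) (space M)"

lemma cell_of_eq:
  assumes "countable_measurable_partition M \<alpha>" "A \<in> \<alpha>" "x \<in> A"
  shows "cell_of M \<alpha> x = A"
proof -
  have p: "partition_on (space M) \<alpha>" using assms(1) by (simp add: countable_measurable_partition_def)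
  have "{B \<in> \<alpha>. x \<in> B} = {A}"
    using partition_onD2[OF p] assms(2,3) by (auto simp: disjoint_def)
  moreover have "x \<in> space M" using partition_onD1[OF p] assms by auto
  ultimately show ?thesis by (simp add: cell_of_def)
qed

lemma cell_of_fibre:
  assumes "countable_measurable_partition M \<alpha>" "A \<in> \<alpha>"
  shows "{x \<in> space M. cell_of M \<alpha> x = A} = A"
proof -
  have p: "partition_on (space M) \<alpha>" using assms(1) by (simp add: countable_measurable_partition_def)
  have "x \<in> A" if "x \<in> space M" "cell_of M \<alpha> x = A" for x
  proof -
    have "x \<in> \<Union>\<alpha>" using that(1) partition_onD1[OF p] by simp
    then obtain B where B: "B \<in> \<alpha>" "x \<in> B" by (rule UnionE)
    then show ?thesis using cell_of_eq[OF assms(1) B] that(2) by simp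
  qed
  then show ?thesis
    using cell_of_eq[OF assms(1,2)] partition_onD1[OF p] assms(2) by auto
qed

lemma cell_of_image:
  assumes "countable_measurable_partition M \<alpha>" shows "cell_of M \<alpha> ` space M = \<alpha>"
proof -
  have p: "partition_on (space M) \<alpha>" using assms(1) by (simp add: countable_measurable_partition_def)
  have "\<exists>x\<in>space M. cell_of M \<alpha> x = A" if "A \<in> \<alpha>" for A
  proof -
    obtain x where "x \<in> A" using partition_onD3[OF p] \<open>A \<in> \<alpha>\<close> by (metis equals0I)
    then show ?thesis
      using cell_of_eq[OF assms that] partition_onD1[OF p] that by (intro bexI[of _ x]) auto
  qed
  moreover have "cell_of M \<alpha> x \<in> \<alpha>" if "x \<in> space M" for x
  proof -
    have "x \<in> \<Union>\<alpha>" using that partition_onD1[OF p] by simp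
    then obtain B where B: "B \<in> \<alpha>" "x \<in> B" by (rule UnionE)
    then show ?thesis using cell_of_eq[OF assms B] by simp
  qed
  ultimately show ?thesis by blast
qed

lemma fibres_cell_of:
  assumes "countable_measurable_partition M \<alpha>" shows "fibres M (cell_of M \<alpha>) = \<alpha>"
  unfolding fibres_def cell_of_image[OF assms] using cell_of_fibre[OF assms] by simp

lemma discrete_rv_cell_of:
  assumes "countable_measurable_partition M \<alpha>" shows "discrete_rv M (cell_of M \<alpha>)"
  unfolding discrete_rv_def cell_of_image[OF assms]
proof (intro conjI allI)
  show "countable \<alpha>" using assms by (simp add: countable_measurable_partition_def)
  fix A
  show "{x \<in> space M. cell_of M \<alpha> x = A} \<in> sets M"
  proof (cases "A \<in> \<alpha>")
    case True
    then show ?thesis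
      using cell_of_fibre[OF assms] assms by (auto simp: countable_measurable_partition_def)
  next
    case False
    then have "{x \<in> space M. cell_of M \<alpha> x = A} = {}" using cell_of_image[OF assms] by blast
    then show ?thesis by (simp only: sets.empty_sets)
  qed
qed

lemma (in prob_space) cell_of_in_rvs:
  assumes "countable_measurable_partition M \<alpha>" "shannon_entropy M \<alpha> < \<infinity>"
  shows "cell_of M \<alpha> \<in> rvs"
  using assms discrete_rv_cell_of[OF assms(1)] fibres_cell_of[OF assms(1)]
  by (auto simp: rvs_def finite_ent_iff_shannon_entropy) (simp add: cell_of_def)


section \<open>Measure preserving actions\<close>

locale pmp_system = prob_space M + group G
  for M :: "'x measure" and G :: "('g, 'm) monoid_scheme" (structure) +
  fixes \<phi> :: "'g \<Rightarrow> 'x \<Rightarrow> 'x"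
  assumes pmp: "pmp_action G M \<phi>"
begin

lemma act_measurable: "g \<in> carrier G \<Longrightarrow> \<phi> g \<in> measurable M M"
  and act_distr: "g \<in> carrier G \<Longrightarrow> distr M M (\<phi> g) = M"
  and action: "group_action G (space M) \<phi>"
  using pmp by (auto simp: pmp_action_def)

lemma act_space: "g \<in> carrier G \<Longrightarrow> x \<in> space M \<Longrightarrow> \<phi> g x \<in> space M"
  using group_action.element_image[OF action] by blast

lemma act_mult: "g \<in> carrier G \<Longrightarrow> k \<in> carrier G \<Longrightarrow> x \<in> space M \<Longrightarrow> \<phi> (g \<otimes> k) x = \<phi> g (\<phi> k x)"
  using group_action.composition_rule[OF action] by blast

lemma act_one: "x \<in> space M \<Longrightarrow> \<phi> \<one> x = x"
  using group_action.id_eq_one[OF action] by (metis restrict_apply')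

lemma act_inv: "g \<in> carrier G \<Longrightarrow> x \<in> space M \<Longrightarrow> \<phi> (inv g) (\<phi> g x) = x"
  and act_inv': "g \<in> carrier G \<Longrightarrow> x \<in> space M \<Longrightarrow> \<phi> g (\<phi> (inv g) x) = x"
  by (simp_all add: act_one flip: act_mult)

text \<open>The inverse makes this a left action and makes the fibres of \<open>shift g f\<close>
  the translates by \<open>g\<close> of the fibres of \<open>f\<close>.\<close>

definition shift :: "'g \<Rightarrow> ('x \<Rightarrow> 'c) \<Rightarrow> 'x \<Rightarrow> 'c" where
  "shift g f = restrict (\<lambda>x. f (\<phi> (inv g) x)) (space M)"

lemma shift_apply [simp]: "x \<in> space M \<Longrightarrow> shift g f x = f (\<phi> (inv g) x)"
  by (simp add: shift_def)

lemma shift_in_rvs: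
  assumes "g \<in> carrier G" "f \<in> rvs" shows "shift g f \<in> rvs"
proof -
  have f: "finite_ent f" "discrete_rv M f" using assms by (auto simp: rvs_def finite_ent_def)
  have "finite_ent (f \<circ> \<phi> (inv g))"
    using assms(1) by (intro ent_compose(2)[OF act_measurable act_distr f(2) f(1)]) auto
  then have "finite_ent (shift g f)" by (rule finite_ent_cong) auto
  then show ?thesis by (simp add: rvs_def) (simp add: shift_def)
qed

sublocale invariant_polymatroid G "rvs :: ('x \<Rightarrow> 'c) set" shift joint_ent
proof (intro invariant_polymatroid.intro invariant_polymatroid_axioms.intro group_axioms
    polymatroid_joint_ent)
  fix g and f :: "'x \<Rightarrow> 'c"
  assume g: "g \<in> carrier G" and f: "f \<in> rvs"
  show "shift g f \<in> rvs" by (rule shift_in_rvs[OF g f])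
next
  fix f :: "'x \<Rightarrow> 'c" assume "f \<in> rvs"
  then have "f \<in> extensional (space M)" by (simp add: rvs_def)
  then show "shift \<one> f = f" by (auto simp: shift_def act_one fun_eq_iff extensional_def)
next
  fix g k and f :: "'x \<Rightarrow> 'c"
  assume "g \<in> carrier G" "k \<in> carrier G" "f \<in> rvs"
  then show "shift (g \<otimes> k) f = shift g (shift k f)"
    by (auto simp: fun_eq_iff shift_def inv_mult_group act_mult act_space)
next
  fix g and A :: "('x \<Rightarrow> 'c) set"
  assume g: "g \<in> carrier G" and A: "finite A" "A \<subseteq> rvs"
  have d: "discrete_rv M (joint A)" using finite_ent_joint[OF A] by (simp add: finite_ent_def)
  have "ent (joint (shift g ` A)) = ent (joint A \<circ> \<phi> (inv g))"
    by (rule ent_cong) (auto simp: joint_eq_iff)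
  also have "\<dots> = ent (joint A)"
    using g by (intro ent_compose(1)[OF act_measurable act_distr d]) auto
  finally show "joint_ent (shift g ` A) = joint_ent A" by (simp add: joint_ent_def)
qed

lemma translate_fibres:
  assumes "g \<in> carrier G"
  shows "translate_partition \<phi> g (fibres M f) = fibres M (\<lambda>x. f (\<phi> (inv g) x))"
proof -
  have "\<phi> g ` {y \<in> space M. f y = f x} = {y \<in> space M. f (\<phi> (inv g) y) = f x}" for x
  proof
    show "\<phi> g ` {y \<in> space M. f y = f x} \<subseteq> {y \<in> space M. f (\<phi> (inv g) y) = f x}"
      using assms act_space act_inv by auto
    show "{y \<in> space M. f (\<phi> (inv g) y) = f x} \<subseteq> \<phi> g ` {y \<in> space M. f y = f x}"
    proof
      fix y assume y: "y \<in> {y \<in> space M. f (\<phi> (inv g) y) = f x}"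
      then show "y \<in> \<phi> g ` {y \<in> space M. f y = f x}"
        using assms act_space[of "inv g" y] act_inv'[of g y] by (intro image_eqI[of _ _ "\<phi> (inv g) y"]) auto
    qed
  qed
  moreover have "f ` space M = (\<lambda>x. f (\<phi> (inv g) x)) ` space M"
  proof
    show "f ` space M \<subseteq> (\<lambda>x. f (\<phi> (inv g) x)) ` space M"
    proof
      fix v assume "v \<in> f ` space M"
      then obtain x where "x \<in> space M" "v = f x" by blast
      then show "v \<in> (\<lambda>x. f (\<phi> (inv g) x)) ` space M"
        using assms by (intro image_eqI[of _ _ "\<phi> g x"]) (auto simp: act_inv act_space)
    qed
    show "(\<lambda>x. f (\<phi> (inv g) x)) ` space M \<subseteq> f ` space M" using assms by (auto simp: act_space)
  qed
  ultimately show ?thesis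
    unfolding translate_partition_def fibres_def
    by (auto simp: image_image)
qed

lemma join_translates_fibres:
  assumes "F \<noteq> {}" "F \<subseteq> carrier G"
  shows "join_translates \<phi> F (fibres M f) = fibres M (joint ((\<lambda>g. shift g f) ` F))"
proof -
  have "(\<lambda>g. translate_partition \<phi> g (fibres M f)) ` F = (\<lambda>g. fibres M (\<lambda>x. f (\<phi> (inv g) x))) ` F"
    using assms by (intro image_cong) (auto simp: translate_fibres)
  then have "join_translates \<phi> F (fibres M f) = fibres M (\<lambda>x. restrict (\<lambda>g. f (\<phi> (inv g) x)) F)"
    unfolding join_translates_def using common_refinement_fibres[OF assms(1)] by simp
  also have "\<dots> = fibres M (joint ((\<lambda>g. shift g f) ` F))"
    by (rule fibres_cong) (auto simp: joint_eq_iff restrict_eq_iff)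
  finally show ?thesis .
qed

text \<open>By invariance the mutual information of \<open>A\<close> and its translate by
  \<open>s\<close> is \<open>2 * joint_ent A\<close> minus their joint entropy. Summing over
  \<open>S\<close> absorbs the coefficient \<open>- 2 * card S\<close>.\<close>

lemma F_entropy_eq:
  assumes A: "finite A" "A \<subseteq> rvs" and S: "finite S" "S \<subseteq> carrier G"
  shows "F_entropy M \<phi> S (fibres M (joint A)) =
    ereal (joint_ent A - (\<Sum>s\<in>S. mi A (shift s ` A)))"
proof -
  have fA: "finite_ent (joint A)" by (rule finite_ent_joint[OF A])
  have "shannon_entropy M (common_refinement {translate_partition \<phi> s (fibres M (joint A)), fibres M (joint A)}) =
      ereal (joint_ent (A \<union> shift s ` A))" if s: "s \<in> S" for s
  proof -
    have sc: "s \<in> carrier G" using s S by auto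
    \<comment> \<open>A Boolean index presents the two partitions as one family of fibres, to which
      \<open>common_refinement_fibres\<close> applies.\<close>
    let ?F = "\<lambda>b. if b then (\<lambda>x. joint A (\<phi> (inv s) x)) else joint A"
    have "{translate_partition \<phi> s (fibres M (joint A)), fibres M (joint A)} = (\<lambda>b. fibres M (?F b)) ` UNIV"
      using translate_fibres[OF sc, of "joint A"] by (simp add: UNIV_bool insert_commute)
    then have "common_refinement {translate_partition \<phi> s (fibres M (joint A)), fibres M (joint A)} =
        fibres M (\<lambda>x. restrict (\<lambda>b. ?F b x) UNIV)"
      using common_refinement_fibres[of UNIV M ?F] by simp
    also have "\<dots> = fibres M (joint (A \<union> shift s ` A))"
      by (rule fibres_cong) (auto simp: joint_eq_iff restrict_eq_iff ball_Un split: if_splits)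
    finally have "common_refinement {translate_partition \<phi> s (fibres M (joint A)), fibres M (joint A)} =
        fibres M (joint (A \<union> shift s ` A))" .
    moreover have "finite_ent (joint (A \<union> shift s ` A))"
      using A sc shift_in_rvs by (intro finite_ent_joint) auto
    ultimately show ?thesis by (simp add: shannon_entropy_finite_ent joint_ent_def)
  qed
  then have "F_entropy M \<phi> S (fibres M (joint A)) =
      ereal ((1 - 2 * real (card S)) * joint_ent A + (\<Sum>s\<in>S. joint_ent (A \<union> shift s ` A)))"
    using fA by (simp add: F_entropy_def shannon_entropy_finite_ent joint_ent_def)
  also have "(\<Sum>s\<in>S. joint_ent (A \<union> shift s ` A)) =
      (\<Sum>s\<in>S. 2 * joint_ent A - mi A (shift s ` A))"
    using A S by (intro sum.cong) (auto simp: mi_def h_invariant subset_iff)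
  finally show ?thesis by (simp add: sum_subtractf algebra_simps)
qed

end

section \<open>Continuity of conditional entropy, and sigma-algebras generated by
  observables\<close>

section \<open>Approximation by finitely many random variables\<close>

text \<open>The cost of splitting a mass \<open>p + q\<close>. By \<open>ln t \<le> t - 1\<close>
  the share of \<open>p\<close> is at most \<open>q\<close>, and at \<open>t = 1 / sqrt q\<close>
  the same bound gives \<open>- q * ln q \<le> 2 * sqrt q\<close>. The term
  \<open>q * ln (p + q)\<close> is not positive, and \<open>q \<le> sqrt q\<close>.\<close>

lemma entropy_split_le:
  fixes p q :: real
  assumes "0 \<le> p" "0 \<le> q" "p + q \<le> 1"
  shows "- p * ln p - q * ln q + (p + q) * ln (p + q) \<le> 3 * sqrt q"
proof (cases "p = 0 \<or> q = 0")
  case True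
  then show ?thesis using assms by auto
next
  case False
  then have pos: "0 < p" "0 < q" using assms by auto
  have "ln ((p + q) / p) \<le> (p + q) / p - 1" using pos by (intro ln_le_minus_one) simp
  then have "p * ln ((p + q) / p) \<le> p * ((p + q) / p - 1)"
    using pos by (intro mult_left_mono) auto
  then have 1: "p * ln (p + q) - p * ln p \<le> q" using pos by (simp add: ln_div field_simps)
  have "ln (1 / sqrt q) \<le> 1 / sqrt q - 1" using pos by (intro ln_le_minus_one) simp
  then have "q * (2 * ln (1 / sqrt q)) \<le> q * (2 * (1 / sqrt q))"
    using pos by (intro mult_left_mono) auto
  moreover have "q * (2 * (1 / sqrt q)) = 2 * sqrt q"
  proof -
    have "q * (2 * (1 / sqrt q)) = 2 * (q / sqrt q)" by simp
    also have "q / sqrt q = sqrt q" using pos by (intro real_div_sqrt) simp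
    finally show ?thesis .
  qed
  moreover have "q * (2 * ln (1 / sqrt q)) = - q * ln q" using pos by (simp add: ln_div ln_sqrt)
  ultimately have 2: "- q * ln q \<le> 2 * sqrt q" by linarith
  have 3: "q * ln (p + q) \<le> 0" using pos assms by (simp add: mult_nonneg_nonpos)
  have "q * 1 \<le> sqrt q" using assms pos by (intro real_le_rsqrt) (simp add: power2_eq_square mult_left_le)
  then show ?thesis using 1 2 3 by (simp add: algebra_simps)
qed

context prob_space
begin

lemma ent_finite_range:
  assumes "finite V" "f ` space M \<subseteq> V" "discrete_rv M f"
  shows "finite_ent f" "ent f = (\<Sum>v\<in>V. - prob {x \<in> space M. f x = v} * ln (prob {x \<in> space M. f x = v}))"
proof -
  let ?A = "\<lambda>v. {x \<in> space M. f x = v}"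
  note A = discrete_rv_sets[OF assms(3)]
  have info: "info f x = (\<Sum>v\<in>V. - ln (prob (?A v)) * indicator (?A v) x)" if "x \<in> space M" for x
  proof -
    have "(\<Sum>v\<in>V. - ln (prob (?A v)) * indicator (?A v) x) =
        (\<Sum>v\<in>V. if v = f x then - ln (prob (?A v)) else 0)"
      using that by (intro sum.cong) (auto simp: indicator_def)
    also have "\<dots> = info f x" using that assms by (auto simp: info_def pmass_def)
    finally show ?thesis by simp
  qed
  have "integrable M (\<lambda>x. \<Sum>v\<in>V. - ln (prob (?A v)) * indicator (?A v) x)"
    using A by (intro Bochner_Integration.integrable_sum integrable_mult_right)
      (auto simp: emeasure_eq_measure)
  then have "integrable M (info f)"
    using info by (subst Bochner_Integration.integrable_cong[OF refl]) auto
  then show "finite_ent f" using assms(3) by (simp add: finite_ent_def)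
  have "ent f = (\<integral>x. (\<Sum>v\<in>V. - ln (prob (?A v)) * indicator (?A v) x) \<partial>M)"
    unfolding ent_def using info by (intro Bochner_Integration.integral_cong) auto
  also have "\<dots> = (\<Sum>v\<in>V. \<integral>x. - ln (prob (?A v)) * indicator (?A v) x \<partial>M)"
    using A by (intro Bochner_Integration.integral_sum integrable_mult_right) (auto simp: emeasure_eq_measure)
  also have "\<dots> = (\<Sum>v\<in>V. - prob (?A v) * ln (prob (?A v)))"
    using A by (intro sum.cong) (auto simp: mult.commute)
  finally show "ent f = (\<Sum>v\<in>V. - prob (?A v) * ln (prob (?A v)))" .
qed

lemma discrete_rv_mem: "E \<in> sets M \<Longrightarrow> discrete_rv M (\<lambda>x. x \<in> E)"
proof -
  assume E: "E \<in> sets M"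
  have "{x \<in> space M. (x \<in> E) = b} = (if b then E else space M - E)" for b
    using sets.sets_into_space[OF E] by auto
  then show ?thesis using E by (simp add: discrete_rv_def)
qed

text \<open>\<open>E\<close> splits \<open>F\<close> and its complement, and each split has one
  piece inside the symmetric difference. By \<open>entropy_split_le\<close> each contributes at most
  \<open>3 * sqrt\<close> of the mass of this piece.\<close>

lemma ent_mem_pair_le:
  assumes E: "E \<in> sets M" and F: "F \<in> sets M"
  shows "ent (\<lambda>x. (x \<in> E, x \<in> F)) - ent (\<lambda>x. x \<in> F) \<le> 6 * sqrt (prob (sym_diff E F))"
proof -
  let ?p = "\<lambda>a b. prob {x \<in> space M. (x \<in> E) = a \<and> (x \<in> F) = b}"
  let ?\<eta> = "\<lambda>p :: real. - p * ln p"
  have S: "{x \<in> space M. (x \<in> E) = a \<and> (x \<in> F) = b} \<in> sets M" for a b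
  proof -
    have "{x \<in> space M. (x \<in> E) = a \<and> (x \<in> F) = b} =
        (if a then E else space M - E) \<inter> (if b then F else space M - F)"
      using sets.sets_into_space[OF E] by auto
    then show ?thesis using E F by simp
  qed
  have "ent (\<lambda>x. (x \<in> E, x \<in> F)) = (\<Sum>v\<in>UNIV \<times> UNIV. ?\<eta> (prob {x \<in> space M. (x \<in> E, x \<in> F) = v}))"
    by (rule ent_finite_range(2)[OF _ _ discrete_rv_Pair[OF discrete_rv_mem[OF E] discrete_rv_mem[OF F]]]) auto
  also have "\<dots> = ?\<eta> (?p True True) + ?\<eta> (?p True False) + ?\<eta> (?p False True) + ?\<eta> (?p False False)"
    unfolding sum.cartesian_product[symmetric] by (simp add: UNIV_bool)
  finally have 1: "ent (\<lambda>x. (x \<in> E, x \<in> F)) =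
      ?\<eta> (?p True True) + ?\<eta> (?p True False) + ?\<eta> (?p False True) + ?\<eta> (?p False False)" .
  have "ent (\<lambda>x. x \<in> F) = (\<Sum>v\<in>UNIV. ?\<eta> (prob {x \<in> space M. (x \<in> F) = v}))"
    by (rule ent_finite_range(2)) (auto intro: discrete_rv_mem F)
  also have "\<dots> = ?\<eta> (prob {x \<in> space M. (x \<in> F) = True}) + ?\<eta> (prob {x \<in> space M. (x \<in> F) = False})"
    by (simp add: UNIV_bool)
  finally have 2: "ent (\<lambda>x. x \<in> F) =
      ?\<eta> (prob {x \<in> space M. (x \<in> F) = True}) + ?\<eta> (prob {x \<in> space M. (x \<in> F) = False})" .
  have sum: "prob {x \<in> space M. (x \<in> F) = b} = ?p True b + ?p False b" for b
  proof -
    have "{x \<in> space M. (x \<in> F) = b} = {x \<in> space M. (x \<in> E) = True \<and> (x \<in> F) = b} \<union>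
        {x \<in> space M. (x \<in> E) = False \<and> (x \<in> F) = b}" by auto
    moreover have "prob ({x \<in> space M. (x \<in> E) = True \<and> (x \<in> F) = b} \<union>
        {x \<in> space M. (x \<in> E) = False \<and> (x \<in> F) = b}) = ?p True b + ?p False b"
      by (intro finite_measure_Union S) auto
    ultimately show ?thesis by (simp only:)
  qed
  have le1: "?p True b + ?p False b \<le> 1" for b unfolding sum[symmetric] by simp
  have D: "sym_diff E F \<in> sets M" using E F by auto
  have "?p True False \<le> prob (sym_diff E F)" "?p False True \<le> prob (sym_diff E F)"
    using D by (auto intro!: finite_measure_mono)
  then have "sqrt (?p True False) \<le> sqrt (prob (sym_diff E F))"
    "sqrt (?p False True) \<le> sqrt (prob (sym_diff E F))" by auto
  moreover have "?\<eta> (?p True True) + ?\<eta> (?p False True) - ?\<eta> (?p True True + ?p False True) \<le> 3 * sqrt (?p False True)"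
    using entropy_split_le[of "?p True True" "?p False True"] le1[of True] by (simp add: algebra_simps)
  moreover have "?\<eta> (?p False False) + ?\<eta> (?p True False) - ?\<eta> (?p True False + ?p False False) \<le> 3 * sqrt (?p True False)"
    using entropy_split_le[of "?p False False" "?p True False"] le1[of False]
    by (simp add: algebra_simps)
  ultimately show ?thesis unfolding 1 2 sum by linarith
qed

definition depends_on :: "('a \<Rightarrow> 'c) set \<Rightarrow> 'a set \<Rightarrow> bool" where
  "depends_on B E \<longleftrightarrow> E \<in> sets M \<and>
     (\<forall>x\<in>space M. \<forall>y\<in>space M. joint B x = joint B y \<longrightarrow> (x \<in> E \<longleftrightarrow> y \<in> E))"

text \<open>Finite dependence is closed under complements and finite unions. A countable union is
  truncated by continuity of the measure, and the remaining error is shared among its finitely many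
  members.\<close>

lemma sigma_sets_approximation:
  assumes U: "\<And>f. f \<in> U \<Longrightarrow> discrete_rv M f"
    and E: "E \<in> sigma_sets (space M) (\<Union>f\<in>U. fibres M f)"
  shows "E \<in> sets M \<and> (\<forall>\<epsilon>>0. \<exists>B E'. finite B \<and> B \<subseteq> U \<and> depends_on B E' \<and> prob (sym_diff E E') < \<epsilon>)"
  using E
proof induction
  case (Basic A)
  then obtain f x where f: "f \<in> U" "x \<in> space M" "A = {y \<in> space M. f y = f x}"
    by (auto simp: fibres_alt)
  have A: "A \<in> sets M" using discrete_rv_sets[OF U[OF f(1)]] f(3) by simp
  then have "depends_on {f} A" using f by (auto simp: depends_on_def joint_eq_iff)
  then show ?case using A f by (auto intro!: exI[of _ "{f}"] exI[of _ A])
next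
  case Empty
  then show ?case by (auto simp: depends_on_def intro!: exI[of _ "{}"] exI[of _ "{}"])
next
  case (Compl A)
  show ?case
  proof (intro conjI allI impI)
    show "space M - A \<in> sets M" using Compl by auto
    fix \<epsilon> :: real assume \<epsilon>: "0 < \<epsilon>"
    have "\<exists>B E'. finite B \<and> B \<subseteq> U \<and> depends_on B E' \<and> prob (sym_diff A E') < \<epsilon>"
      using Compl.IH \<epsilon> by simp
    then obtain B E' where B: "finite B" "B \<subseteq> U" "depends_on B E'" "prob (sym_diff A E') < \<epsilon>"
      by metis
    have "depends_on B (space M - E')"
      using B(3) unfolding depends_on_def by (intro conjI sets.compl_sets) blast+
    moreover have "sym_diff (space M - A) (space M - E') = sym_diff A E'"
    proof -
      have "A \<subseteq> space M" "E' \<subseteq> space M"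
        using Compl.IH B(3) sets.sets_into_space[of _ M] unfolding depends_on_def by simp_all
      then show ?thesis by blast
    qed
    ultimately show "\<exists>B E'. finite B \<and> B \<subseteq> U \<and> depends_on B E' \<and> prob (sym_diff (space M - A) E') < \<epsilon>"
      using B by (intro exI[of _ B] exI[of _ "space M - E'"]) simp
  qed
next
  case (Union A)
  have A: "A i \<in> sets M" for i using Union.IH by auto
  show ?case
  proof (intro conjI allI impI)
    show "\<Union> (range A) \<in> sets M" using A by auto
    fix \<epsilon> :: real assume \<epsilon>: "0 < \<epsilon>"
    have "incseq (\<lambda>n. \<Union>i<n. A i)"
      unfolding incseq_def by (intro allI impI UN_mono) auto
    then have "(\<lambda>n. prob (\<Union>i<n. A i)) \<longlonglongrightarrow> prob (\<Union>n. \<Union>i<n. A i)"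
      using A by (intro finite_Lim_measure_incseq) auto
    moreover have "(\<Union>n. \<Union>i<n. A i) = \<Union> (range A)" by auto
    ultimately have "(\<lambda>n. prob (\<Union>i<n. A i)) \<longlonglongrightarrow> prob (\<Union> (range A))" by simp
    then obtain n where n: "\<bar>prob (\<Union>i<n. A i) - prob (\<Union> (range A))\<bar> < \<epsilon> / 2"
      using LIMSEQ_D[of _ _ "\<epsilon> / 2"] \<epsilon> by fastforce
    have "prob (\<Union> (range A) - (\<Union>i<n. A i)) = prob (\<Union> (range A)) - prob (\<Union>i<n. A i)"
      using A by (intro finite_measure_Diff) auto
    with abs_less_iff[THEN iffD1, OF n]
    have tail: "prob (\<Union> (range A) - (\<Union>i<n. A i)) < \<epsilon> / 2" by linarith
    define \<delta> where "\<delta> = \<epsilon> / (2 * (real n + 1))"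
    have \<delta>: "0 < \<delta>" "real n * \<delta> \<le> \<epsilon> / 2" using \<epsilon> by (auto simp: \<delta>_def field_simps)
    have "\<forall>i. \<exists>B E'. finite B \<and> B \<subseteq> U \<and> depends_on B E' \<and> prob (sym_diff (A i) E') < \<delta>"
    proof
      fix i
      show "\<exists>B E'. finite B \<and> B \<subseteq> U \<and> depends_on B E' \<and> prob (sym_diff (A i) E') < \<delta>"
        using Union.IH[of i] \<delta>(1) by simp
    qed
    then obtain B E' where BE: "\<And>i. finite (B i)" "\<And>i. B i \<subseteq> U" "\<And>i. depends_on (B i) (E' i)"
      "\<And>i. prob (sym_diff (A i) (E' i)) < \<delta>" by metis
    have E'[measurable]: "E' i \<in> sets M" for i using BE(3) by (simp add: depends_on_def)
    let ?E = "\<Union>i<n. E' i" and ?B = "\<Union>i<n. B i"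
    have "x \<in> ?E \<longleftrightarrow> y \<in> ?E"
      if xy: "x \<in> space M" "y \<in> space M" "joint ?B x = joint ?B y" for x y
    proof -
      have "x \<in> E' i \<longleftrightarrow> y \<in> E' i" if "i < n" for i
      proof -
        have "joint (B i) x = joint (B i) y" using xy(3) that unfolding joint_eq_iff by blast
        then show ?thesis using BE(3)[of i] xy(1,2) unfolding depends_on_def by blast
      qed
      then show ?thesis by blast
    qed
    moreover have "?E \<in> sets M" by auto
    ultimately have "depends_on ?B ?E" unfolding depends_on_def by blast
    moreover have "prob (sym_diff (\<Union> (range A)) ?E) < \<epsilon>"
    proof -
      have "prob (sym_diff (\<Union> (range A)) ?E) \<le>
          prob ((\<Union> (range A) - (\<Union>i<n. A i)) \<union> (\<Union>i<n. sym_diff (A i) (E' i)))"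
        using A by (intro finite_measure_mono) (auto intro!: sets.Un sets.Diff sets.finite_UN)
      also have "\<dots> \<le> prob (\<Union> (range A) - (\<Union>i<n. A i)) + prob (\<Union>i<n. sym_diff (A i) (E' i))"
        using A by (intro measure_Un_le) (auto intro!: sets.Un sets.Diff sets.finite_UN)
      also have "prob (\<Union>i<n. sym_diff (A i) (E' i)) \<le> (\<Sum>i<n. prob (sym_diff (A i) (E' i)))"
        using A by (intro measure_UNION_le) (auto intro!: sets.Un sets.Diff)
      also have "\<dots> \<le> (\<Sum>i<n. \<delta>)" using BE(4) by (intro sum_mono less_imp_le) auto
      finally show ?thesis using tail \<delta>(2) by simp
    qed
    moreover have "finite ?B" "?B \<subseteq> U" using BE by auto
    ultimately show "\<exists>B E'. finite B \<and> B \<subseteq> U \<and> depends_on B E' \<and> prob (sym_diff (\<Union> (range A)) E') < \<epsilon>"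
      by blast
  qed
qed

text \<open>An indicator with values in \<open>'a set\<close>, so that it has the type of
  \<open>cell_of\<close> and belongs to the same polymatroid.\<close>

definition mem_rv :: "'a set \<Rightarrow> 'a \<Rightarrow> 'a set" where
  "mem_rv E = restrict (\<lambda>x. if x \<in> E then UNIV else {}) (space M)"

lemma mem_rv_eq_iff: "x \<in> space M \<Longrightarrow> y \<in> space M \<Longrightarrow> mem_rv E x = mem_rv E y \<longleftrightarrow> (x \<in> E \<longleftrightarrow> y \<in> E)"
  by (auto simp: mem_rv_def)

lemma mem_rv_in_rvs:
  assumes "E \<in> sets M" shows "mem_rv E \<in> rvs"
proof -
  have d: "discrete_rv M (\<lambda>x. if x \<in> E then UNIV else {} :: 'a set)"
    using discrete_rv_comp[OF discrete_rv_mem[OF assms], of "\<lambda>b. if b then UNIV else {}"] .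
  then have "finite_ent (\<lambda>x. if x \<in> E then UNIV else {} :: 'a set)"
    by (rule ent_finite_range(1)[of "{UNIV, {}}", rotated 2]) auto
  then have "finite_ent (mem_rv E)" by (rule finite_ent_cong) (auto simp: mem_rv_def)
  then show ?thesis by (auto simp: rvs_def mem_rv_def)
qed

text \<open>Up to small measure \<open>E\<close> is an event \<open>E'\<close> read off finitely
  many observables. Conditioning on these is at least conditioning on \<open>E'\<close>, where
  \<open>ent_mem_pair_le\<close> applies.\<close>

lemma determined_by_mem_rv:
  fixes U :: "('a \<Rightarrow> 'a set) set"
  assumes U: "U \<subseteq> rvs" and E: "E \<in> sets M"
    and C: "C \<in> sigma_sets (space M) (\<Union>f\<in>U. fibres M f)" "sym_diff E C \<in> null_sets M"
  shows "polymatroid.determined_by joint_ent U (mem_rv E)"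
proof -
  interpret polymatroid "rvs :: ('a \<Rightarrow> 'a set) set" joint_ent by (rule polymatroid_joint_ent)
  show ?thesis unfolding determined_by_def
  proof (intro allI impI)
    fix \<epsilon> :: real assume \<epsilon>: "0 < \<epsilon>"
    \<comment> \<open>The square compensates the bound \<open>6 * sqrt\<close> of
      \<open>ent_mem_pair_le\<close>.\<close>
    have "0 < (\<epsilon> / 6)\<^sup>2" using \<epsilon> by simp
    then obtain B E' where B: "finite B" "B \<subseteq> U" "depends_on B E'" "prob (sym_diff C E') < (\<epsilon> / 6)\<^sup>2"
      and Cs: "C \<in> sets M"
      using sigma_sets_approximation[OF _ C(1)] U unfolding rvs_def finite_ent_def by blast
    have E': "E' \<in> sets M" using B(3) by (simp add: depends_on_def)
    have "prob (sym_diff E E') \<le> prob (sym_diff E C \<union> sym_diff C E')"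
      using E E' Cs by (intro finite_measure_mono) auto
    also have "\<dots> \<le> prob (sym_diff E C) + prob (sym_diff C E')"
      using E E' Cs by (intro measure_Un_le) auto
    also have "prob (sym_diff E C) = 0" using C(2) by (simp add: null_sets_def measure_def)
    finally have "prob (sym_diff E E') < (\<epsilon> / 6)\<^sup>2" using B(4) by simp
    then have "sqrt (prob (sym_diff E E')) < sqrt ((\<epsilon> / 6)\<^sup>2)" by (rule real_sqrt_less_mono)
    also have "\<dots> = \<epsilon> / 6" using \<epsilon> by (intro real_sqrt_unique) auto
    finally have small: "6 * sqrt (prob (sym_diff E E')) < \<epsilon>" by simp
    let ?f = "\<lambda>x. x \<in> E" and ?k = "\<lambda>x. x \<in> E'"
    have BU: "B \<subseteq> rvs" using B U by auto
    have fB: "finite_ent (joint B)" by (rule finite_ent_joint[OF B(1) BU])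
    have d: "discrete_rv M ?f" "discrete_rv M (joint B)" "discrete_rv M ?k"
      using discrete_rv_mem E E' fB by (auto simp: finite_ent_def)
    have k: "?k x = ?k y" if "x \<in> space M" "y \<in> space M" "joint B x = joint B y" for x y
      using B(3) that unfolding depends_on_def by blast
    have "finite_ent (\<lambda>x. (?f x, ?k x))"
      by (rule ent_finite_range(1)[of UNIV, OF _ _ discrete_rv_Pair[OF d(1,3)]]) auto
    moreover have "finite_ent (\<lambda>x. (joint B x, ?k x))"
    proof (rule finite_ent_mono(1)[OF discrete_rv_Pair[OF d(2,3)] fB])
      fix x y assume "x \<in> space M" "y \<in> space M" "joint B x = joint B y"
      then show "(joint B x, ?k x) = (joint B y, ?k y)" using k[of x y] by simp
    qed
    ultimately have "ent (\<lambda>x. (?f x, joint B x, ?k x)) + ent ?k \<le>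
        ent (\<lambda>x. (?f x, ?k x)) + ent (\<lambda>x. (joint B x, ?k x))"
      by (rule ent_submodular(2)[OF d])
    moreover have "ent (\<lambda>x. (?f x, joint B x, ?k x)) = joint_ent (insert (mem_rv E) B)"
    proof -
      have "(joint (insert (mem_rv E) B) x = joint (insert (mem_rv E) B) y) =
          ((?f x, joint B x, ?k x) = (?f y, joint B y, ?k y))"
        if "x \<in> space M" "y \<in> space M" for x y
      proof -
        have "joint (insert (mem_rv E) B) x = joint (insert (mem_rv E) B) y \<longleftrightarrow>
            ?f x = ?f y \<and> joint B x = joint B y"
          unfolding joint_eq_iff by (simp add: mem_rv_eq_iff[OF that])
        then show ?thesis using k[OF that] by auto
      qed
      then show ?thesis unfolding joint_ent_def by (rule ent_cong)
    qed
    moreover have "ent (\<lambda>x. (joint B x, ?k x)) = joint_ent B"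
    proof -
      have "(joint B x = joint B y) = ((joint B x, ?k x) = (joint B y, ?k y))"
        if "x \<in> space M" "y \<in> space M" for x y
        using k[OF that] by auto
      then show ?thesis unfolding joint_ent_def by (rule ent_cong)
    qed
    ultimately have "joint_ent (insert (mem_rv E) B) - joint_ent B \<le> 6 * sqrt (prob (sym_diff E E'))"
      using ent_mem_pair_le[OF E E'] by simp
    then show "\<exists>B. finite B \<and> B \<subseteq> U \<and> joint_ent (insert (mem_rv E) B) - joint_ent B < \<epsilon>"
      using B small by (intro exI[of _ B]) auto
  qed
qed

text \<open>Where \<open>f\<close> takes a value in \<open>N\<close>, the indicators determine it.
  The conditional entropy is thus at most the information of \<open>f\<close> integrated over the
  other points, a tail that vanishes by dominated convergence.\<close>

lemma finitely_many_values_suffice: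
  fixes f :: "'a \<Rightarrow> 'a set"
  assumes f: "f \<in> rvs" and \<epsilon>: "0 < \<epsilon>"
  shows "\<exists>N. finite N \<and> joint_ent (insert f ((\<lambda>v. mem_rv {x \<in> space M. f x = v}) ` N)) -
    joint_ent ((\<lambda>v. mem_rv {x \<in> space M. f x = v}) ` N) < \<epsilon>"
proof -
  let ?Z = "\<lambda>N. (\<lambda>v. mem_rv {x \<in> space M. f x = v}) ` N"
  let ?N = "\<lambda>n. from_nat_into (f ` space M) ` {..<n}"
  have fe: "finite_ent f" "discrete_rv M f" "integrable M (info f)"
    using f by (auto simp: rvs_def finite_ent_def)
  have Zr: "?Z N \<subseteq> rvs" for N using mem_rv_in_rvs discrete_rv_sets[OF fe(2)] by auto
  have joint: "joint (?Z N) x = joint (?Z N) y \<longleftrightarrow> (\<forall>v\<in>N. f x = v \<longleftrightarrow> f y = v)"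
    if "x \<in> space M" "y \<in> space M" for x y N
    using that by (auto simp: joint_eq_iff mem_rv_eq_iff)
  have le: "joint_ent (insert f (?Z N)) - joint_ent (?Z N) \<le>
      (\<integral>x. info f x * indicator {x \<in> space M. f x \<notin> N} x \<partial>M)" if N: "finite N" for N
  proof -
    have Ze: "finite_ent (joint (?Z N))" using N Zr by (intro finite_ent_joint) auto
    then have Zi: "integrable M (info (joint (?Z N)))" by (simp add: finite_ent_def)
    have NS: "{x \<in> space M. f x \<notin> N} \<in> sets M"
      using measurable_sets[OF discrete_rv_measurable[OF fe(2)], of "- N"]
      by (simp add: vimage_def Int_def conj_commute)
    have "joint_ent (insert f (?Z N)) = ent f"
      unfolding joint_ent_def by (rule ent_cong) (auto simp: joint_eq_iff mem_rv_eq_iff)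
    then have "joint_ent (insert f (?Z N)) - joint_ent (?Z N) = (\<integral>x. info f x - info (joint (?Z N)) x \<partial>M)"
      using fe Zi by (simp add: joint_ent_def ent_def)
    also have "\<dots> \<le> (\<integral>x. info f x * indicator {x \<in> space M. f x \<notin> N} x \<partial>M)"
    proof (rule integral_mono)
      show "integrable M (\<lambda>x. info f x - info (joint (?Z N)) x)" using fe Zi by simp
      show "integrable M (\<lambda>x. info f x * indicator {x \<in> space M. f x \<notin> N} x)"
        using fe NS by (intro integrable_real_mult_indicator)
      fix x assume x: "x \<in> space M"
      show "info f x - info (joint (?Z N)) x \<le> info f x * indicator {x \<in> space M. f x \<notin> N} x"
      proof (cases "f x \<in> N")
        case True
        have "joint (?Z N) y = joint (?Z N) x \<longleftrightarrow> f y = f x" if "y \<in> space M" for y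
          unfolding joint[OF that x] using True by metis
        then have "{y \<in> space M. joint (?Z N) y = joint (?Z N) x} = {y \<in> space M. f y = f x}"
          by (intro Collect_cong conj_cong refl)
        then show ?thesis using True by (simp add: info_def pmass_def)
      next
        case False
        then show ?thesis using x info_nonneg[of "joint (?Z N)" x] by simp
      qed
    qed
    finally show ?thesis .
  qed
  have NS: "{x \<in> space M. f x \<notin> N} \<in> sets M" for N
    using measurable_sets[OF discrete_rv_measurable[OF fe(2)], of "- N"]
    by (simp add: vimage_def Int_def conj_commute)
  have "(\<lambda>n. \<integral>x. info f x * indicator {x \<in> space M. f x \<notin> ?N n} x \<partial>M) \<longlonglongrightarrow> (\<integral>x. 0 \<partial>M)"
  proof (rule integral_dominated_convergence[where w = "info f"])
    show "AE x in M. (\<lambda>n. info f x * indicator {x \<in> space M. f x \<notin> ?N n} x) \<longlonglongrightarrow> 0"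
    proof (rule AE_I2)
      fix x assume x: "x \<in> space M"
      have "f x \<in> f ` space M" using x by simp
      moreover have "countable (f ` space M)" using fe(2) by (simp add: discrete_rv_def)
      ultimately obtain m where m: "f x = from_nat_into (f ` space M) m"
        using from_nat_into_surj by metis
      have "eventually (\<lambda>n. info f x * indicator {x \<in> space M. f x \<notin> ?N n} x = 0) sequentially"
        using eventually_gt_at_top[of m] by eventually_elim (auto simp: m)
      then show "(\<lambda>n. info f x * indicator {x \<in> space M. f x \<notin> ?N n} x) \<longlonglongrightarrow> 0"
        by (rule tendsto_eventually)
    qed
    show "\<And>n. AE x in M. norm (info f x * indicator {x \<in> space M. f x \<notin> ?N n} x) \<le> info f x"
      using info_nonneg[of f] by (auto simp: indicator_def)
    show "(\<lambda>x. info f x * indicator {x \<in> space M. f x \<notin> ?N n} x) \<in> borel_measurable M" for n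
      using NS info_measurable[OF fe(2)] by measurable
  qed (use fe in auto)
  then have "eventually (\<lambda>n. (\<integral>x. info f x * indicator {x \<in> space M. f x \<notin> ?N n} x \<partial>M) < \<epsilon>) sequentially"
    using \<epsilon> by (intro order_tendstoD(2)) auto
  then obtain n where "(\<integral>x. info f x * indicator {x \<in> space M. f x \<notin> ?N n} x \<partial>M) < \<epsilon>"
    by (auto simp: eventually_sequentially)
  then have "joint_ent (insert f (?Z (?N n))) - joint_ent (?Z (?N n)) < \<epsilon>"
    using le[of "?N n"] by simp
  then show ?thesis by (intro exI[of _ "?N n"]) simp
qed

text \<open>\<open>f\<close> is replaced by the indicators of finitely many of its values, which
  \<open>U\<close> determines because it generates; the two errors of \<open>\<epsilon> / 2\<close>
  add up.\<close>

theorem determined_by_generating: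
  fixes U :: "('a \<Rightarrow> 'a set) set"
  assumes U: "U \<subseteq> rvs" and f: "f \<in> rvs"
    and gen: "\<And>E. E \<in> sets M \<Longrightarrow>
      \<exists>C\<in>sigma_sets (space M) (\<Union>f\<in>U. fibres M f). sym_diff E C \<in> null_sets M"
  shows "polymatroid.determined_by joint_ent U f"
proof -
  interpret polymatroid "rvs :: ('a \<Rightarrow> 'a set) set" joint_ent by (rule polymatroid_joint_ent)
  have fd: "discrete_rv M f" using f by (simp add: rvs_def finite_ent_def)
  show ?thesis unfolding determined_by_def
  proof (intro allI impI)
    fix \<epsilon> :: real assume \<epsilon>: "0 < \<epsilon>"
    then obtain N where N: "finite N" and N\<epsilon>: "joint_ent (insert f ((\<lambda>v. mem_rv {x \<in> space M. f x = v}) ` N)) -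
        joint_ent ((\<lambda>v. mem_rv {x \<in> space M. f x = v}) ` N) < \<epsilon> / 2"
      using finitely_many_values_suffice[OF f, of "\<epsilon> / 2"] by auto
    define Z where "Z = (\<lambda>v. mem_rv {x \<in> space M. f x = v}) ` N"
    have Z: "finite Z" "Z \<subseteq> rvs" "joint_ent (insert f Z) - joint_ent Z < \<epsilon> / 2"
      using N N\<epsilon> mem_rv_in_rvs discrete_rv_sets[OF fd] by (auto simp: Z_def)
    have "determined_by U z" if "z \<in> Z" for z
    proof -
      obtain v where z: "z = mem_rv {x \<in> space M. f x = v}" using \<open>z \<in> Z\<close> unfolding Z_def by blast
      obtain C where "C \<in> sigma_sets (space M) (\<Union>f\<in>U. fibres M f)"
        "sym_diff {x \<in> space M. f x = v} C \<in> null_sets M"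
        using gen[OF discrete_rv_sets[OF fd]] by blast
      then show ?thesis unfolding z by (intro determined_by_mem_rv[OF U discrete_rv_sets[OF fd]])
    qed
    then obtain B where B: "finite B" "B \<subseteq> U"
      "\<And>B'. fin B' \<Longrightarrow> B \<subseteq> B' \<Longrightarrow> joint_ent (Z \<union> B') - joint_ent B' < \<epsilon> / 2"
      using determined_by_finite[OF Z(1,2) U, of "\<epsilon> / 2"] \<epsilon> by auto
    have BU: "fin B" using B U by auto
    have "joint_ent ({f} \<union> (Z \<union> B)) - joint_ent (Z \<union> B) \<le> joint_ent ({f} \<union> Z) - joint_ent Z"
      using Z BU f by (intro increment_antimono) auto
    moreover have "joint_ent (insert f B) \<le> joint_ent ({f} \<union> (Z \<union> B))"
      using Z BU f by (intro h_mono) auto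
    ultimately have "joint_ent (insert f B) - joint_ent B < \<epsilon>"
      using Z(3) B(3)[OF BU order_refl] by simp
    then show "\<exists>B. finite B \<and> B \<subseteq> U \<and> joint_ent (insert f B) - joint_ent B < \<epsilon>"
      using B by blast
  qed
qed

end

section \<open>Generating partitions determine all observables of finite entropy\<close>

context pmp_system
begin

lemma image_fibre_shift:
  assumes "g \<in> carrier G" "A \<in> fibres M f" shows "\<phi> g ` A \<in> fibres M (shift g f)"
proof -
  have "\<phi> g ` A \<in> translate_partition \<phi> g (fibres M f)"
    using assms by (auto simp: translate_partition_def)
  also have "\<dots> = fibres M (shift g f)"
    unfolding translate_fibres[OF assms(1)] by (rule fibres_cong) simp
  finally show ?thesis .
qed

text \<open>Translation by \<open>g\<close> takes generating fibres to generating fibres, as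
  \<open>shift g (shift y z) = shift (g \<otimes> y) z\<close>. Bijectivity on
  \<open>space M\<close> carries this through complements.\<close>

lemma sigma_sets_shifts_invariant:
  assumes L: "subgroup L G" and z: "z \<in> rvs"
  shows "invariant_sigma_algebra (G\<lparr>carrier := L\<rparr>) M \<phi>
    (sigma_sets (space M) (\<Union>f\<in>(\<lambda>y. shift y z) ` L. fibres M f))"
  unfolding invariant_sigma_algebra_def
proof (intro conjI ballI)
  let ?F = "\<Union>f\<in>(\<lambda>y. shift y z) ` L. fibres M f"
  have LG: "L \<subseteq> carrier G" using subgroup.subset[OF L] .
  have sub: "?F \<subseteq> Pow (space M)" by (auto simp: fibres_alt)
  show "sigma_algebra (space M) (sigma_sets (space M) ?F)" by (rule sigma_algebra_sigma_sets[OF sub])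
  fix g A assume "g \<in> carrier (G\<lparr>carrier := L\<rparr>)" and A: "A \<in> sigma_sets (space M) ?F"
  then have g: "g \<in> L" "g \<in> carrier G" using LG by auto
  show "\<phi> g ` A \<in> sigma_sets (space M) ?F" using A
  proof induction
    case (Basic B)
    then obtain y where y: "y \<in> L" "B \<in> fibres M (shift y z)" by auto
    have yc: "y \<in> carrier G" using y LG by auto
    have "\<phi> g ` B \<in> fibres M (shift g (shift y z))" by (rule image_fibre_shift[OF g(2) y(2)])
    also have "shift g (shift y z) = shift (g \<otimes> y) z" using a_mult[OF g(2) yc z] by simp
    finally show ?case
      using subgroup.m_closed[OF L g(1) y(1)] by (intro sigma_sets.Basic) auto
  next
    case (Compl B)
    have B: "B \<subseteq> space M" using sigma_sets_into_sp[OF sub Compl.hyps] .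
    have "\<phi> g ` (space M - B) = space M - \<phi> g ` B"
    proof
      show "\<phi> g ` (space M - B) \<subseteq> space M - \<phi> g ` B"
      proof
        fix x assume "x \<in> \<phi> g ` (space M - B)"
        then obtain u where u: "u \<in> space M" "u \<notin> B" "x = \<phi> g u" by blast
        have "x \<notin> \<phi> g ` B"
        proof
          assume "x \<in> \<phi> g ` B"
          then obtain v where v: "v \<in> B" "x = \<phi> g v" by blast
          then have "\<phi> (inv g) (\<phi> g u) = \<phi> (inv g) (\<phi> g v)" using u by simp
          then show False using u v B g act_inv by auto
        qed
        then show "x \<in> space M - \<phi> g ` B" using u g act_space by auto
      qed
      show "space M - \<phi> g ` B \<subseteq> \<phi> g ` (space M - B)"
      proof
        fix x assume x: "x \<in> space M - \<phi> g ` B"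
        then have "x = \<phi> g (\<phi> (inv g) x)" "\<phi> (inv g) x \<in> space M"
          using g act_inv' act_space by auto
        then show "x \<in> \<phi> g ` (space M - B)" using x by blast
      qed
    qed
    then show ?case using sigma_sets.Compl[OF Compl.IH] by simp
  next
    case (Union B)
    then show ?case by (simp add: image_UN sigma_sets.Union)
  qed (simp add: sigma_sets.Empty)
qed

text \<open>The sigma-algebra generated by the translated cells is invariant and contains
  \<open>\<alpha>\<close>, so it contains the invariant hull and is dense up to null sets.\<close>

lemma generating_determines:
  assumes L: "subgroup L G" and gen: "finite_entropy_generating_partition (G\<lparr>carrier := L\<rparr>) M \<phi> \<alpha>"
    and f: "f \<in> rvs"
  shows "cell_of M \<alpha> \<in> rvs" "determined_by ((\<lambda>y. shift y (cell_of M \<alpha>)) ` L) f"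
proof -
  let ?z = "cell_of M \<alpha>"
  let ?F = "\<Union>f\<in>(\<lambda>y. shift y ?z) ` L. fibres M f"
  have \<alpha>: "countable_measurable_partition M \<alpha>" "shannon_entropy M \<alpha> < \<infinity>"
    and hull: "\<And>E. E \<in> sets M \<Longrightarrow>
      \<exists>C\<in>invariant_sigma_algebra (G\<lparr>carrier := L\<rparr>) M \<phi> hull \<alpha>. sym_diff E C \<in> null_sets M"
    using gen by (auto simp: finite_entropy_generating_partition_def generating_partition_def)
  show z: "?z \<in> rvs" by (rule cell_of_in_rvs[OF \<alpha>])
  have LG: "L \<subseteq> carrier G" using subgroup.subset[OF L] .
  have "shift \<one> ?z = ?z" using z by simp
  then have "\<alpha> \<subseteq> ?F"
    using fibres_cell_of[OF \<alpha>(1)] subgroup.one_closed[OF L] by (metis UN_upper image_eqI)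
  then have "\<alpha> \<subseteq> sigma_sets (space M) ?F" using sigma_sets.Basic by blast
  then have "invariant_sigma_algebra (G\<lparr>carrier := L\<rparr>) M \<phi> hull \<alpha> \<subseteq> sigma_sets (space M) ?F"
    by (rule hull_minimal) (rule sigma_sets_shifts_invariant[OF L z])
  then have "\<exists>C\<in>sigma_sets (space M) ?F. sym_diff E C \<in> null_sets M" if "E \<in> sets M" for E
    using hull[OF that] by blast
  moreover have "(\<lambda>y. shift y ?z) ` L \<subseteq> rvs" using z LG shift_in_rvs by auto
  ultimately show "determined_by ((\<lambda>y. shift y ?z) ` L) f"
    by (intro determined_by_generating f)
qed

end

section \<open>Index arithmetic, Schreier generators and finiteness of free bases\<close>

section \<open>Finite index subgroups\<close>

context group
begin

lemma Int_coset:
  assumes "subgroup L G" "subgroup K G" "x \<in> carrier G"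
  shows "(L \<inter> K) #> x = (L #> x) \<inter> (K #> x)"
proof -
  have LK: "subgroup (L \<inter> K) G" using subgroups_Inter_pair[OF assms(1,2)] .
  note sub = r_coset_subset_G[OF subgroup.subset[OF assms(1)] assms(3)]
    r_coset_subset_G[OF subgroup.subset[OF LK] assms(3)]
  have "y \<in> (L \<inter> K) #> x \<longleftrightarrow> y \<in> (L #> x) \<inter> (K #> x)" if "y \<in> carrier G" for y
    using subgroup.rcos_module[OF assms(1) is_group assms(3) that]
      subgroup.rcos_module[OF assms(2) is_group assms(3) that]
      subgroup.rcos_module[OF LK is_group assms(3) that] by simp
  then show ?thesis using sub by blast
qed

lemma finite_index_Int:
  assumes "finite_index_subgroup G L" "finite_index_subgroup G K"
  shows "finite_index_subgroup G (L \<inter> K)"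
proof -
  have L: "subgroup L G" "finite (rcosets L)" and K: "subgroup K G" "finite (rcosets K)"
    using assms by (auto simp: finite_index_subgroup_def)
  have "rcosets (L \<inter> K) \<subseteq> (\<lambda>(A, B). A \<inter> B) ` ((rcosets L) \<times> (rcosets K))"
    using Int_coset[OF L(1) K(1)] by (auto simp: RCOSETS_def)
  then have "finite (rcosets (L \<inter> K))" using L K by (auto intro: finite_subset)
  then show ?thesis
    using subgroups_Inter_pair[OF L(1) K(1)] by (simp add: finite_index_subgroup_def)
qed

lemma coset_representative:
  assumes "subgroup L G" "A \<in> rcosets L"
  shows "(SOME x. x \<in> A) \<in> A \<and> (SOME x. x \<in> A) \<in> carrier G \<and> L #> (SOME x. x \<in> A) = A"
proof -
  obtain x where x: "x \<in> carrier G" "A = L #> x" using assms(2) by (auto simp: RCOSETS_def)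
  have "x \<in> A" using rcos_self[OF x(1) assms(1)] x(2) by simp
  then have A: "(SOME x. x \<in> A) \<in> A" by (rule someI)
  moreover have "A \<subseteq> carrier G" using subgroup.rcosets_carrier[OF assms(1) is_group assms(2)] .
  moreover have "L #> (SOME x. x \<in> A) = A"
    using repr_independence[OF _ x(1) assms(1)] A x(2) by metis
  ultimately show ?thesis by blast
qed

text \<open>A coset of \<open>K\<close> is, in exactly one way, a coset of \<open>K\<close> inside
  \<open>L\<close> moved by the representative of a coset of \<open>L\<close>.\<close>

lemma index_mult:
  assumes L: "subgroup L G" and K: "subgroup K G" "K \<subseteq> L"
  shows "subgroup_index G K = subgroup_index G L * card ((#>) K ` L)"
proof -
  define \<rho> where "\<rho> A = (SOME x. x \<in> A)" for A :: "'a set"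
  have \<rho>: "\<rho> A \<in> A \<and> \<rho> A \<in> carrier G \<and> L #> \<rho> A = A" if "A \<in> rcosets L" for A
    unfolding \<rho>_def by (rule coset_representative[OF L that])
  have LG: "L \<subseteq> carrier G" and KG: "K \<subseteq> carrier G"
    using subgroup.subset[OF L] subgroup.subset[OF K(1)] by simp_all
  let ?f = "\<lambda>(A, \<kappa>). \<kappa> #> \<rho> A"
  have assoc: "K #> l #> \<rho> A = K #> (l \<otimes> \<rho> A)" if "A \<in> rcosets L" "l \<in> L" for A l
    using coset_mult_assoc[OF KG, of l "\<rho> A"] \<rho>[OF that(1)] that LG by auto
  have "bij_betw ?f ((rcosets L) \<times> (#>) K ` L) (rcosets K)"
    unfolding bij_betw_def
  proof
    show "inj_on ?f ((rcosets L) \<times> (#>) K ` L)"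
    proof (rule inj_onI, clarify)
      fix A l A' l' assume A: "A \<in> rcosets L" "A' \<in> rcosets L" and l: "l \<in> L" "l' \<in> L"
        and eq: "K #> l #> \<rho> A = K #> l' #> \<rho> A'"
      have lc: "l \<in> carrier G" "l' \<in> carrier G" using l LG by auto
      note r = \<rho>[OF A(1)] \<rho>[OF A(2)]
      have "l \<otimes> \<rho> A \<in> K #> (l' \<otimes> \<rho> A')"
        using eq assoc[OF A(1) l(1)] assoc[OF A(2) l(2)] rcos_self[of "l \<otimes> \<rho> A" K] K(1) lc r by auto
      then obtain k where k: "k \<in> K" "l \<otimes> \<rho> A = k \<otimes> (l' \<otimes> \<rho> A')" by (auto simp: r_coset_def)
      have kc: "k \<in> carrier G" "k \<in> L" using k KG K(2) by auto
      have "l \<otimes> \<rho> A = (k \<otimes> l') \<otimes> \<rho> A'" using k kc lc r by (simp add: m_assoc)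
      moreover have "k \<otimes> l' \<in> L" using subgroup.m_closed[OF L] kc l by simp
      ultimately have "l \<otimes> \<rho> A \<in> A'" using r by (auto simp: r_coset_def)
      moreover have "l \<otimes> \<rho> A \<in> A" using r l by (auto simp: r_coset_def)
      ultimately have AA: "A = A'" using A rcos_disjoint[OF L] by (auto simp: pairwise_def disjnt_def)
      have "K #> l #> \<rho> A #> inv (\<rho> A) = K #> l' #> \<rho> A #> inv (\<rho> A)" using eq AA by simp
      then show "A = A' \<and> K #> l = K #> l'"
        using AA lc r KG by (simp add: coset_mult_assoc m_assoc)
    qed
    show "?f ` ((rcosets L) \<times> (#>) K ` L) = rcosets K"
    proof
      show "?f ` ((rcosets L) \<times> (#>) K ` L) \<subseteq> rcosets K"
        using assoc \<rho> LG rcosetsI[OF KG] by (auto simp: subset_iff)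
      show "rcosets K \<subseteq> ?f ` ((rcosets L) \<times> (#>) K ` L)"
      proof
        fix B assume "B \<in> rcosets K"
        then obtain x where x: "x \<in> carrier G" "B = K #> x" by (auto simp: RCOSETS_def)
        define A where "A = L #> x"
        have A: "A \<in> rcosets L" using x rcosetsI[OF LG] by (simp add: A_def)
        have "x \<in> L #> \<rho> A" using \<rho>[OF A] rcos_self[OF x(1) L] by (simp add: A_def)
        then obtain l where l: "l \<in> L" "x = l \<otimes> \<rho> A" by (auto simp: r_coset_def)
        then have "B = ?f (A, K #> l)" using assoc[OF A l(1)] x by simp
        then show "B \<in> ?f ` ((rcosets L) \<times> (#>) K ` L)" using A l by blast
      qed
    qed
  qed
  then have "card (rcosets K) = card ((rcosets L) \<times> (#>) K ` L)" by (metis bij_betw_same_card)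
  then show ?thesis by (simp add: subgroup_index_def card_cartesian_product)
qed

lemma subgroup_index_pos:
  assumes "finite_index_subgroup G L" shows "0 < subgroup_index G L"
proof -
  have "L #> \<one> \<in> rcosets L"
    using assms by (intro rcosetsI) (auto simp: finite_index_subgroup_def dest: subgroup.subset)
  then show ?thesis using assms by (auto simp: subgroup_index_def finite_index_subgroup_def card_gt_0_iff)
qed

lemma finite_index_carrier: "finite_index_subgroup G (carrier G)" "subgroup_index G (carrier G) = 1"
proof -
  have "rcosets (carrier G) = {carrier G}"
    using coset_join2[OF _ subgroup_self] by (auto simp: RCOSETS_def)
  then show "finite_index_subgroup G (carrier G)" "subgroup_index G (carrier G) = 1"
    using subgroup_self by (auto simp: finite_index_subgroup_def subgroup_index_def)
qed

text \<open>Schreier's lemma: the elements \<open>lb A x\<close> for generators \<open>x\<close> lie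
  in \<open>L\<close>, and \<open>lb\<close> telescopes on products, so every value of
  \<open>lb\<close> is generated by them.\<close>

lemma finitely_generated_finite_index:
  assumes "finitely_generated_group G" "finite_index_subgroup G L"
  obtains Y where "finite Y" "Y \<subseteq> L" "L \<subseteq> generate G Y"
proof -
  obtain Z where Z: "finite Z" "Z \<subseteq> carrier G" "generate G Z = carrier G"
    using assms(1) by (auto simp: finitely_generated_group_def)
  have L: "subgroup L G" "finite (rcosets L)" using assms(2) by (auto simp: finite_index_subgroup_def)
  have LG: "L \<subseteq> carrier G" using subgroup.subset[OF L(1)] .
  define \<rho> where "\<rho> A = (SOME x. x \<in> A)" for A :: "'a set"
  have \<rho>: "\<rho> A \<in> A \<and> \<rho> A \<in> carrier G \<and> L #> \<rho> A = A" if "A \<in> rcosets L" for A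
    unfolding \<rho>_def by (rule coset_representative[OF L(1) that])
  define lb where "lb A x = \<rho> A \<otimes> x \<otimes> inv (\<rho> (A #> x))" for A x
  have mult: "A #> x \<in> rcosets L" "A #> x #> y = A #> (x \<otimes> y)"
    if "A \<in> rcosets L" "x \<in> carrier G" "y \<in> carrier G" for A x y
  proof -
    obtain u where u: "u \<in> carrier G" "A = L #> u"
      using \<open>A \<in> rcosets L\<close> by (auto simp: RCOSETS_def)
    then have "A #> x = L #> (u \<otimes> x)" using coset_mult_assoc[OF LG] that by simp
    then show "A #> x \<in> rcosets L" using rcosetsI[OF LG] u that by simp
    have "A \<subseteq> carrier G" using r_coset_subset_G[OF LG] u by simp
    then show "A #> x #> y = A #> (x \<otimes> y)" using coset_mult_assoc that by simp
  qed
  have lb: "lb A x \<in> L" if "A \<in> rcosets L" "x \<in> carrier G" for A x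
  proof -
    note r = \<rho>[OF that(1)] \<rho>[OF mult(1)[OF that that(2)]]
    have "L #> (\<rho> A \<otimes> x) = L #> \<rho> (A #> x)" using r coset_mult_assoc[OF LG, of "\<rho> A" x] that by simp
    then have "\<rho> A \<otimes> x \<in> L #> \<rho> (A #> x)"
      using rcos_self[of "\<rho> A \<otimes> x" L] r that L(1) by simp
    then show ?thesis unfolding lb_def
      using subgroup.rcos_module_imp[OF L(1) is_group] r by blast
  qed
  define Y where "Y = (\<lambda>(A, x). lb A x) ` ((rcosets L) \<times> Z)"
  have Y: "finite Y" "Y \<subseteq> L" using L(2) Z lb by (auto simp: Y_def)
  have YG: "Y \<subseteq> carrier G" using Y LG by auto
  have all: "\<forall>A\<in>rcosets L. lb A g \<in> generate G Y" if "g \<in> generate G Z" for g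
    using that
  proof (induction rule: generate.induct)
    case one
    have "A #> \<one> = A" if "A \<in> rcosets L" for A
      using subgroup.rcosets_carrier[OF L(1) is_group that] by simp
    then show ?case using \<rho> by (auto simp: lb_def generate.one)
  next
    case (incl x)
    then show ?case by (auto simp: Y_def intro!: generate.incl)
  next
    case (inv x)
    show ?case
    proof
      fix A assume A: "A \<in> rcosets L"
      have x: "x \<in> carrier G" using inv Z by auto
      define B where "B = A #> inv x"
      have B: "B \<in> rcosets L" using mult(1)[OF A, of "inv x" \<one>] x by (simp add: B_def)
      have Bx: "B #> x = A" using mult(2)[OF A, of "inv x" x] x subgroup.rcosets_carrier[OF L(1) is_group A]
        by (simp add: B_def)
      have "lb A (inv x) = inv (lb B x)"
        using \<rho>[OF A] \<rho>[OF B] x Bx by (simp add: lb_def inv_mult_group m_assoc flip: B_def)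
      moreover have "lb B x \<in> Y" using B inv by (auto simp: Y_def)
      ultimately show "lb A (inv x) \<in> generate G Y" by (simp add: generate.inv)
    qed
  next
    case (eng x y)
    show ?case
    proof
      fix A assume A: "A \<in> rcosets L"
      have x: "x \<in> carrier G" "y \<in> carrier G" using eng.hyps Z(3) by auto
      have B: "A #> x \<in> rcosets L" using mult(1)[OF A x] .
      have C: "A #> (x \<otimes> y) \<in> rcosets L" using mult(1)[OF A, of "x \<otimes> y" \<one>] x by simp
      have "lb A x \<otimes> lb (A #> x) y = lb A (x \<otimes> y)"
        using \<rho>[OF A] \<rho>[OF B] \<rho>[OF C] x mult(2)[OF A x]
        by (simp add: lb_def m_assoc) (simp add: m_assoc[symmetric])
      then show "lb A (x \<otimes> y) \<in> generate G Y"
        using generate.eng[of "lb A x" G Y "lb (A #> x) y"] eng.IH A B by simp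
    qed
  qed
  have "L \<subseteq> generate G Y"
  proof
    fix g assume g: "g \<in> L"
    have LL: "L \<in> rcosets L" using rcosetsI[OF LG one_closed] coset_mult_one[OF LG] by simp
    note r = \<rho>[OF LL]
    have gc: "g \<in> carrier G" using g LG by auto
    \<comment> \<open>The representative of the coset \<open>L\<close> itself need not be
      \<open>\<one>\<close>; conjugating by it gives an element with
      \<open>lb L k = g\<close>.\<close>
    define k where "k = inv (\<rho> L) \<otimes> g \<otimes> \<rho> L"
    have k: "k \<in> L" "k \<in> carrier G"
      using r g gc subgroup.m_closed[OF L(1)] subgroup.m_inv_closed[OF L(1)] by (simp_all add: k_def)
    have "L #> k = L" using coset_join2[OF k(2) L(1) k(1)] .
    then have "lb L k = g" using r gc by (simp add: lb_def k_def m_assoc) (simp add: m_assoc[symmetric])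
    then show "g \<in> generate G Y" using all[of k] k Z(3) LL by auto
  qed
  then show thesis using that Y by blast
qed

text \<open>Suppose \<open>s\<close> in the basis occurs in no word chosen for the finitely many
  generators. The potential that changes exactly across the edges of \<open>s\<close> is then
  unchanged by all generators, hence by all of \<open>L\<close>, which contains
  \<open>s\<close>.\<close>

lemma finite_free_basis:
  assumes fg: "finitely_generated_group G" and fi: "finite_index_subgroup G L"
    and free: "free_group (G\<lparr>carrier := L\<rparr>)"
  shows "\<exists>S. finite S \<and> free_generating_set (G\<lparr>carrier := L\<rparr>) S"
proof -
  let ?L = "G\<lparr>carrier := L\<rparr>"
  have L: "subgroup L G" using fi by (simp add: finite_index_subgroup_def)
  have LG: "L \<subseteq> carrier G" using subgroup.subset[OF L] .
  interpret L: group ?L by (rule subgroup.subgroup_is_group[OF L is_group])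
  obtain S where S: "free_generating_set ?L S" using free by (auto simp: free_group_def)
  have SL: "S \<subseteq> L" using S by (simp add: free_generating_set_def)
  obtain Y where Y: "finite Y" "Y \<subseteq> L" "L \<subseteq> generate G Y"
    using finitely_generated_finite_index[OF fg fi] .
  have "\<exists>w. w \<in> words_on S \<and> word_value G w = y" if "y \<in> Y" for y
  proof -
    have "y \<in> word_value ?L ` reduced_words_on S"
      using S Y(2) that by (auto simp: free_generating_set_def bij_betw_def)
    then show ?thesis using word_value_subgroup[OF L words_on_mono[OF SL]]
      by (auto simp: reduced_words_on_def)
  qed
  then obtain w where w: "\<And>y. y \<in> Y \<Longrightarrow> w y \<in> words_on S \<and> word_value G (w y) = y" by metis
  define S0 where "S0 = (\<Union>y\<in>Y. snd ` set (w y))"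
  have "finite S0" using Y(1) by (simp add: S0_def)
  moreover have "S \<subseteq> S0"
  proof (rule ccontr)
    assume "\<not> S \<subseteq> S0"
    then obtain s where s: "s \<in> S" "s \<notin> S0" by blast
    have "\<exists>p :: 'a \<Rightarrow> bool. \<forall>\<omega>\<in>L. \<forall>t\<in>S. (p \<omega> \<noteq> p (\<omega> \<otimes> t)) = (t = s)"
      by (rule L.free_potential[OF S, where r = "\<lambda>\<omega> g. \<omega> \<otimes> g" and \<beta> = "\<lambda>_. \<one>" and \<gamma> = "\<lambda>\<omega>. \<omega>"])
        (use LG subgroup.m_closed[OF L] subgroup.one_closed[OF L] in \<open>auto simp: m_assoc subset_iff\<close>)
    then obtain p :: "'a \<Rightarrow> bool" where p: "\<And>\<omega> t. \<omega> \<in> L \<Longrightarrow> t \<in> S \<Longrightarrow> (p \<omega> \<noteq> p (\<omega> \<otimes> t)) = (t = s)"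
      by metis
    have word: "p (\<omega> \<otimes> word_value G v) = p \<omega>" if "\<omega> \<in> L" "v \<in> words_on (S \<inter> S0)" for \<omega> v
      using that
    proof (induction v arbitrary: \<omega>)
      case Nil
      then show ?case using LG by auto
    next
      case (Cons x v)
      obtain b t where x: "x = (b, t)" by (cases x)
      let ?t = "if b then t else inv t"
      have t: "t \<in> S" "t \<in> S0" "t \<in> L" "t \<in> carrier G" "v \<in> words_on (S \<inter> S0)" "\<omega> \<in> carrier G"
        using Cons.prems x SL LG by auto
      have tL: "?t \<in> L" "?t \<in> carrier G" using t subgroup.m_inv_closed[OF L] by auto
      have \<omega>t: "\<omega> \<otimes> ?t \<in> L" using subgroup.m_closed[OF L Cons.prems(1) tL(1)] .
      have ts: "t \<noteq> s" using t s by auto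
      have 1: "p (\<omega> \<otimes> ?t) = p \<omega>"
      proof (cases b)
        case True
        then show ?thesis using p[OF Cons.prems(1) t(1)] ts by auto
      next
        case False
        then have "\<omega> \<otimes> ?t \<otimes> t = \<omega>" using t by (simp add: m_assoc)
        then show ?thesis using p[OF \<omega>t t(1)] ts by auto
      qed
      have "v \<in> words_on (carrier G)" using words_on_mono[OF _ t(5), of "carrier G"] SL LG by blast
      then have "\<omega> \<otimes> word_value G (x # v) = \<omega> \<otimes> ?t \<otimes> word_value G v"
        using t tL word_value_closed by (simp add: x m_assoc)
      then show ?case using Cons.IH[OF \<omega>t t(5)] 1 by simp
    qed
    have Yp: "p (\<omega> \<otimes> y) = p \<omega>" if "\<omega> \<in> L" "y \<in> Y" for \<omega> y
    proof -
      have "w y \<in> words_on (S \<inter> S0)"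
      proof -
        have "snd x \<in> S0" if "x \<in> set (w y)" for x using that \<open>y \<in> Y\<close> by (auto simp: S0_def)
        moreover have "snd x \<in> S" if "x \<in> set (w y)" for x
          using w[OF \<open>y \<in> Y\<close>] that by (auto simp: words_on_def in_lists_conv_set)
        ultimately show ?thesis by (auto simp: words_on_def in_lists_conv_set mem_Times_iff)
      qed
      then show ?thesis using word[OF that(1)] w[OF that(2)] by metis
    qed
    have "g \<in> L \<and> (\<forall>\<omega>\<in>L. p (\<omega> \<otimes> g) = p \<omega>)" if "g \<in> generate G Y" for g
      using that
    proof (induction rule: generate.induct)
      case one
      then show ?case using subgroup.one_closed[OF L] LG by auto
    next
      case (incl y)
      then show ?case using Y Yp by auto
    next
      case (inv y)
      have y: "y \<in> L" "y \<in> carrier G" using inv Y LG by auto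
      have "p (\<omega> \<otimes> inv y) = p \<omega>" if "\<omega> \<in> L" for \<omega>
      proof -
        have "\<omega> \<otimes> inv y \<in> L" using that y subgroup.m_closed[OF L] subgroup.m_inv_closed[OF L] by simp
        moreover have "\<omega> \<otimes> inv y \<otimes> y = \<omega>" using that LG y by (auto simp: m_assoc)
        ultimately show ?thesis using Yp[of "\<omega> \<otimes> inv y" y] inv by simp
      qed
      then show ?case using y subgroup.m_inv_closed[OF L] by simp
    next
      case (eng g k)
      have "p (\<omega> \<otimes> (g \<otimes> k)) = p \<omega>" if "\<omega> \<in> L" for \<omega>
      proof -
        have "\<omega> \<otimes> (g \<otimes> k) = \<omega> \<otimes> g \<otimes> k" using that eng.IH LG by (simp add: m_assoc subset_iff)
        then show ?thesis using eng.IH that subgroup.m_closed[OF L] by simp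
      qed
      then show ?case using eng.IH subgroup.m_closed[OF L] by simp
    qed
    then have "p (\<one> \<otimes> s) = p \<one>" using Y(3) SL s(1) subgroup.one_closed[OF L] by blast
    then show False using p[OF subgroup.one_closed[OF L] s(1)] by simp
  qed
  ultimately show ?thesis using S finite_subset by blast
qed

end

context invariant_polymatroid
begin

text \<open>On the one-vertex graph with a loop for each element of \<open>S\<close>, the next ball
  is a splitting of the present one.\<close>

lemma basis_F_decreasing:
  assumes S: "finite S" "S \<subseteq> carrier G" and w: "w \<in> W"
  shows "basis_F S w (Suc n) \<le> basis_F S w n"
proof -
  define \<Delta> :: "(unit, 'a, 'a, unit) lgraph" where
    "\<Delta> = \<lparr>verts = UNIV, edges = S, src = (\<lambda>_. ()), tgt = (\<lambda>_. ()), lab = id, pos = id\<rparr>"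
  have \<Delta>: "verts \<Delta> = UNIV" "edges \<Delta> = S" "src \<Delta> = (\<lambda>_. ())" "tgt \<Delta> = (\<lambda>_. ())" "lab \<Delta> = id"
    by (auto simp: \<Delta>_def)
  have F: "graph_F \<Delta> (\<lambda>_. orbit_ball S w n) = basis_F S w n" for n
    by (simp add: graph_F_def basis_F_def \<Delta> UNIV_unit)
  have fin: "fin (orbit_ball S w n)" for n by (rule fin_orbit_ball[OF S w])
  have "graph_F \<Delta> (\<lambda>_. orbit_ball S w (Suc n)) \<le> graph_F \<Delta> (\<lambda>_. orbit_ball S w n)"
  proof (rule graph_F_splitting)
    show "wf_graph \<Delta>" using S by (auto simp: wf_graph_def \<Delta>)
    fix i v assume v: "v \<in> orbit_ball S w (Suc n) - orbit_ball S w n"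
    then obtain y where y: "y \<in> word_ball G S (Suc n)" "v = a y w" by (auto simp: orbit_ball_def)
    from y(1) show "(\<exists>d\<in>edges \<Delta>. src \<Delta> d = i \<and> v \<in> a (lab \<Delta> d) ` orbit_ball S w n) \<or>
      (\<exists>d\<in>edges \<Delta>. tgt \<Delta> d = i \<and> v \<in> a (inv (lab \<Delta> d)) ` orbit_ball S w n)"
    proof (cases rule: word_ball_SucE)
      case 1
      then show ?thesis using v y by (auto simp: orbit_ball_def)
    next
      case (2 b s z)
      let ?s = "if b then s else inv s"
      have "?s \<in> carrier G" "z \<in> carrier G"
        using 2 S word_ball_closed[OF S(2), of n] by auto
      then have "v = a ?s (a z w)" "a z w \<in> orbit_ball S w n"
        using y 2 w by (auto simp: orbit_ball_def a_mult)
      then have "v \<in> a ?s ` orbit_ball S w n" by blast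
      then show ?thesis using 2(1) by (cases b) (auto simp: \<Delta>)
    qed
  qed (use fin orbit_ball_mono[of n "Suc n" S w] in \<open>auto simp: labelling_def\<close>)
  then show ?thesis by (simp add: F)
qed

end

section \<open>Passage to partitions and limits\<close>

section \<open>The f-invariant\<close>

lemma partition_fibres: "partition_on (space M) (fibres M f)"
  unfolding fibres_alt by (rule partition_onI) (auto simp: disjnt_def)

lemma countable_measurable_partition_fibres:
  assumes "discrete_rv M f" shows "countable_measurable_partition M (fibres M f)"
  using assms partition_fibres[of M f]
  by (auto simp: countable_measurable_partition_def fibres_def discrete_rv_def)

context pmp_system
begin

text \<open>Each group element is \<open>l \<otimes> t\<close> with \<open>l \<in> L\<close> and
  \<open>t\<close> one of finitely many coset representatives. The join of the translates of
  \<open>\<alpha>\<close> by these \<open>t\<close> has finite entropy, and its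
  \<open>L\<close>-translates recover all translates of \<open>\<alpha>\<close>.\<close>

lemma finite_index_generating_partition:
  assumes L: "finite_index_subgroup G L" and \<alpha>: "finite_entropy_generating_partition G M \<phi> \<alpha>"
  shows "\<exists>\<beta>. finite_entropy_generating_partition (G\<lparr>carrier := L\<rparr>) M \<phi> \<beta>"
proof -
  let ?L = "G\<lparr>carrier := L\<rparr>"
  have Ls: "subgroup L G" "finite (rcosets L)" using L by (auto simp: finite_index_subgroup_def)
  have LG: "L \<subseteq> carrier G" using subgroup.subset[OF Ls(1)] .
  have \<alpha>c: "countable_measurable_partition M \<alpha>" "shannon_entropy M \<alpha> < \<infinity>"
    and gen: "\<And>E. E \<in> sets M \<Longrightarrow>
      \<exists>C\<in>invariant_sigma_algebra G M \<phi> hull \<alpha>. sym_diff E C \<in> null_sets M"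
    using \<alpha> by (auto simp: finite_entropy_generating_partition_def generating_partition_def)
  define z where "z = cell_of M \<alpha>"
  have z: "z \<in> rvs" unfolding z_def by (rule cell_of_in_rvs[OF \<alpha>c])
  define \<rho> where "\<rho> A = (SOME x. x \<in> A)" for A :: "'g set"
  have \<rho>: "\<rho> A \<in> A \<and> \<rho> A \<in> carrier G \<and> L #> \<rho> A = A" if "A \<in> rcosets L" for A
    unfolding \<rho>_def by (rule coset_representative[OF Ls(1) that])
  define A where "A = (\<lambda>B. shift (\<rho> B) z) ` (rcosets L)"
  have A: "finite A" "A \<subseteq> rvs" using Ls(2) \<rho> z shift_in_rvs by (auto simp: A_def)
  define \<beta> where "\<beta> = fibres M (joint A)"
  have fA: "finite_ent (joint A)" by (rule finite_ent_joint[OF A])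
  then have \<beta>c: "countable_measurable_partition M \<beta>" "shannon_entropy M \<beta> < \<infinity>"
    unfolding \<beta>_def by (auto simp: finite_ent_def countable_measurable_partition_fibres shannon_entropy_finite_ent)
  have sub: "invariant_sigma_algebra G M \<phi> hull \<alpha> \<subseteq> invariant_sigma_algebra ?L M \<phi> hull \<beta>"
  proof -
    let ?F = "\<Union>f\<in>(\<lambda>y. shift y z) ` carrier G. fibres M f"
    have "sigma_sets (space M) ?F \<subseteq> \<A>"
      if inv: "invariant_sigma_algebra ?L M \<phi> \<A>" and \<beta>: "\<beta> \<subseteq> \<A>" for \<A>
    proof -
      interpret \<A>: sigma_algebra "space M" \<A> using inv by (simp add: invariant_sigma_algebra_def)
      have "?F \<subseteq> \<A>"
      proof
        fix E assume "E \<in> ?F"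
        then obtain y where y: "y \<in> carrier G" "E \<in> fibres M (shift y z)" by auto
        have B: "L #> y \<in> rcosets L" using rcosetsI[OF LG y(1)] .
        define t where "t = \<rho> (L #> y)"
        have t: "t \<in> carrier G" "y \<in> L #> t" "shift t z \<in> A"
          using \<rho>[OF B] rcos_self[OF y(1) Ls(1)] B by (auto simp: t_def A_def)
        obtain l where l: "l \<in> L" "y = l \<otimes> t" using t(2) by (auto simp: r_coset_def)
        have lc: "l \<in> carrier G" using l LG by auto
        have "shift y z = shift l (shift t z)" using a_mult[OF lc t(1) z] l by simp
        moreover have "fibres M (shift l (shift t z)) = translate_partition \<phi> l (fibres M (shift t z))"
          unfolding translate_fibres[OF lc] by (rule fibres_cong) simp
        ultimately obtain D where D: "D \<in> fibres M (shift t z)" "E = \<phi> l ` D"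
          using y(2) by (auto simp: translate_partition_def)
        \<comment> \<open>\<open>\<beta>\<close> refines the fibres of \<open>shift t z\<close> and
          is countable, which places \<open>D\<close> in \<open>\<A>\<close>.\<close>
        have "D = \<Union>{B \<in> \<beta>. B \<subseteq> D}"
        proof
          show "D \<subseteq> \<Union>{B \<in> \<beta>. B \<subseteq> D}"
          proof
            fix x assume x: "x \<in> D"
            then have xs: "x \<in> space M" using D(1) by (auto simp: fibres_alt)
            have Dx: "D = {u \<in> space M. shift t z u = shift t z x}" by (rule fibre_eq[OF D(1) x])
            let ?B = "{u \<in> space M. joint A u = joint A x}"
            have "?B \<in> \<beta>" using xs by (auto simp: \<beta>_def fibres_alt)
            moreover have "?B \<subseteq> D"
            proof
              fix u assume "u \<in> ?B"
              then show "u \<in> D" unfolding Dx joint_eq_iff using t(3) by blast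
            qed
            ultimately show "x \<in> \<Union>{B \<in> \<beta>. B \<subseteq> D}" using xs by blast
          qed
        qed blast
        moreover have "\<Union>{B \<in> \<beta>. B \<subseteq> D} \<in> \<A>"
        proof (rule \<A>.countable_Union)
          have "countable \<beta>" using \<beta>c by (simp add: countable_measurable_partition_def)
          then show "countable {B \<in> \<beta>. B \<subseteq> D}" by (rule countable_subset[rotated]) auto
        qed (use \<beta> in auto)
        ultimately have "D \<in> \<A>" by simp
        then show "E \<in> \<A>" using inv l(1) D(2) by (simp add: invariant_sigma_algebra_def)
      qed
      then show ?thesis by (rule \<A>.sigma_sets_subset)
    qed
    then have 1: "sigma_sets (space M) ?F \<subseteq> invariant_sigma_algebra ?L M \<phi> hull \<beta>"
      unfolding hull_def by blast
    have "shift \<one> z = z" using z by simp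
    then have "\<alpha> \<subseteq> ?F" using fibres_cell_of[OF \<alpha>c(1)] by (metis UN_upper image_eqI one_closed z_def)
    then have "\<alpha> \<subseteq> sigma_sets (space M) ?F" using sigma_sets.Basic by blast
    moreover have "invariant_sigma_algebra G M \<phi> (sigma_sets (space M) ?F)"
      using sigma_sets_shifts_invariant[OF subgroup_self z] by simp
    ultimately have "invariant_sigma_algebra G M \<phi> hull \<alpha> \<subseteq> sigma_sets (space M) ?F"
      by (rule hull_minimal)
    then show ?thesis using 1 by blast
  qed
  have "finite_entropy_generating_partition ?L M \<phi> \<beta>"
    unfolding finite_entropy_generating_partition_def generating_partition_def
    using \<beta>c gen sub by blast
  then show ?thesis ..
qed

lemma F_entropy_word_ball:
  assumes L: "subgroup L G" and S: "finite S" "S \<subseteq> L"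
    and \<alpha>: "countable_measurable_partition M \<alpha>" "shannon_entropy M \<alpha> < \<infinity>"
  shows "F_entropy M \<phi> S (join_translates \<phi> (word_ball (G\<lparr>carrier := L\<rparr>) S n) \<alpha>) =
    ereal (basis_F S (cell_of M \<alpha>) n)"
proof -
  let ?z = "cell_of M \<alpha>"
  have z: "?z \<in> rvs" by (rule cell_of_in_rvs[OF \<alpha>])
  have SG: "S \<subseteq> carrier G" using S subgroup.subset[OF L] by auto
  have ball: "word_ball (G\<lparr>carrier := L\<rparr>) S n = word_ball G S n" by (rule word_ball_subgroup[OF L S(2)])
  have "word_ball G S n \<noteq> {}" using one_in_word_ball by blast
  from join_translates_fibres[OF this word_ball_closed[OF SG], of ?z]
  have "join_translates \<phi> (word_ball G S n) \<alpha> = fibres M (joint (orbit_ball S ?z n))"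
    by (simp add: fibres_cell_of[OF \<alpha>(1)] orbit_ball_def)
  moreover have "fin (orbit_ball S ?z n)" by (rule fin_orbit_ball[OF S(1) SG z])
  ultimately show ?thesis unfolding ball basis_F_def 
    using F_entropy_eq[of "orbit_ball S ?z n" S] S(1) SG by simp
qed

lemma has_f_invariant_basis_F:
  assumes L: "subgroup L G" and v: "has_f_invariant (G\<lparr>carrier := L\<rparr>) M \<phi> v"
  obtains S and z :: "'x \<Rightarrow> 'x set" where "finite S" "free_generating_set (G\<lparr>carrier := L\<rparr>) S" "S \<subseteq> carrier G" "z \<in> rvs"
    "\<forall>f\<in>rvs. determined_by ((\<lambda>y. shift y z) ` L) f"
    "(\<lambda>n. ereal (basis_F S z n)) \<longlonglongrightarrow> v"
proof -
  obtain S \<alpha> where S: "finite S" "free_generating_set (G\<lparr>carrier := L\<rparr>) S"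
    and \<alpha>: "finite_entropy_generating_partition (G\<lparr>carrier := L\<rparr>) M \<phi> \<alpha>"
    and lim: "(\<lambda>n. F_entropy M \<phi> S (join_translates \<phi> (word_ball (G\<lparr>carrier := L\<rparr>) S n) \<alpha>)) \<longlonglongrightarrow> v"
    using v by (auto simp: has_f_invariant_def)
  have SL: "S \<subseteq> L" using S by (simp add: free_generating_set_def)
  have \<alpha>c: "countable_measurable_partition M \<alpha>" "shannon_entropy M \<alpha> < \<infinity>"
    using \<alpha> by (auto simp: finite_entropy_generating_partition_def generating_partition_def)
  show thesis
    using S SL subgroup.subset[OF L] generating_determines[OF L \<alpha>] lim
      F_entropy_word_ball[OF L S(1) SL \<alpha>c] cell_of_in_rvs[OF \<alpha>c]
    by (intro that[of S "cell_of M \<alpha>"]) auto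
qed

text \<open>The stages decrease, so they converge to their infimum in \<open>ereal\<close>, possibly
  minus infinity.\<close>

lemma f_invariant_exists:
  assumes L: "subgroup L G" and "f_invariant_defined (G\<lparr>carrier := L\<rparr>) M \<phi>"
  shows "\<exists>v. has_f_invariant (G\<lparr>carrier := L\<rparr>) M \<phi> v"
proof -
  obtain S \<alpha> where S: "finite S" "free_generating_set (G\<lparr>carrier := L\<rparr>) S"
    and \<alpha>: "finite_entropy_generating_partition (G\<lparr>carrier := L\<rparr>) M \<phi> \<alpha>"
    using assms(2) by (auto simp: f_invariant_defined_def)
  have SL: "S \<subseteq> L" using S by (simp add: free_generating_set_def)
  have SG: "S \<subseteq> carrier G" using SL subgroup.subset[OF L] by auto
  have \<alpha>c: "countable_measurable_partition M \<alpha>" "shannon_entropy M \<alpha> < \<infinity>"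
    using \<alpha> by (auto simp: finite_entropy_generating_partition_def generating_partition_def)
  have "decseq (\<lambda>n. ereal (basis_F S (cell_of M \<alpha>) n))"
    using basis_F_decreasing[OF S(1) SG cell_of_in_rvs[OF \<alpha>c]] by (intro decseq_SucI) simp
  from LIMSEQ_INF[OF this] show ?thesis
    unfolding has_f_invariant_def
    by (intro exI[of _ S] exI[of _ \<alpha>] exI conjI S \<alpha>) (simp add: F_entropy_word_ball[OF L S(1) SL \<alpha>c])
qed

text \<open>\<open>two_subgroups_inequality\<close> bounds some stage for \<open>K\<close> by an
  arbitrary stage \<open>m\<close> for \<open>L\<close>. The stages for \<open>K\<close> decrease,
  so \<open>v\<close> lies below each of them, and the limit over \<open>m\<close> brings in
  \<open>u\<close>. Division by the index of \<open>L \<inter> K\<close> turns coset counts into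
  indices.\<close>

lemma f_invariant_le:
  assumes L: "finite_index_subgroup G L" and K: "finite_index_subgroup G K"
    and u: "has_f_invariant (G\<lparr>carrier := L\<rparr>) M \<phi> u" and v: "has_f_invariant (G\<lparr>carrier := K\<rparr>) M \<phi> v"
  shows "ereal (1 / subgroup_index G K) * v \<le> ereal (1 / subgroup_index G L) * u"
proof -
  have Ls: "subgroup L G" and Ks: "subgroup K G" using L K by (auto simp: finite_index_subgroup_def)
  have LK: "subgroup (L \<inter> K) G" "finite (rcosets (L \<inter> K))"
    using finite_index_Int[OF L K] by (auto simp: finite_index_subgroup_def)
  have LG: "L \<subseteq> carrier G" "K \<subseteq> carrier G" "L \<inter> K \<subseteq> carrier G"
    using subgroup.subset[OF Ls] subgroup.subset[OF Ks] by auto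
  have fin: "finite ((#>) (L \<inter> K) ` L)" "finite ((#>) (L \<inter> K) ` K)"
    using LK(2) rcosetsI[OF LG(3)] LG by (auto elim!: finite_subset[rotated])
  obtain S and z :: "'x \<Rightarrow> 'x set" where S: "finite S" "free_generating_set (G\<lparr>carrier := L\<rparr>) S" "S \<subseteq> carrier G"
    and z: "z \<in> rvs" "\<forall>f\<in>rvs. determined_by ((\<lambda>y. shift y z) ` L) f"
    and limS: "(\<lambda>n. ereal (basis_F S z n)) \<longlonglongrightarrow> u"
    using has_f_invariant_basis_F[OF Ls u] .
  obtain T and w :: "'x \<Rightarrow> 'x set" where T: "finite T" "free_generating_set (G\<lparr>carrier := K\<rparr>) T" "T \<subseteq> carrier G"
    and w: "w \<in> rvs" "\<forall>f\<in>rvs. determined_by ((\<lambda>y. shift y w) ` K) f"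
    and limT: "(\<lambda>n. ereal (basis_F T w n)) \<longlonglongrightarrow> v"
    using has_f_invariant_basis_F[OF Ks v] .
  define cL where "cL = real (card ((#>) (L \<inter> K) ` L))"
  define cK where "cK = real (card ((#>) (L \<inter> K) ` K))"
  have "L \<noteq> {}" "K \<noteq> {}" using subgroup.one_closed[OF Ls] subgroup.one_closed[OF Ks] by auto
  then have c: "0 < cL" "0 < cK" using fin by (auto simp: cL_def cK_def card_gt_0_iff)
  have "decseq (\<lambda>n. ereal (basis_F T w n))"
    using basis_F_decreasing[OF T(1,3) w(1)] by (intro decseq_SucI) simp
  then have v_le: "v \<le> ereal (basis_F T w n)" for n using limT by (rule decseq_ge)
  have "ereal cK * v \<le> ereal (cL * basis_F S z m)" for m
  proof (rule ereal_le_epsilon2)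
    fix \<epsilon> :: real assume "0 < \<epsilon>"
    then obtain n where n: "cK * basis_F T w n \<le> cL * basis_F S z m + \<epsilon>"
      using two_subgroups_inequality[OF Ls Ks fin S(1,2) T(1,2)
          z(1) bspec[OF z(2)] w(1) bspec[OF w(2)] joint_ent_empty, of \<epsilon> m]
      by (auto simp: cL_def cK_def)
    have "ereal cK * v \<le> ereal cK * ereal (basis_F T w n)"
      using c v_le by (intro ereal_mult_left_mono) auto
    also have "\<dots> \<le> ereal (cL * basis_F S z m) + ereal \<epsilon>" using n by simp
    finally show "ereal cK * v \<le> ereal (cL * basis_F S z m) + ereal \<epsilon>" .
  qed
  moreover have "(\<lambda>m. ereal cL * ereal (basis_F S z m)) \<longlonglongrightarrow> ereal cL * u"
    using limS by (intro tendsto_cmult_ereal) auto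
  ultimately have le: "ereal cK * v \<le> ereal cL * u"
    by (intro LIMSEQ_le_const[where X = "\<lambda>m. ereal cL * ereal (basis_F S z m)"]) auto
  let ?i = "real (subgroup_index G (L \<inter> K))"
  have i: "?i = subgroup_index G L * cL" "?i = subgroup_index G K * cK" "0 < ?i"
  proof -
    show "?i = subgroup_index G L * cL"
      unfolding index_mult[OF Ls LK(1) Int_lower1] cL_def by simp
    show "?i = subgroup_index G K * cK"
      unfolding index_mult[OF Ks LK(1) Int_lower2] cK_def by simp
    show "0 < ?i" using subgroup_index_pos[OF finite_index_Int[OF L K]] by simp
  qed
  have "1 / real (subgroup_index G K) = 1 / ?i * cK" unfolding i(2) using c by simp
  moreover have "1 / real (subgroup_index G L) = 1 / ?i * cL" unfolding i(1) using c by simp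
  moreover have "ereal (1 / ?i) * (ereal cK * v) \<le> ereal (1 / ?i) * (ereal cL * u)"
    using le by (intro ereal_mult_left_mono) auto
  ultimately show ?thesis by (simp flip: mult.assoc)
qed

text \<open>Antisymmetry of \<open>f_invariant_le\<close>. Applied with both subgroups equal, it
  also gives uniqueness of the value, so that the definite description denotes.\<close>

lemma f_invariant_eq:
  assumes "finite_index_subgroup G L" "finite_index_subgroup G K"
    and "f_invariant_defined (G\<lparr>carrier := L\<rparr>) M \<phi>" "f_invariant_defined (G\<lparr>carrier := K\<rparr>) M \<phi>"
  shows "ereal (1 / subgroup_index G L) * f_invariant (G\<lparr>carrier := L\<rparr>) M \<phi> =
    ereal (1 / subgroup_index G K) * f_invariant (G\<lparr>carrier := K\<rparr>) M \<phi>"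
proof -
  have "has_f_invariant (G\<lparr>carrier := L\<rparr>) M \<phi> (f_invariant (G\<lparr>carrier := L\<rparr>) M \<phi>)"
    if L: "finite_index_subgroup G L" and df: "f_invariant_defined (G\<lparr>carrier := L\<rparr>) M \<phi>" for L
  proof -
    have "subgroup L G" using L by (simp add: finite_index_subgroup_def)
    then obtain v where v: "has_f_invariant (G\<lparr>carrier := L\<rparr>) M \<phi> v"
      using f_invariant_exists[OF _ df] by blast
    have "u = v" if u: "has_f_invariant (G\<lparr>carrier := L\<rparr>) M \<phi> u" for u
    proof -
      let ?i = "real (subgroup_index G L)"
      have i: "0 < ?i" using subgroup_index_pos[OF L] by simp
      have "ereal (1 / ?i) * u = ereal (1 / ?i) * v"
        using f_invariant_le[OF L L u v] f_invariant_le[OF L L v u] by (rule antisym[rotated])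
      then have "ereal ?i * (ereal (1 / ?i) * u) = ereal ?i * (ereal (1 / ?i) * v)" by simp
      then show ?thesis using i by (simp flip: mult.assoc)
    qed
    then show ?thesis unfolding f_invariant_def using v by (metis (mono_tags, lifting) theI)
  qed
  then show ?thesis using assms by (intro antisym f_invariant_le)
qed

end

theorem corollary1p6:
  fixes \<Gamma> :: "('g, 'm) monoid_scheme"
    and M :: "'x measure"
    and \<phi> :: "'g \<Rightarrow> 'x \<Rightarrow> 'x"
    and G H :: "'g set"
  assumes "finitely_generated_group \<Gamma>"
    and "virtually_free_group \<Gamma>"
    and "standard_prob_space M"
    and "pmp_action \<Gamma> M \<phi>"
    and "finite_index_subgroup \<Gamma> G" and "free_group (\<Gamma>\<lparr>carrier := G\<rparr>)"
    and "finite_index_subgroup \<Gamma> H" and "free_group (\<Gamma>\<lparr>carrier := H\<rparr>)"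
    and "\<exists>\<alpha>. finite_entropy_generating_partition \<Gamma> M \<phi> \<alpha>"
  shows "f_invariant_defined (\<Gamma>\<lparr>carrier := G\<rparr>) M \<phi> \<and>
         f_invariant_defined (\<Gamma>\<lparr>carrier := H\<rparr>) M \<phi> \<and>
         ereal (1 / real (subgroup_index \<Gamma> G)) * f_invariant (\<Gamma>\<lparr>carrier := G\<rparr>) M \<phi> =
         ereal (1 / real (subgroup_index \<Gamma> H)) * f_invariant (\<Gamma>\<lparr>carrier := H\<rparr>) M \<phi> \<and>
         (free_group \<Gamma> \<longrightarrow>
            f_invariant_defined \<Gamma> M \<phi> \<and>
            ereal (1 / real (subgroup_index \<Gamma> G)) * f_invariant (\<Gamma>\<lparr>carrier := G\<rparr>) M \<phi> =
            f_invariant \<Gamma> M \<phi> \<and>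
            ereal (1 / real (subgroup_index \<Gamma> H)) * f_invariant (\<Gamma>\<lparr>carrier := H\<rparr>) M \<phi> =
            f_invariant \<Gamma> M \<phi>)"
proof -
  have "group \<Gamma>" using assms(1) by (simp add: finitely_generated_group_def)
  moreover have "prob_space M" using assms(3) by (simp add: standard_prob_space_def)
  ultimately interpret pmp_system M \<Gamma> \<phi>
    using assms(4) by (intro pmp_system.intro pmp_system_axioms.intro)
  have dfd: "f_invariant_defined (\<Gamma>\<lparr>carrier := L\<rparr>) M \<phi>"
    if "finite_index_subgroup \<Gamma> L" "free_group (\<Gamma>\<lparr>carrier := L\<rparr>)" for L
    unfolding f_invariant_defined_def
    using finite_free_basis[OF assms(1) that] finite_index_generating_partition[OF that(1)] assms(9)
    by blast
  note G = assms(5,6) and H = assms(7,8)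
  note fG = dfd[OF G] and fH = dfd[OF H]
  have self: "\<Gamma>\<lparr>carrier := carrier \<Gamma>\<rparr> = \<Gamma>" by simp
  have "f_invariant_defined \<Gamma> M \<phi>" if "free_group \<Gamma>"
    using dfd[OF finite_index_carrier(1)] that by simp
  \<comment> \<open>A free ambient group is its own subgroup of index one, so this is the comparison
    with the whole group.\<close>
  moreover have "ereal (1 / real (subgroup_index \<Gamma> L)) * f_invariant (\<Gamma>\<lparr>carrier := L\<rparr>) M \<phi> =
      f_invariant \<Gamma> M \<phi>"
    if "free_group \<Gamma>" "finite_index_subgroup \<Gamma> L" "free_group (\<Gamma>\<lparr>carrier := L\<rparr>)" for L
    using f_invariant_eq[OF that(2) finite_index_carrier(1) dfd[OF that(2,3)]]
      dfd[OF finite_index_carrier(1)] that(1) finite_index_carrier(2)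
    by (simp add: one_ereal_def[symmetric])
  ultimately show ?thesis
    using fG fH f_invariant_eq[OF G(1) H(1) fG fH] G H by blast
qed

end
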